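(* Let $G_1$ and $G_2$ be second countable locally compact groups, and let $J_1\subseteq A(G_1)$ and $J_2\subseteq A(G_2)$ be closed ideals. Set $$J=\overline{J_1\otimes A(G_2)+A(G_1)\otimes J_2}^{\|\cdot\|_A}\subseteq A(G_1\times G_2).$$ The following are equivalent: (i) $J_1$ and $J_2$ are ideals of multiplicity; (ii) $J$ is an ideal of multiplicity.
   Context: For a second countable locally compact group $G$, $C_r^*(G)\subseteq \mathcal{B}(L^2(G))$ is the reduced C*-algebra of $G$ (the operator norm closure of $\lambda(L^1(G))$, where $\lambda$ is the left regular representation with respect to a fixed left Haar measure) and $\mathrm{VN}(G)$ is its weak* closure. The Fourier algebra $A(G)$ consists of the functions $s\mapsto (\lambda_s\xi,\eta)$, $\xi,\eta\in L^2(G)$, and is identified with the predual of $\mathrm{VN}(G)$ via $\langle u,T\rangle=(T\xi,\eta)$ when $u(s)=(\lambda_s\xi,\eta)$; its norm is denoted $\|\cdot\|_A$. For $J\subseteq A(G)$, $J^{\perp}=\{T\in \mathrm{VN}(G) : \langle u,T\rangle=0 \text{ for all } u\in J\}$. A closed ideal $J$ of $A(G)$ is an ideal of multiplicity if $J^{\perp}\cap C_r^*(G)\neq\{0\}$. The symbol $\otimes$ denotes the algebraic tensor product; $A(G_1)\otimes A(G_2)$ is regarded as a (dense) subalgebra of $A(G_1\times G_2)$ via $(u\otimes v)(s,t)=u(s)v(t)$, and closures are taken in the norm $\|\cdot\|_A$ of $A(G_1\times G_2)$. *)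

theory Defs
  imports "HOL-Analysis.Analysis"
begin

text \<open>
  Groups are written additively, but \<^class>\<open>group_add\<close> is not commutative: \<open>s + t\<close> is the group
  product, \<open>- s\<close> the inverse and \<open>- s + t\<close> stands for \<open>s\<^sup>-\<^sup>1 t\<close>.
\<close>

text \<open>
  On a second countable locally compact Hausdorff group every Borel measure that is finite on
  compact sets is regular, so regularity need not be demanded.
\<close>

definition left_haar_measure :: "'a::{group_add, topological_space} measure \<Rightarrow> bool" where
  "left_haar_measure \<mu> \<longleftrightarrow>
     sets \<mu> = sets borel \<and>
     (\<forall>s. \<forall>B\<in>sets borel. emeasure \<mu> ((+) s ` B) = emeasure \<mu> B) \<and>
     (\<forall>K. compact K \<longrightarrow> emeasure \<mu> K < \<infinity>) \<and>
     emeasure \<mu> UNIV \<noteq> 0"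


subsection \<open>Bounded operators on L2\<close>

text \<open>
  Vectors are represented by square integrable functions and operators by maps between such
  functions. Identification of vectors up to null sets is built into the notions below: an operator
  is linear up to null sets, boundedness makes it respect almost everywhere equality, and it is the
  zero operator if all its values vanish almost everywhere.
\<close>

definition L2 :: "'a measure \<Rightarrow> ('a \<Rightarrow> complex) set" where
  "L2 \<mu> = {\<xi>. \<xi> \<in> borel_measurable \<mu> \<and> integrable \<mu> (\<lambda>x. (cmod (\<xi> x))\<^sup>2)}"

definition l2_inner :: "'a measure \<Rightarrow> ('a \<Rightarrow> complex) \<Rightarrow> ('a \<Rightarrow> complex) \<Rightarrow> complex" where
  "l2_inner \<mu> \<xi> \<eta> = (\<integral>x. \<xi> x * cnj (\<eta> x) \<partial>\<mu>)"

definition l2_norm :: "'a measure \<Rightarrow> ('a \<Rightarrow> complex) \<Rightarrow> real" where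
  "l2_norm \<mu> \<xi> = sqrt (\<integral>x. (cmod (\<xi> x))\<^sup>2 \<partial>\<mu>)"

type_synonym 'a l2_op = "('a \<Rightarrow> complex) \<Rightarrow> 'a \<Rightarrow> complex"

definition bounded_ops :: "'a measure \<Rightarrow> 'a l2_op set" where
  "bounded_ops \<mu> = {T.
     (\<forall>\<xi>\<in>L2 \<mu>. T \<xi> \<in> L2 \<mu>) \<and>
     (\<forall>\<xi>\<in>L2 \<mu>. \<forall>\<eta>\<in>L2 \<mu>. AE x in \<mu>. T (\<lambda>y. \<xi> y + \<eta> y) x = T \<xi> x + T \<eta> x) \<and>
     (\<forall>c. \<forall>\<xi>\<in>L2 \<mu>. AE x in \<mu>. T (\<lambda>y. c * \<xi> y) x = c * T \<xi> x) \<and>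
     (\<exists>C. \<forall>\<xi>\<in>L2 \<mu>. l2_norm \<mu> (T \<xi>) \<le> C * l2_norm \<mu> \<xi>)}"

definition zero_op :: "'a measure \<Rightarrow> 'a l2_op \<Rightarrow> bool" where
  "zero_op \<mu> T \<longleftrightarrow> (\<forall>\<xi>\<in>L2 \<mu>. AE x in \<mu>. T \<xi> x = 0)"

definition op_norm :: "'a measure \<Rightarrow> 'a l2_op \<Rightarrow> real" where
  "op_norm \<mu> T = (SUP \<xi>\<in>{\<xi>\<in>L2 \<mu>. l2_norm \<mu> \<xi> \<le> 1}. l2_norm \<mu> (T \<xi>))"

definition op_norm_closure :: "'a measure \<Rightarrow> 'a l2_op set \<Rightarrow> 'a l2_op set" where
  "op_norm_closure \<mu> \<S> =
     {T \<in> bounded_ops \<mu>. \<forall>\<epsilon>>0. \<exists>S\<in>\<S>. op_norm \<mu> (\<lambda>\<xi> x. T \<xi> x - S \<xi> x) < \<epsilon>}"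

text \<open>
  The weak* topology comes from the duality with the trace class operators. The trace class
  functionals are exactly \<open>T \<mapsto> \<Sum>n. (T \<xi>\<^sub>n, \<eta>\<^sub>n)\<close> with \<open>(\<parallel>\<xi>\<^sub>n\<parallel>)\<close> and \<open>(\<parallel>\<eta>\<^sub>n\<parallel>)\<close> square summable.
\<close>

definition sq_summable_seqs :: "'a measure \<Rightarrow> (nat \<Rightarrow> 'a \<Rightarrow> complex) set" where
  "sq_summable_seqs \<mu> = {\<Xi>. (\<forall>n. \<Xi> n \<in> L2 \<mu>) \<and> summable (\<lambda>n. (l2_norm \<mu> (\<Xi> n))\<^sup>2)}"

definition trace_functional ::
  "'a measure \<Rightarrow> (nat \<Rightarrow> 'a \<Rightarrow> complex) \<Rightarrow> (nat \<Rightarrow> 'a \<Rightarrow> complex) \<Rightarrow> 'a l2_op \<Rightarrow> complex" where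
  "trace_functional \<mu> \<Xi> H T = (\<Sum>n. l2_inner \<mu> (T (\<Xi> n)) (H n))"

definition weak_star_closure :: "'a measure \<Rightarrow> 'a l2_op set \<Rightarrow> 'a l2_op set" where
  "weak_star_closure \<mu> \<S> =
     {T \<in> bounded_ops \<mu>.
        \<forall>F \<epsilon>. finite F \<and> F \<subseteq> sq_summable_seqs \<mu> \<times> sq_summable_seqs \<mu> \<and> \<epsilon> > 0 \<longrightarrow>
          (\<exists>S\<in>\<S>. \<forall>(\<Xi>, H)\<in>F.
             cmod (trace_functional \<mu> \<Xi> H T - trace_functional \<mu> \<Xi> H S) < \<epsilon>)}"


subsection \<open>The operator algebras of a group and its Fourier algebra\<close>

definition left_translation :: "'a::group_add \<Rightarrow> 'a l2_op" where
  "left_translation s \<xi> = (\<lambda>t. \<xi> (- s + t))"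

definition left_convolution :: "'a::group_add measure \<Rightarrow> ('a \<Rightarrow> complex) \<Rightarrow> 'a l2_op" where
  "left_convolution \<mu> f \<xi> = (\<lambda>t. \<integral>s. f s * left_translation s \<xi> t \<partial>\<mu>)"

definition reduced_group_cstar :: "'a::group_add measure \<Rightarrow> 'a l2_op set" where
  "reduced_group_cstar \<mu> = op_norm_closure \<mu> (left_convolution \<mu> ` {f. integrable \<mu> f})"

definition group_VN :: "'a::group_add measure \<Rightarrow> 'a l2_op set" where
  "group_VN \<mu> = weak_star_closure \<mu> (reduced_group_cstar \<mu>)"

definition matrix_coeff ::
  "'a::group_add measure \<Rightarrow> ('a \<Rightarrow> complex) \<Rightarrow> ('a \<Rightarrow> complex) \<Rightarrow> 'a \<Rightarrow> complex" where
  "matrix_coeff \<mu> \<xi> \<eta> = (\<lambda>s. l2_inner \<mu> (left_translation s \<xi>) \<eta>)"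

definition fourier_algebra :: "'a::group_add measure \<Rightarrow> ('a \<Rightarrow> complex) set" where
  "fourier_algebra \<mu> = {matrix_coeff \<mu> \<xi> \<eta> | \<xi> \<eta>. \<xi> \<in> L2 \<mu> \<and> \<eta> \<in> L2 \<mu>}"

text \<open>For \<open>u\<close> in \<open>A(G)\<close> and \<open>T\<close> in \<open>VN(G)\<close> the value does not depend on the choice of \<open>\<xi>\<close> and \<open>\<eta>\<close>.\<close>

definition fourier_pairing :: "'a::group_add measure \<Rightarrow> ('a \<Rightarrow> complex) \<Rightarrow> 'a l2_op \<Rightarrow> complex" where
  "fourier_pairing \<mu> u T =
     (THE c. \<exists>\<xi>\<in>L2 \<mu>. \<exists>\<eta>\<in>L2 \<mu>. u = matrix_coeff \<mu> \<xi> \<eta> \<and> c = l2_inner \<mu> (T \<xi>) \<eta>)"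

text \<open>The norm of \<open>A(G)\<close> as the predual of \<open>VN(G)\<close>.\<close>

definition fourier_norm :: "'a::group_add measure \<Rightarrow> ('a \<Rightarrow> complex) \<Rightarrow> real" where
  "fourier_norm \<mu> u = (SUP T\<in>{T\<in>group_VN \<mu>. op_norm \<mu> T \<le> 1}. cmod (fourier_pairing \<mu> u T))"

text \<open>
  \<^const>\<open>fourier_norm\<close> is meaningful on \<^const>\<open>fourier_algebra\<close> only. As \<open>A(G)\<close> is a vector space,
  membership of the difference is automatic when \<open>S \<subseteq> A(G)\<close>.
\<close>

definition fourier_closure ::
  "'a::group_add measure \<Rightarrow> ('a \<Rightarrow> complex) set \<Rightarrow> ('a \<Rightarrow> complex) set" where
  "fourier_closure \<mu> S =
     {u \<in> fourier_algebra \<mu>. \<forall>\<epsilon>>0. \<exists>w\<in>S.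
        (\<lambda>x. u x - w x) \<in> fourier_algebra \<mu> \<and> fourier_norm \<mu> (\<lambda>x. u x - w x) < \<epsilon>}"

definition closed_ideal :: "'a::group_add measure \<Rightarrow> ('a \<Rightarrow> complex) set \<Rightarrow> bool" where
  "closed_ideal \<mu> J \<longleftrightarrow>
     J \<subseteq> fourier_algebra \<mu> \<and>
     (\<lambda>x. 0) \<in> J \<and>
     (\<forall>u\<in>J. \<forall>v\<in>J. (\<lambda>x. u x + v x) \<in> J) \<and>
     (\<forall>c. \<forall>u\<in>J. (\<lambda>x. c * u x) \<in> J) \<and>
     (\<forall>u\<in>J. \<forall>v\<in>fourier_algebra \<mu>. (\<lambda>x. u x * v x) \<in> J) \<and>
     fourier_closure \<mu> J \<subseteq> J"

definition annihilator :: "'a::group_add measure \<Rightarrow> ('a \<Rightarrow> complex) set \<Rightarrow> 'a l2_op set" where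
  "annihilator \<mu> J = {T \<in> group_VN \<mu>. \<forall>u\<in>J. fourier_pairing \<mu> u T = 0}"

definition ideal_of_multiplicity :: "'a::group_add measure \<Rightarrow> ('a \<Rightarrow> complex) set \<Rightarrow> bool" where
  "ideal_of_multiplicity \<mu> J \<longleftrightarrow> (\<exists>T \<in> annihilator \<mu> J \<inter> reduced_group_cstar \<mu>. \<not> zero_op \<mu> T)"


subsection \<open>Algebraic tensor products of function spaces\<close>

definition alg_tensor ::
  "('a \<Rightarrow> complex) set \<Rightarrow> ('b \<Rightarrow> complex) set \<Rightarrow> ('a \<times> 'b \<Rightarrow> complex) set" where
  "alg_tensor U V =
     {(\<lambda>(s, t). \<Sum>i<n. u i s * v i t) | (n::nat) u v. \<forall>i<n. u i \<in> U \<and> v i \<in> V}"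

definition subspace_sum :: "('a \<Rightarrow> complex) set \<Rightarrow> ('a \<Rightarrow> complex) set \<Rightarrow> ('a \<Rightarrow> complex) set" where
  "subspace_sum U V = {(\<lambda>x. u x + v x) | u v. u \<in> U \<and> v \<in> V}"

end

theory Submission
  imports Defs
begin

text \<open>
  Write \<open>\<lambda>(f)\<close> for convolution by \<open>f\<close>. Everything rests on \<open>(\<lambda>(f) \<xi>, \<eta>) = \<integral> f u\<close> with \<open>u(s) = (\<lambda>\<^sub>s \<xi>, \<eta>)\<close>.

  If \<open>T\<^sub>i = lim \<lambda>(f\<^sub>i\<^sub>,\<^sub>n)\<close> in operator norm, then \<open>\<lambda>(f\<^sub>1\<^sub>,\<^sub>n \<otimes> f\<^sub>2\<^sub>,\<^sub>n)\<close> is a Cauchy sequence, and its limit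
  \<open>T\<^sub>1 \<otimes> T\<^sub>2\<close> satisfies \<open>\<langle>u \<otimes> v, T\<^sub>1 \<otimes> T\<^sub>2\<rangle> = \<langle>u, T\<^sub>1\<rangle> \<langle>v, T\<^sub>2\<rangle>\<close>. So it annihilates \<open>J\<close> if \<open>T\<^sub>i\<close> annihilates
  \<open>J\<^sub>i\<close>, and it is nonzero if both \<open>T\<^sub>i\<close> are.

  Conversely, let \<open>T\<close> in \<open>C\<^sub>r\<^sup>*(G\<^sub>1 \<times> G\<^sub>2)\<close> annihilate \<open>J\<close>. For \<open>v\<close> in \<open>A(G\<^sub>2)\<close> the slice \<open>R\<^sub>v(T)\<close> given by
  \<open>\<langle>u, R\<^sub>v(T)\<rangle> = \<langle>u \<otimes> v, T\<rangle>\<close> lies in \<open>C\<^sub>r\<^sup>*(G\<^sub>1)\<close>, because slicing is bounded and maps \<open>\<lambda>(h)\<close> to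
  convolution by \<open>s \<mapsto> \<integral> h(s, t) v(t) dt\<close>. Slices of \<open>T\<close> annihilate \<open>J\<^sub>1\<close>, and as elementary tensors span
  a dense subspace of \<open>L\<^sup>2(G\<^sub>1 \<times> G\<^sub>2)\<close>, some slice is nonzero if \<open>T\<close> is. The same works for \<open>G\<^sub>2\<close>.

  Uniqueness of Haar measure reduces the given measure on \<open>G\<^sub>1 \<times> G\<^sub>2\<close> to a multiple of the product measure.
\<close>

section \<open>Square integrable functions\<close>

text \<open>Elements of the reduced C*-algebra are accessible only through approximating
  convolutions, so every new operator is built as a limit of convolution operators with explicit
  kernels. Approximants are taken with error (1/2)^n: increments then decay geometrically, and one
  completeness argument in L2 serves all limits. New operators are tied to old ones through the
  numbers (T xi, eta) only.

  Two obstacles shape the proof. Vectors are functions, not classes, so operators are linear only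
  almost everywhere and limits are chosen vector by vector. And \<open>fourier_pairing\<close> is a
  definite description, so it has a usable value only once (T xi, eta) is known to depend on the
  matrix coefficient alone. This is proved for finite sums at once: if a sum of matrix coefficients
  vanishes, so does the sum of the numbers (T xi_i, eta_i), first for convolutions, then for norm
  limits, then for weak* limits. The same fact handles the closure that defines J.

  In the converse a single nonzero entry (T (xi tensor xi'), eta tensor eta') yields both slices:
  xi', eta' are frozen for one, xi, eta for the other.\<close>

lemma borel_measurable_cnj [measurable (raw)]:
  "f \<in> borel_measurable M \<Longrightarrow> (\<lambda>x. cnj (f x)) \<in> borel_measurable M"
  by (rule borel_measurable_continuous_on) (auto intro: continuous_intros)

lemma L2_measurable [measurable_dest]: "\<xi> \<in> L2 M \<Longrightarrow> \<xi> \<in> borel_measurable M"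
  by (simp add: L2_def)

lemma L2_iff_nn_integral:
  "\<xi> \<in> L2 M \<longleftrightarrow> \<xi> \<in> borel_measurable M \<and> (\<integral>\<^sup>+x. ennreal ((cmod (\<xi> x))\<^sup>2) \<partial>M) < \<infinity>"
  by (auto simp: L2_def integrable_iff_bounded)

lemma l2_norm_nonneg [simp]: "0 \<le> l2_norm M \<xi>"
  by (simp add: l2_norm_def)

lemma l2_norm_power2: "(l2_norm M \<xi>)\<^sup>2 = (\<integral>x. (cmod (\<xi> x))\<^sup>2 \<partial>M)"
  by (simp add: l2_norm_def)

lemma nn_integral_eq_l2_norm:
  "\<xi> \<in> L2 M \<Longrightarrow> (\<integral>\<^sup>+x. ennreal ((cmod (\<xi> x))\<^sup>2) \<partial>M) = ennreal ((l2_norm M \<xi>)\<^sup>2)"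
  unfolding l2_norm_power2 by (rule nn_integral_eq_integral) (auto simp: L2_def)

text \<open>The hypothesis is about the nonnegative integral because the Bochner integral in
  \<open>l2_norm\<close> is 0 for a non-integrable function: a bound on \<open>l2_norm\<close> alone
  would not give membership in \<open>L2\<close>.\<close>

lemma
  assumes "\<xi> \<in> borel_measurable M" "0 \<le> B"
    and le: "(\<integral>\<^sup>+x. ennreal ((cmod (\<xi> x))\<^sup>2) \<partial>M) \<le> ennreal (B\<^sup>2)"
  shows L2_nn_integralI: "\<xi> \<in> L2 M" and l2_norm_le_nn_integralI: "l2_norm M \<xi> \<le> B"
proof -
  show L2: "\<xi> \<in> L2 M"
    using assms by (auto simp: L2_iff_nn_integral intro: le_less_trans)
  have "(l2_norm M \<xi>)\<^sup>2 \<le> B\<^sup>2"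
    using le unfolding nn_integral_eq_l2_norm[OF L2] by (subst (asm) ennreal_le_iff) auto
  then show "l2_norm M \<xi> \<le> B"
    using assms(2) by (rule power2_le_imp_le)
qed

lemma nn_integral_mult_le_l2_norm:
  assumes [measurable]: "\<xi> \<in> L2 M" "\<eta> \<in> L2 M"
  shows "(\<integral>\<^sup>+x. ennreal (cmod (\<xi> x) * cmod (\<eta> x)) \<partial>M) \<le> ennreal (l2_norm M \<xi> * l2_norm M \<eta>)"
proof -
  let ?I = "\<integral>\<^sup>+x. ennreal (cmod (\<xi> x) * cmod (\<eta> x)) \<partial>M"
  have "?I\<^sup>2 \<le> ennreal ((l2_norm M \<xi>)\<^sup>2) * ennreal ((l2_norm M \<eta>)\<^sup>2)"
    using Cauchy_Schwarz_nn_integral[of "\<lambda>x. ennreal (cmod (\<xi> x))" M "\<lambda>x. ennreal (cmod (\<eta> x))"]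
    by (simp add: ennreal_power ennreal_mult' nn_integral_eq_l2_norm[OF assms(1)]
        nn_integral_eq_l2_norm[OF assms(2)])
  also have "\<dots> = (ennreal (l2_norm M \<xi> * l2_norm M \<eta>))\<^sup>2"
    by (simp add: ennreal_power ennreal_mult'[symmetric] power_mult_distrib)
  finally have le: "?I\<^sup>2 \<le> (ennreal (l2_norm M \<xi> * l2_norm M \<eta>))\<^sup>2" .
  \<comment> \<open>The root is extracted in the reals; an infinite left side would contradict the
    finite bound on its square.\<close>
  show ?thesis
  proof (cases ?I)
    case (real r)
    then have "r\<^sup>2 \<le> (l2_norm M \<xi> * l2_norm M \<eta>)\<^sup>2"
      using le by (simp add: ennreal_power)
    then have "r \<le> l2_norm M \<xi> * l2_norm M \<eta>"
      by (rule power2_le_imp_le) simp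
    then show ?thesis using real by (simp add: ennreal_leI)
  next
    case top
    then show ?thesis using le by (simp add: ennreal_power top_power_ennreal top_unique)
  qed
qed

lemma L2_mult_cnj_integrable:
  assumes [measurable]: "\<xi> \<in> L2 M" "\<eta> \<in> L2 M"
  shows "integrable M (\<lambda>x. \<xi> x * cnj (\<eta> x))"
proof (rule integrableI_bounded)
  show "(\<lambda>x. \<xi> x * cnj (\<eta> x)) \<in> borel_measurable M" by measurable
  show "(\<integral>\<^sup>+x. ennreal (norm (\<xi> x * cnj (\<eta> x))) \<partial>M) < \<infinity>"
    using nn_integral_mult_le_l2_norm[OF assms] by (auto simp: norm_mult intro: le_less_trans)
qed

lemma norm_l2_inner_le:
  assumes "\<xi> \<in> L2 M" "\<eta> \<in> L2 M"
  shows "cmod (l2_inner M \<xi> \<eta>) \<le> l2_norm M \<xi> * l2_norm M \<eta>"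
proof -
  have "ennreal (cmod (l2_inner M \<xi> \<eta>)) \<le> ennreal (l2_norm M \<xi> * l2_norm M \<eta>)"
    unfolding l2_inner_def
    using integral_norm_bound_ennreal[OF L2_mult_cnj_integrable[OF assms]]
      nn_integral_mult_le_l2_norm[OF assms] unfolding norm_mult complex_mod_cnj by (rule order_trans)
  then show ?thesis by simp
qed

lemma l2_inner_self: "l2_inner M \<xi> \<xi> = complex_of_real ((l2_norm M \<xi>)\<^sup>2)"
  unfolding l2_inner_def l2_norm_power2 complex_norm_square [symmetric] by (rule integral_complex_of_real)

lemma L2_zero [simp, intro]: "(\<lambda>x. 0) \<in> L2 M"
  by (simp add: L2_def)

lemma L2_indicator:
  assumes "E \<in> sets M" "emeasure M E < \<infinity>"
  shows "(\<lambda>x. indicator E x :: complex) \<in> L2 M"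
proof -
  have "(\<lambda>x. ennreal ((cmod (indicator E x))\<^sup>2)) = (\<lambda>x. indicator E x)"
    by (auto simp: indicator_def)
  then show ?thesis using assms by (simp add: L2_iff_nn_integral)
qed

lemma L2_add [simp, intro]:
  assumes [measurable]: "\<xi> \<in> L2 M" "\<eta> \<in> L2 M"
  shows "(\<lambda>x. \<xi> x + \<eta> x) \<in> L2 M"
proof -
  have "integrable M (\<lambda>x. (cmod (\<xi> x + \<eta> x))\<^sup>2)"
  proof (rule Bochner_Integration.integrable_bound)
    show "integrable M (\<lambda>x. 2 * (cmod (\<xi> x))\<^sup>2 + 2 * (cmod (\<eta> x))\<^sup>2)"
      using assms by (simp add: L2_def)
    have "(cmod (a + b))\<^sup>2 \<le> 2 * (cmod a)\<^sup>2 + 2 * (cmod b)\<^sup>2" for a b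
    proof -
      have "(cmod (a + b))\<^sup>2 \<le> (cmod a + cmod b)\<^sup>2"
        by (simp add: norm_triangle_ineq power_mono)
      then show ?thesis
        using sum_squares_bound[of "cmod a" "cmod b"] by (simp add: power2_sum)
    qed
    then show "AE x in M. norm ((cmod (\<xi> x + \<eta> x))\<^sup>2) \<le> norm (2 * (cmod (\<xi> x))\<^sup>2 + 2 * (cmod (\<eta> x))\<^sup>2)"
      by (auto intro!: AE_I2)
  qed measurable
  then show ?thesis by (simp add: L2_def)
qed

lemma L2_cmult [simp, intro]: "\<xi> \<in> L2 M \<Longrightarrow> (\<lambda>x. c * \<xi> x) \<in> L2 M"
  by (auto simp: L2_def norm_mult power_mult_distrib)

lemma L2_uminus [simp, intro]: "\<xi> \<in> L2 M \<Longrightarrow> (\<lambda>x. - \<xi> x) \<in> L2 M"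
  using L2_cmult[of \<xi> M "-1"] by simp

lemma L2_diff [simp, intro]: "\<xi> \<in> L2 M \<Longrightarrow> \<eta> \<in> L2 M \<Longrightarrow> (\<lambda>x. \<xi> x - \<eta> x) \<in> L2 M"
  using L2_add[OF _ L2_uminus] by force

lemma L2_sum: "(\<And>i. i \<in> I \<Longrightarrow> \<xi> i \<in> L2 M) \<Longrightarrow> (\<lambda>x. \<Sum>i\<in>I. \<xi> i x) \<in> L2 M"
  by (induction I rule: infinite_finite_induct) auto

lemma l2_inner_add_left:
  "\<xi> \<in> L2 M \<Longrightarrow> \<xi>' \<in> L2 M \<Longrightarrow> \<eta> \<in> L2 M \<Longrightarrow>
    l2_inner M (\<lambda>x. \<xi> x + \<xi>' x) \<eta> = l2_inner M \<xi> \<eta> + l2_inner M \<xi>' \<eta>"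
  by (simp add: l2_inner_def distrib_right L2_mult_cnj_integrable)

lemma l2_inner_add_right:
  "\<xi> \<in> L2 M \<Longrightarrow> \<eta> \<in> L2 M \<Longrightarrow> \<eta>' \<in> L2 M \<Longrightarrow>
    l2_inner M \<xi> (\<lambda>x. \<eta> x + \<eta>' x) = l2_inner M \<xi> \<eta> + l2_inner M \<xi> \<eta>'"
  by (simp add: l2_inner_def distrib_left L2_mult_cnj_integrable)

lemma l2_inner_diff_left:
  "\<xi> \<in> L2 M \<Longrightarrow> \<xi>' \<in> L2 M \<Longrightarrow> \<eta> \<in> L2 M \<Longrightarrow>
    l2_inner M (\<lambda>x. \<xi> x - \<xi>' x) \<eta> = l2_inner M \<xi> \<eta> - l2_inner M \<xi>' \<eta>"
  by (simp add: l2_inner_def left_diff_distrib L2_mult_cnj_integrable)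

lemma l2_inner_diff_right:
  "\<xi> \<in> L2 M \<Longrightarrow> \<eta> \<in> L2 M \<Longrightarrow> \<eta>' \<in> L2 M \<Longrightarrow>
    l2_inner M \<xi> (\<lambda>x. \<eta> x - \<eta>' x) = l2_inner M \<xi> \<eta> - l2_inner M \<xi> \<eta>'"
  by (simp add: l2_inner_def right_diff_distrib L2_mult_cnj_integrable)

lemma l2_inner_cmult_left: "l2_inner M (\<lambda>x. c * \<xi> x) \<eta> = c * l2_inner M \<xi> \<eta>"
  by (simp add: l2_inner_def mult.assoc)

lemma l2_inner_cmult_right: "l2_inner M \<xi> (\<lambda>x. c * \<eta> x) = cnj c * l2_inner M \<xi> \<eta>"
  by (simp add: l2_inner_def mult.left_commute)

lemma l2_inner_zero_right [simp]: "l2_inner M \<xi> (\<lambda>x. 0) = 0"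
  by (simp add: l2_inner_def)

lemma l2_norm_zero [simp]: "l2_norm M (\<lambda>x. 0) = 0"
  by (simp add: l2_norm_def)

lemma l2_norm_cmult: "l2_norm M (\<lambda>x. c * \<xi> x) = cmod c * l2_norm M \<xi>"
  by (simp add: l2_norm_def norm_mult power_mult_distrib real_sqrt_mult)

lemma l2_norm_uminus [simp]: "l2_norm M (\<lambda>x. - \<xi> x) = l2_norm M \<xi>"
  by (simp add: l2_norm_def)

lemma l2_norm_minus_commute: "l2_norm M (\<lambda>x. \<xi> x - \<eta> x) = l2_norm M (\<lambda>x. \<eta> x - \<xi> x)"
  by (simp add: l2_norm_def norm_minus_commute)

lemma l2_norm_cong_AE:
  "\<xi> \<in> borel_measurable M \<Longrightarrow> \<eta> \<in> borel_measurable M \<Longrightarrow> (AE x in M. \<xi> x = \<eta> x) \<Longrightarrow>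
    l2_norm M \<xi> = l2_norm M \<eta>"
  unfolding l2_norm_def by (intro arg_cong[where f=sqrt] integral_cong_AE) auto

lemma l2_inner_cong_AE:
  "\<xi> \<in> borel_measurable M \<Longrightarrow> \<xi>' \<in> borel_measurable M \<Longrightarrow> \<eta> \<in> borel_measurable M \<Longrightarrow>
    (AE x in M. \<xi> x = \<xi>' x) \<Longrightarrow> l2_inner M \<xi> \<eta> = l2_inner M \<xi>' \<eta>"
  unfolding l2_inner_def by (rule integral_cong_AE) auto

lemma l2_norm_eq_0_iff:
  "\<xi> \<in> L2 M \<Longrightarrow> l2_norm M \<xi> = 0 \<longleftrightarrow> (AE x in M. \<xi> x = 0)"
  by (simp add: l2_norm_def L2_def integral_nonneg_eq_0_iff_AE)

lemma l2_norm_triangle: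
  assumes "\<xi> \<in> L2 M" "\<eta> \<in> L2 M"
  shows "l2_norm M (\<lambda>x. \<xi> x + \<eta> x) \<le> l2_norm M \<xi> + l2_norm M \<eta>"
proof -
  have "complex_of_real ((l2_norm M (\<lambda>x. \<xi> x + \<eta> x))\<^sup>2) =
      of_real ((l2_norm M \<xi>)\<^sup>2 + (l2_norm M \<eta>)\<^sup>2) + (l2_inner M \<xi> \<eta> + l2_inner M \<eta> \<xi>)"
    unfolding l2_inner_self[symmetric] of_real_add
    using assms by (simp add: l2_inner_add_left l2_inner_add_right)
  then have "(l2_norm M (\<lambda>x. \<xi> x + \<eta> x))\<^sup>2 =
      (l2_norm M \<xi>)\<^sup>2 + (l2_norm M \<eta>)\<^sup>2 + Re (l2_inner M \<xi> \<eta>) + Re (l2_inner M \<eta> \<xi>)"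
    by (auto dest: arg_cong[where f=Re])
  moreover have "Re (l2_inner M \<xi> \<eta>) \<le> l2_norm M \<xi> * l2_norm M \<eta>"
    "Re (l2_inner M \<eta> \<xi>) \<le> l2_norm M \<xi> * l2_norm M \<eta>"
    using norm_l2_inner_le[OF assms] norm_l2_inner_le[OF assms(2,1)]
      complex_Re_le_cmod[of "l2_inner M \<xi> \<eta>"] complex_Re_le_cmod[of "l2_inner M \<eta> \<xi>"]
    by (auto simp: mult.commute)
  ultimately have "(l2_norm M (\<lambda>x. \<xi> x + \<eta> x))\<^sup>2 \<le> (l2_norm M \<xi> + l2_norm M \<eta>)\<^sup>2"
    by (simp add: power2_sum)
  then show ?thesis by (rule power2_le_imp_le) simp
qed

lemma l2_norm_triangle_diff:
  assumes "\<xi> \<in> L2 M" "\<eta> \<in> L2 M" "\<zeta> \<in> L2 M"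
  shows "l2_norm M (\<lambda>x. \<xi> x - \<zeta> x) \<le> l2_norm M (\<lambda>x. \<xi> x - \<eta> x) + l2_norm M (\<lambda>x. \<eta> x - \<zeta> x)"
  using l2_norm_triangle[of "\<lambda>x. \<xi> x - \<eta> x" M "\<lambda>x. \<eta> x - \<zeta> x"] assms by simp

lemma l2_norm_diff_le:
  assumes "\<xi> \<in> L2 M" "\<eta> \<in> L2 M"
  shows "l2_norm M (\<lambda>x. \<xi> x - \<eta> x) \<le> l2_norm M \<xi> + l2_norm M \<eta>"
  using l2_norm_triangle[of \<xi> M "\<lambda>x. - \<eta> x"] assms by simp

section \<open>Completeness of L2 along geometrically Cauchy sequences\<close>

lemma l2_norm_geometric_tail:
  assumes L2: "\<And>n. X n \<in> L2 M"
    and C: "\<And>n. l2_norm M (\<lambda>x. X (Suc n) x - X n x) \<le> C * (1/2)^n" and "n \<le> m"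
  shows "l2_norm M (\<lambda>x. X m x - X n x) \<le> 2 * C * (1/2)^n"
proof -
  \<comment> \<open>The subtracted term makes the induction close: the right side is exactly the sum
    of C (1/2)^k over n <= k < m.\<close>
  have "l2_norm M (\<lambda>x. X m x - X n x) \<le> 2 * C * (1/2)^n - 2 * C * (1/2)^m"
    using \<open>n \<le> m\<close>
  proof (induction m rule: dec_induct)
    case (step m)
    then show ?case
      using C[of m] l2_norm_triangle_diff[of "X (Suc m)" M "X m" "X n", OF L2 L2 L2] by simp
  qed simp
  moreover have "0 \<le> C" using order_trans[OF l2_norm_nonneg C[of 0]] by simp
  ultimately show ?thesis
    using mult_nonneg_nonneg[of "2*C" "(1/2)^m"] by (smt (verit) zero_le_power zero_le_divide_1_iff)
qed

text \<open>Weighting the squared increments by \<open>2 ^ n\<close> keeps them integrable and, where the weighted series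
  is finite, forces the increments to decay geometrically.\<close>

lemma L2_complete_geometric:
  assumes L2[measurable]: "\<And>n. X n \<in> L2 M"
    and C: "\<And>n. l2_norm M (\<lambda>x. X (Suc n) x - X n x) \<le> C * (1/2)^n"
  shows "\<exists>\<xi>\<in>L2 M. \<forall>n. l2_norm M (\<lambda>x. \<xi> x - X n x) \<le> 2 * C * (1/2)^n"
proof -
  define d where "d n x = (cmod (X (Suc n) x - X n x))\<^sup>2" for n x
  have [measurable]: "d n \<in> borel_measurable M" for n unfolding d_def by measurable
  have C0: "0 \<le> C" using order_trans[OF l2_norm_nonneg C[of 0]] by simp
  have "(\<integral>\<^sup>+x. (\<Sum>n. ennreal (2^n * d n x)) \<partial>M) = (\<Sum>n. \<integral>\<^sup>+x. ennreal (2^n * d n x) \<partial>M)"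
    by (rule nn_integral_suminf) measurable
  also have "\<dots> \<le> (\<Sum>n. ennreal (C\<^sup>2 * (1/2)^n))"
  proof (rule suminf_le)
    fix n
    have "(\<integral>\<^sup>+x. ennreal (2^n * d n x) \<partial>M) = ennreal (2^n) * (\<integral>\<^sup>+x. ennreal (d n x) \<partial>M)"
      by (simp add: ennreal_mult' nn_integral_cmult d_def)
    also have "\<dots> = ennreal (2^n * (l2_norm M (\<lambda>x. X (Suc n) x - X n x))\<^sup>2)"
      unfolding d_def by (simp add: nn_integral_eq_l2_norm[OF L2_diff[OF L2 L2]] ennreal_mult')
    also have "\<dots> \<le> ennreal (2^n * (C * (1/2)^n)\<^sup>2)"
      using C[of n] by (intro ennreal_leI mult_left_mono power_mono) auto
    also have "2^n * (C * (1/2)^n)\<^sup>2 = C\<^sup>2 * (1/2)^n"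
      by (simp add: power_mult_distrib power2_eq_square field_simps)
    finally show "(\<integral>\<^sup>+x. ennreal (2^n * d n x) \<partial>M) \<le> ennreal (C\<^sup>2 * (1/2)^n)" .
  qed auto
  also have "\<dots> < \<infinity>"
    by (subst suminf_ennreal2) (auto intro: summable_mult)
  finally have "AE x in M. (\<Sum>n. ennreal (2^n * d n x)) \<noteq> \<infinity>"
    by (intro nn_integral_PInf_AE) auto
  then have conv: "AE x in M. (\<lambda>n. X n x) \<longlonglongrightarrow> lim (\<lambda>n. X n x)"
  proof eventually_elim
    case (elim x)
    have "summable (\<lambda>n. 2^n * d n x)"
      using elim by (intro summable_suminf_not_top) (auto simp: d_def top_ennreal.abs_eq)
    then have "Bseq (\<lambda>n. 2^n * d n x)" by (rule summable_imp_Bseq)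
    then obtain K where "\<And>n. norm (2^n * d n x) \<le> K" by (auto simp: Bseq_def)
    then have K: "2^n * d n x \<le> K" for n using abs_ge_self order_trans by (metis real_norm_def)
    have "summable (\<lambda>n. X (Suc n) x - X n x)"
    proof (rule summable_comparison_test')
      show "summable (\<lambda>n. sqrt K * (sqrt (1/2))^n)"
        by (intro summable_mult summable_geometric) auto
      fix n :: nat
      have "d n x \<le> K * (1/2)^n"
        using K[of n] by (simp add: field_simps)
      then have "sqrt (d n x) \<le> sqrt K * (sqrt (1/2))^n"
        unfolding real_sqrt_power[symmetric] real_sqrt_mult[symmetric] by (rule real_sqrt_le_mono)
      then show "norm (X (Suc n) x - X n x) \<le> sqrt K * (sqrt (1/2))^n"
        by (simp add: d_def)
    qed
    then have "convergent (\<lambda>n. X n x)"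
      using sum_lessThan_telescope[of "\<lambda>n. X n x"] convergent_diff_const_right_iff[of "\<lambda>n. X n x" "X 0 x"]
      by (simp add: summable_iff_convergent)
    then show ?case by (simp add: convergent_LIMSEQ_iff)
  qed
  \<comment> \<open>On the exceptional null set \<open>lim\<close> is a mere default value; the
    estimates below are made almost everywhere.\<close>
  define \<xi> where "\<xi> x = lim (\<lambda>n. X n x)" for x
  have [measurable]: "\<xi> \<in> borel_measurable M" unfolding \<xi>_def by measurable
  have est: "(\<lambda>x. \<xi> x - X n x) \<in> L2 M \<and> l2_norm M (\<lambda>x. \<xi> x - X n x) \<le> 2 * C * (1/2)^n" for n
  proof -
    \<comment> \<open>Fatou lets m tend to infinity in the tail bound. Finiteness of the integral
      also yields membership in \<open>L2\<close>.\<close>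
    have "(\<integral>\<^sup>+x. ennreal ((cmod (\<xi> x - X n x))\<^sup>2) \<partial>M)
        = (\<integral>\<^sup>+x. liminf (\<lambda>m. ennreal ((cmod (X m x - X n x))\<^sup>2)) \<partial>M)"
    proof (rule nn_integral_cong_AE, use conv in eventually_elim)
      case (elim x)
      have "(\<lambda>m. ennreal ((cmod (X m x - X n x))\<^sup>2)) \<longlonglongrightarrow> ennreal ((cmod (\<xi> x - X n x))\<^sup>2)"
        using elim unfolding \<xi>_def by (intro tendsto_intros) auto
      from lim_imp_Liminf[OF _ this] show ?case by simp
    qed
    also have "\<dots> \<le> liminf (\<lambda>m. \<integral>\<^sup>+x. ennreal ((cmod (X m x - X n x))\<^sup>2) \<partial>M)"
      by (rule nn_integral_liminf) measurable
    also have "\<dots> = liminf (\<lambda>m. ennreal ((l2_norm M (\<lambda>x. X m x - X n x))\<^sup>2))"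
      by (simp add: nn_integral_eq_l2_norm[OF L2_diff[OF L2 L2]])
    also have "\<dots> \<le> ennreal ((2 * C * (1/2)^n)\<^sup>2)"
    proof -
      have "\<forall>\<^sub>F m in sequentially. ennreal ((l2_norm M (\<lambda>x. X m x - X n x))\<^sup>2) \<le> ennreal ((2 * C * (1/2)^n)\<^sup>2)"
        using eventually_ge_at_top[of n]
        by eventually_elim (intro ennreal_leI power_mono l2_norm_geometric_tail[OF L2 C], auto)
      then have "liminf (\<lambda>m. ennreal ((l2_norm M (\<lambda>x. X m x - X n x))\<^sup>2))
          \<le> liminf (\<lambda>m::nat. ennreal ((2 * C * (1/2)^n)\<^sup>2))"
        by (rule Liminf_mono)
      then show ?thesis by (simp add: Liminf_const)
    qed
    finally have "(\<integral>\<^sup>+x. ennreal ((cmod (\<xi> x - X n x))\<^sup>2) \<partial>M) \<le> ennreal ((2 * C * (1/2)^n)\<^sup>2)" .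
    moreover have "0 \<le> 2 * C * (1/2)^n" using C0 by simp
    ultimately show ?thesis
      using L2_nn_integralI[of "\<lambda>x. \<xi> x - X n x" M "2 * C * (1/2)^n"]
        l2_norm_le_nn_integralI[of "\<lambda>x. \<xi> x - X n x" M "2 * C * (1/2)^n"] by simp
  qed
  have "(\<lambda>x. (\<xi> x - X 0 x) + X 0 x) \<in> L2 M"
    using est[of 0] L2 by (intro L2_add) auto
  then show ?thesis using est by (auto intro!: bexI[of _ \<xi>])
qed


section \<open>Bounded operators\<close>

lemma bounded_ops_L2: "T \<in> bounded_ops M \<Longrightarrow> \<xi> \<in> L2 M \<Longrightarrow> T \<xi> \<in> L2 M"
  by (simp add: bounded_ops_def)

lemma bounded_ops_add_AE:
  "T \<in> bounded_ops M \<Longrightarrow> \<xi> \<in> L2 M \<Longrightarrow> \<eta> \<in> L2 M \<Longrightarrow>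
    AE x in M. T (\<lambda>y. \<xi> y + \<eta> y) x = T \<xi> x + T \<eta> x"
  by (simp add: bounded_ops_def)

lemma bounded_ops_cmult_AE:
  "T \<in> bounded_ops M \<Longrightarrow> \<xi> \<in> L2 M \<Longrightarrow> AE x in M. T (\<lambda>y. c * \<xi> y) x = c * T \<xi> x"
  by (simp add: bounded_ops_def)

lemma bounded_ops_bound:
  assumes "T \<in> bounded_ops M"
  obtains C where "0 \<le> C" "\<And>\<xi>. \<xi> \<in> L2 M \<Longrightarrow> l2_norm M (T \<xi>) \<le> C * l2_norm M \<xi>"
proof -
  obtain C where C: "\<And>\<xi>. \<xi> \<in> L2 M \<Longrightarrow> l2_norm M (T \<xi>) \<le> C * l2_norm M \<xi>"
    using assms unfolding bounded_ops_def by blast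
  have "l2_norm M (T \<xi>) \<le> \<bar>C\<bar> * l2_norm M \<xi>" if "\<xi> \<in> L2 M" for \<xi>
    by (rule order_trans[OF C[OF that]]) (simp add: mult_right_mono)
  then show ?thesis using that[of "\<bar>C\<bar>"] by auto
qed

lemma op_norm_le:
  assumes "0 \<le> C" "\<And>\<xi>. \<xi> \<in> L2 M \<Longrightarrow> l2_norm M (T \<xi>) \<le> C * l2_norm M \<xi>"
  shows "op_norm M T \<le> C"
  unfolding op_norm_def
proof (rule cSUP_least)
  show "{\<xi> \<in> L2 M. l2_norm M \<xi> \<le> 1} \<noteq> {}"
    by (auto intro!: exI[of _ "\<lambda>x. 0"])
  fix \<xi> assume "\<xi> \<in> {\<xi> \<in> L2 M. l2_norm M \<xi> \<le> 1}"
  then show "l2_norm M (T \<xi>) \<le> C"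
    using assms(2)[of \<xi>] mult_left_mono[of "l2_norm M \<xi>" 1 C] assms(1) by auto
qed

lemma l2_norm_le_op_norm:
  assumes T: "T \<in> bounded_ops M" and \<xi>: "\<xi> \<in> L2 M"
  shows "l2_norm M (T \<xi>) \<le> op_norm M T * l2_norm M \<xi>"
proof -
  obtain C where C: "0 \<le> C" "\<And>\<xi>. \<xi> \<in> L2 M \<Longrightarrow> l2_norm M (T \<xi>) \<le> C * l2_norm M \<xi>"
    using bounded_ops_bound[OF T] by blast
  show ?thesis
  proof (cases "l2_norm M \<xi> = 0")
    case True
    \<comment> \<open>A null vector cannot be normalised, but the constant C already forces its
      image to have norm 0.\<close>
    then show ?thesis using C(2)[OF \<xi>] by simp
  next
    case False
    define r where "r = l2_norm M \<xi>"
    have r: "0 < r" using False by (simp add: r_def less_le)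
    define \<xi>' where "\<xi>' = (\<lambda>x. complex_of_real (1/r) * \<xi> x)"
    have \<xi>': "\<xi>' \<in> L2 M" "l2_norm M \<xi>' = 1"
      using r \<xi> L2_cmult[OF \<xi>, of "complex_of_real (1/r)"] unfolding \<xi>'_def
      by (simp_all only: l2_norm_cmult) (simp_all add: r_def norm_divide)
    have "l2_norm M (T \<xi>') = l2_norm M (\<lambda>x. complex_of_real (1/r) * T \<xi> x)"
      using bounded_ops_cmult_AE[OF T \<xi>, of "complex_of_real (1/r)"]
        bounded_ops_L2[OF T \<xi>'(1)] bounded_ops_L2[OF T \<xi>]
      unfolding \<xi>'_def by (intro l2_norm_cong_AE L2_measurable L2_cmult)
    moreover have "l2_norm M (T \<xi>') \<le> op_norm M T"
      unfolding op_norm_def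
    proof (rule cSUP_upper)
      show "bdd_above ((\<lambda>\<xi>. l2_norm M (T \<xi>)) ` {\<xi> \<in> L2 M. l2_norm M \<xi> \<le> 1})"
        using C by (intro bdd_aboveI2[where M=C]) (auto intro!: order_trans[OF C(2)] mult_left_le)
    qed (use \<xi>' in auto)
    ultimately show ?thesis
      using r unfolding l2_norm_cmult by (simp add: r_def field_simps norm_divide)
  qed
qed

lemma op_norm_nonneg:
  assumes "T \<in> bounded_ops M" shows "0 \<le> op_norm M T"
proof -
  obtain C where C: "0 \<le> C" "\<And>\<xi>. \<xi> \<in> L2 M \<Longrightarrow> l2_norm M (T \<xi>) \<le> C * l2_norm M \<xi>"
    using bounded_ops_bound[OF assms] by blast
  have "l2_norm M (T (\<lambda>x. 0)) \<le> op_norm M T"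
    unfolding op_norm_def
  proof (rule cSUP_upper)
    show "bdd_above ((\<lambda>\<xi>. l2_norm M (T \<xi>)) ` {\<xi> \<in> L2 M. l2_norm M \<xi> \<le> 1})"
      using C by (intro bdd_aboveI2[where M=C]) (auto intro!: order_trans[OF C(2)] mult_left_le)
  qed auto
  then show ?thesis using l2_norm_nonneg[of M "T (\<lambda>x. 0)"] by linarith
qed

lemma bounded_ops_cmult:
  assumes T: "T \<in> bounded_ops M"
  shows "(\<lambda>\<xi> x. c * T \<xi> x) \<in> bounded_ops M"
proof -
  obtain C where C: "0 \<le> C" "\<And>\<xi>. \<xi> \<in> L2 M \<Longrightarrow> l2_norm M (T \<xi>) \<le> C * l2_norm M \<xi>"
    using bounded_ops_bound[OF T] by blast
  have "l2_norm M (\<lambda>x. c * T \<xi> x) \<le> (cmod c * C) * l2_norm M \<xi>" if "\<xi> \<in> L2 M" for \<xi>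
    using mult_left_mono[OF C(2)[OF that], of "cmod c"] by (simp add: l2_norm_cmult mult.assoc)
  moreover have "AE x in M. c * T (\<lambda>y. \<xi> y + \<eta> y) x = c * T \<xi> x + c * T \<eta> x"
    if "\<xi> \<in> L2 M" "\<eta> \<in> L2 M" for \<xi> \<eta>
    using bounded_ops_add_AE[OF T that] by eventually_elim (simp add: distrib_left)
  moreover have "AE x in M. c * T (\<lambda>y. a * \<xi> y) x = a * (c * T \<xi> x)" if "\<xi> \<in> L2 M" for a \<xi>
    using bounded_ops_cmult_AE[OF T that, of a] by eventually_elim simp
  ultimately show ?thesis
    using bounded_ops_L2[OF T] by (auto simp: bounded_ops_def)
qed

lemma bounded_ops_diff:
  assumes T: "T \<in> bounded_ops M" and S: "S \<in> bounded_ops M"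
  shows "(\<lambda>\<xi> x. T \<xi> x - S \<xi> x) \<in> bounded_ops M"
proof -
  obtain C where C: "0 \<le> C" "\<And>\<xi>. \<xi> \<in> L2 M \<Longrightarrow> l2_norm M (T \<xi>) \<le> C * l2_norm M \<xi>"
    using bounded_ops_bound[OF T] by blast
  obtain D where D: "0 \<le> D" "\<And>\<xi>. \<xi> \<in> L2 M \<Longrightarrow> l2_norm M (S \<xi>) \<le> D * l2_norm M \<xi>"
    using bounded_ops_bound[OF S] by blast
  have "l2_norm M (\<lambda>x. T \<xi> x - S \<xi> x) \<le> (C + D) * l2_norm M \<xi>" if "\<xi> \<in> L2 M" for \<xi>
    using l2_norm_diff_le[OF bounded_ops_L2[OF T that] bounded_ops_L2[OF S that]]
      C(2)[OF that] D(2)[OF that] by (simp add: distrib_right)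
  moreover have "AE x in M. T (\<lambda>y. \<xi> y + \<eta> y) x - S (\<lambda>y. \<xi> y + \<eta> y) x =
      T \<xi> x - S \<xi> x + (T \<eta> x - S \<eta> x)" if "\<xi> \<in> L2 M" "\<eta> \<in> L2 M" for \<xi> \<eta>
    using bounded_ops_add_AE[OF T that] bounded_ops_add_AE[OF S that] by eventually_elim simp
  moreover have "AE x in M. T (\<lambda>y. a * \<xi> y) x - S (\<lambda>y. a * \<xi> y) x = a * (T \<xi> x - S \<xi> x)"
    if "\<xi> \<in> L2 M" for a \<xi>
    using bounded_ops_cmult_AE[OF T that, of a] bounded_ops_cmult_AE[OF S that, of a]
    by eventually_elim (simp add: right_diff_distrib)
  ultimately show ?thesis
    using bounded_ops_L2[OF T] bounded_ops_L2[OF S] by (auto simp: bounded_ops_def)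
qed

text \<open>The limit operator is chosen vector by vector; uniqueness of limits makes it linear almost everywhere.\<close>

lemma bounded_ops_complete_geometric:
  assumes T: "\<And>n. T n \<in> bounded_ops M"
    and C: "\<And>n \<xi>. \<xi> \<in> L2 M \<Longrightarrow>
      l2_norm M (\<lambda>x. T (Suc n) \<xi> x - T n \<xi> x) \<le> C * (1/2)^n * l2_norm M \<xi>"
  shows "\<exists>R\<in>bounded_ops M. \<forall>n. \<forall>\<xi>\<in>L2 M.
    l2_norm M (\<lambda>x. R \<xi> x - T n \<xi> x) \<le> 2 * C * (1/2)^n * l2_norm M \<xi>"
proof -
  have "\<exists>\<rho>\<in>L2 M. \<forall>n. l2_norm M (\<lambda>x. \<rho> x - T n \<xi> x) \<le> 2 * (C * l2_norm M \<xi>) * (1/2)^n"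
    if "\<xi> \<in> L2 M" for \<xi>
    using C[OF that] bounded_ops_L2[OF T that] by (intro L2_complete_geometric) (auto simp: mult_ac)
  then have "\<forall>\<xi>\<in>L2 M. \<exists>\<rho>. \<rho> \<in> L2 M \<and>
      (\<forall>n. l2_norm M (\<lambda>x. \<rho> x - T n \<xi> x) \<le> 2 * (C * l2_norm M \<xi>) * (1/2)^n)"
    by blast
  from bchoice[OF this] obtain R where R: "\<And>\<xi>. \<xi> \<in> L2 M \<Longrightarrow> R \<xi> \<in> L2 M"
    and est': "\<And>\<xi> n. \<xi> \<in> L2 M \<Longrightarrow>
      l2_norm M (\<lambda>x. R \<xi> x - T n \<xi> x) \<le> 2 * (C * l2_norm M \<xi>) * (1/2)^n"
    by blast
  have est: "l2_norm M (\<lambda>x. R \<xi> x - T n \<xi> x) \<le> 2 * C * (1/2)^n * l2_norm M \<xi>"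
    if "\<xi> \<in> L2 M" for \<xi> n
    using est'[OF that, of n] by (simp only: mult_ac)
  have lim0: "(\<lambda>n. K * (1/2)^n) \<longlonglongrightarrow> 0" for K :: real
    by (intro tendsto_mult_right_zero LIMSEQ_power_zero) simp
  have uniq: "AE x in M. \<alpha> x = \<beta> x"
    if \<alpha>\<beta>: "\<alpha> \<in> L2 M" "\<beta> \<in> L2 M" and le: "\<And>n. l2_norm M (\<lambda>x. \<alpha> x - \<beta> x) \<le> K * (1/2)^n" for \<alpha> \<beta> K
  proof -
    have "l2_norm M (\<lambda>x. \<alpha> x - \<beta> x) \<le> 0"
      using le by (intro LIMSEQ_le_const[OF lim0[of K]]) auto
    then have "l2_norm M (\<lambda>x. \<alpha> x - \<beta> x) = 0"
      using l2_norm_nonneg[of M "\<lambda>x. \<alpha> x - \<beta> x"] by linarith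
    then show ?thesis using l2_norm_eq_0_iff[OF L2_diff[OF \<alpha>\<beta>]] by simp
  qed
  have add: "AE x in M. R (\<lambda>y. \<xi> y + \<eta> y) x = R \<xi> x + R \<eta> x"
    if \<xi>: "\<xi> \<in> L2 M" and \<eta>: "\<eta> \<in> L2 M" for \<xi> \<eta>
  proof (rule uniq)
    let ?s = "\<lambda>y. \<xi> y + \<eta> y"
    have s: "?s \<in> L2 M" using \<xi> \<eta> by auto
    fix n
    note L = R[OF s] R[OF \<xi>] R[OF \<eta>] bounded_ops_L2[OF T[of n] s]
      bounded_ops_L2[OF T[of n] \<xi>] bounded_ops_L2[OF T[of n] \<eta>]
    \<comment> \<open>T n respects the sum off a null set, so its values may be inserted; what
      remains are three approximation errors.\<close>
    have "l2_norm M (\<lambda>x. R ?s x - (R \<xi> x + R \<eta> x)) =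
      l2_norm M (\<lambda>x. (R ?s x - T n ?s x) - ((R \<xi> x - T n \<xi> x) + (R \<eta> x - T n \<eta> x)))"
      using bounded_ops_add_AE[OF T[of n] \<xi> \<eta>]
      by (intro l2_norm_cong_AE L2_measurable L2_diff L2_add L) auto
    also have "\<dots> \<le> l2_norm M (\<lambda>x. R ?s x - T n ?s x) +
      (l2_norm M (\<lambda>x. R \<xi> x - T n \<xi> x) + l2_norm M (\<lambda>x. R \<eta> x - T n \<eta> x))"
      by (intro order_trans[OF l2_norm_diff_le] add_left_mono l2_norm_triangle L2_diff L2_add L)
    also have "\<dots> \<le> (2 * C * (l2_norm M ?s + l2_norm M \<xi> + l2_norm M \<eta>)) * (1/2)^n"
      using est[OF s, of n] est[OF \<xi>, of n] est[OF \<eta>, of n] by (simp add: algebra_simps)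
    finally show "l2_norm M (\<lambda>x. R ?s x - (R \<xi> x + R \<eta> x)) \<le> \<dots>" .
  qed (use R \<xi> \<eta> in auto)
  have cmult: "AE x in M. R (\<lambda>y. c * \<xi> y) x = c * R \<xi> x" if \<xi>: "\<xi> \<in> L2 M" for c \<xi>
  proof (rule uniq)
    let ?s = "\<lambda>y. c * \<xi> y"
    have s: "?s \<in> L2 M" using \<xi> by auto
    fix n
    note L = R[OF s] R[OF \<xi>] bounded_ops_L2[OF T[of n] s] bounded_ops_L2[OF T[of n] \<xi>]
    have "l2_norm M (\<lambda>x. R ?s x - c * R \<xi> x) =
      l2_norm M (\<lambda>x. (R ?s x - T n ?s x) - c * (R \<xi> x - T n \<xi> x))"
      using bounded_ops_cmult_AE[OF T[of n] \<xi>, of c]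
      by (intro l2_norm_cong_AE L2_measurable L2_diff L2_cmult L) (auto simp: algebra_simps)
    also have "\<dots> \<le> l2_norm M (\<lambda>x. R ?s x - T n ?s x) + l2_norm M (\<lambda>x. c * (R \<xi> x - T n \<xi> x))"
      by (intro l2_norm_diff_le L2_diff L2_cmult L)
    also have "\<dots> \<le> 2 * C * (1/2)^n * l2_norm M ?s + cmod c * (2 * C * (1/2)^n * l2_norm M \<xi>)"
      unfolding l2_norm_cmult[of M c "\<lambda>x. R \<xi> x - T n \<xi> x"]
      by (intro add_mono mult_left_mono est s \<xi>) auto
    also have "\<dots> = (2 * C * l2_norm M ?s + cmod c * 2 * C * l2_norm M \<xi>) * (1/2)^n"
      by (simp add: algebra_simps)
    finally show "l2_norm M (\<lambda>x. R ?s x - c * R \<xi> x) \<le> \<dots>" .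
  qed (use R \<xi> in auto)
  obtain D where D: "0 \<le> D" "\<And>\<xi>. \<xi> \<in> L2 M \<Longrightarrow> l2_norm M (T 0 \<xi>) \<le> D * l2_norm M \<xi>"
    using bounded_ops_bound[OF T[of 0]] by blast
  have "l2_norm M (R \<xi>) \<le> (2 * C + D) * l2_norm M \<xi>" if \<xi>: "\<xi> \<in> L2 M" for \<xi>
    using l2_norm_triangle[of "\<lambda>x. R \<xi> x - T 0 \<xi> x" M "T 0 \<xi>"] R[OF \<xi>] bounded_ops_L2[OF T[of 0] \<xi>]
      est[OF \<xi>, of 0] D(2)[OF \<xi>] by (auto simp: distrib_right)
  then have "R \<in> bounded_ops M"
    using R add cmult unfolding bounded_ops_def by blast
  then show ?thesis using est by blast
qed

section \<open>Haar measures\<close>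

text \<open>Together with the next instance this puts the product type into the class that
  \<open>haar_group\<close> asks for, so that everything shown for one group applies to the product
  group.\<close>

instance prod :: (topological_monoid_add, topological_monoid_add) topological_monoid_add
proof
  fix a b :: "'a \<times> 'b"
  have 1: "(fst \<longlongrightarrow> a) (nhds a \<times>\<^sub>F nhds b)" and 2: "(snd \<longlongrightarrow> b) (nhds a \<times>\<^sub>F nhds b)"
    by (rule filterlim_fst filterlim_snd)+
  show "((\<lambda>x. fst x + snd x) \<longlongrightarrow> a + b) (nhds a \<times>\<^sub>F nhds b)"
    unfolding plus_prod_def
    by (intro tendsto_Pair tendsto_add tendsto_fst[OF 1] tendsto_fst[OF 2] tendsto_snd[OF 1] tendsto_snd[OF 2])
qed

instance prod :: (topological_group_add, topological_group_add) topological_group_add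
proof
  fix a :: "'a \<times> 'b"
  have "((\<lambda>x. x) \<longlongrightarrow> a) (nhds a)" by (rule filterlim_ident)
  then show "(uminus \<longlongrightarrow> - a) (nhds a)"
    unfolding uminus_prod_def[abs_def]
    by (intro tendsto_Pair tendsto_minus) (auto intro: tendsto_fst tendsto_snd)
qed

lemma continuous_on_group_uminus:
  fixes f :: "'b::topological_space \<Rightarrow> 'a::topological_group_add"
  shows "continuous_on S f \<Longrightarrow> continuous_on S (\<lambda>x. - f x)"
  unfolding continuous_on_def by (auto intro: tendsto_minus)

lemma borel_measurable_group_uminus [measurable (raw)]:
  fixes f :: "'b \<Rightarrow> 'a::{topological_group_add, second_countable_topology}"
  shows "f \<in> borel_measurable M \<Longrightarrow> (\<lambda>x. - f x) \<in> borel_measurable M"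
  by (rule borel_measurable_continuous_on[OF continuous_on_group_uminus[OF continuous_on_id]])

lemma sets_borel_pair [simp]:
  "sets (borel \<Otimes>\<^sub>M borel :: ('a::second_countable_topology \<times> 'b::second_countable_topology) measure) = sets borel"
  by (simp only: borel_prod)

text \<open>\<open>left_haar_measure\<close> is stated with images, whereas measurability and
  \<open>distr\<close> work with preimages. Left translation is a bijection with inverse the
  translation by - s.\<close>

lemma translate_image_eq_vimage:
  fixes s :: "'a::group_add"
  shows "(+) s ` B = (+) (- s) -` B"
proof -
  have "x \<in> (+) s ` B" if "- s + x \<in> B" for x
    using that by (auto intro!: image_eqI[where x="- s + x"] simp: add.assoc[symmetric])
  then show ?thesis by (auto simp: add.assoc[symmetric])
qed

lemma open_translate:
  fixes s :: "'a::topological_group_add"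
  shows "open U \<Longrightarrow> open ((+) s ` U)"
  unfolding translate_image_eq_vimage
  by (rule open_vimage) (auto intro: continuous_intros)

text \<open>Local compactness is recorded as the existence of a compact neighbourhood of each point,
  a form that passes to products by taking rectangles.\<close>

locale haar_group =
  fixes \<mu> :: "'a::{topological_group_add, second_countable_topology, t2_space} measure"
  assumes compact_nhd: "\<And>x::'a. \<exists>U K. open U \<and> x \<in> U \<and> U \<subseteq> K \<and> compact K"
    and haar: "left_haar_measure \<mu>"
begin

lemma sets_haar [simp, measurable_cong]: "sets \<mu> = sets borel"
  using haar by (simp add: left_haar_measure_def)

lemma space_haar [simp]: "space \<mu> = UNIV"
  using sets_eq_imp_space_eq[OF sets_haar] by simp

lemma emeasure_compact_finite: "compact K \<Longrightarrow> emeasure \<mu> K < \<infinity>"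
  using haar by (simp add: left_haar_measure_def)

lemma emeasure_translate: "B \<in> sets borel \<Longrightarrow> emeasure \<mu> ((+) s ` B) = emeasure \<mu> B"
  using haar by (simp add: left_haar_measure_def)

lemma distr_translate: "distr \<mu> borel ((+) s) = \<mu>"
proof (rule measure_eqI)
  fix B assume "B \<in> sets (distr \<mu> borel ((+) s))"
  then have B: "B \<in> sets borel" by simp
  have "emeasure (distr \<mu> borel ((+) s)) B = emeasure \<mu> ((+) (- (- s)) -` B)"
    using B by (subst emeasure_distr) auto
  also have "\<dots> = emeasure \<mu> B"
    using emeasure_translate[OF B, of "- s"] by (simp only: translate_image_eq_vimage)
  finally show "emeasure (distr \<mu> borel ((+) s)) B = emeasure \<mu> B" .
qed simp

lemma nn_integral_translate:
  assumes [measurable]: "f \<in> borel_measurable borel"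
  shows "(\<integral>\<^sup>+x. f (s + x) \<partial>\<mu>) = (\<integral>\<^sup>+x. f x \<partial>\<mu>)"
proof -
  have "(\<integral>\<^sup>+x. f x \<partial>distr \<mu> borel ((+) s)) = (\<integral>\<^sup>+x. f (s + x) \<partial>\<mu>)"
    by (rule nn_integral_distr) auto
  then show ?thesis by (simp add: distr_translate)
qed

text \<open>If U were null, so would be all its translates. They cover the group, and by Lindelof
  countably many of them do, which would make the whole group null.\<close>

lemma emeasure_open_pos:
  assumes "open U" "U \<noteq> {}"
  shows "0 < emeasure \<mu> U"
proof (rule ccontr)
  assume "\<not> 0 < emeasure \<mu> U"
  then have 0: "emeasure \<mu> U = 0" by simp
  obtain u where u: "u \<in> U" using assms by auto
  obtain \<F> where \<F>: "\<F> \<subseteq> range (\<lambda>s. (+) s ` U)" "countable \<F>" "\<Union>\<F> = \<Union>(range (\<lambda>s. (+) s ` U))"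
    using Lindelof[of "range (\<lambda>s. (+) s ` U)"] open_translate[OF assms(1)] by auto
  have "x \<in> \<Union>(range (\<lambda>s. (+) s ` U))" for x
    using u by (auto intro!: exI[of _ "x - u"] image_eqI[where x=u] simp: algebra_simps)
  then have "\<Union>\<F> = UNIV" using \<F>(3) by auto
  moreover have "(\<Union>A\<in>\<F>. A) \<in> null_sets \<mu>"
  proof (rule null_sets_UN'[OF \<F>(2)])
    fix A assume "A \<in> \<F>"
    then obtain s where A: "A = (+) s ` U" using \<F>(1) by auto
    show "A \<in> null_sets \<mu>"
      unfolding A using emeasure_translate[of U s] 0 open_translate[OF assms(1), of s] assms(1)
      by (auto intro!: null_setsI)
  qed
  ultimately show False
    using haar by (simp add: left_haar_measure_def null_sets_def)
qed

text \<open>Lindelof again: countably many open sets, each inside a compact set, cover the group.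
  Every later use of Fubini depends on this.\<close>

sublocale sigma_finite_measure \<mu>
proof
  obtain U K where UK: "\<And>x::'a. open (U x) \<and> x \<in> U x \<and> U x \<subseteq> K x \<and> compact (K x)"
    using compact_nhd by metis
  obtain \<F> where \<F>: "\<F> \<subseteq> range U" "countable \<F>" "\<Union>\<F> = \<Union>(range U)"
    using Lindelof[of "range U"] UK by auto
  have "\<Union>\<F> = UNIV" using UK \<F>(3) by auto
  moreover have "\<forall>A\<in>\<F>. A \<in> sets borel \<and> emeasure \<mu> A \<noteq> \<infinity>"
  proof
    fix A assume "A \<in> \<F>"
    then obtain x where A: "A = U x" using \<F>(1) by auto
    have "emeasure \<mu> (U x) \<le> emeasure \<mu> (K x)"
      using UK[of x] by (intro emeasure_mono) (auto intro: borel_compact)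
    then show "A \<in> sets borel \<and> emeasure \<mu> A \<noteq> \<infinity>"
      using emeasure_compact_finite[of "K x"] UK[of x] A by auto
  qed
  ultimately show "\<exists>A. countable A \<and> A \<subseteq> sets \<mu> \<and> \<Union> A = space \<mu> \<and> (\<forall>a\<in>A. emeasure \<mu> a \<noteq> \<infinity>)"
    using \<F>(2) by (intro exI[of _ \<F>]) auto
qed

end

section \<open>Uniqueness of Haar measure\<close>

text \<open>The substitution \<open>(x, y) \<mapsto> (- y, x + y)\<close> preserves the product of any two left Haar measures.\<close>

lemma nn_integral_haar_mult:
  assumes "haar_group \<mu>" "haar_group \<nu>"
    and [measurable]: "f \<in> borel_measurable borel" "g \<in> borel_measurable borel"
  shows "(\<integral>\<^sup>+x. f x \<partial>\<mu>) * (\<integral>\<^sup>+y. g y \<partial>\<nu>) = (\<integral>\<^sup>+y. f (- y) * (\<integral>\<^sup>+x. g (x + y) \<partial>\<mu>) \<partial>\<nu>)"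
proof -
  interpret M: haar_group \<mu> by fact
  interpret N: haar_group \<nu> by fact
  interpret pair_sigma_finite \<mu> \<nu> ..
  have "(\<integral>\<^sup>+x. f x \<partial>\<mu>) * (\<integral>\<^sup>+y. g y \<partial>\<nu>) = (\<integral>\<^sup>+y. (\<integral>\<^sup>+x. f x \<partial>\<mu>) * g y \<partial>\<nu>)"
    by (simp add: nn_integral_cmult)
  also have "\<dots> = (\<integral>\<^sup>+y. (\<integral>\<^sup>+x. f (- y + x) \<partial>\<mu>) * g y \<partial>\<nu>)"
    by (simp only: M.nn_integral_translate[OF assms(3)])
  also have "\<dots> = (\<integral>\<^sup>+y. (\<integral>\<^sup>+x. f (- y + x) * g y \<partial>\<mu>) \<partial>\<nu>)"
    by (simp add: nn_integral_multc)
  also have "\<dots> = (\<integral>\<^sup>+x. (\<integral>\<^sup>+y. f (- y + x) * g y \<partial>\<nu>) \<partial>\<mu>)"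
    by (rule Fubini') measurable
  \<comment> \<open>Left invariance of \<open>\<nu>\<close> under the translation of y by x: the
    argument of f becomes - (x + y) + x = - y, so x survives only inside g.\<close>
  also have "\<dots> = (\<integral>\<^sup>+x. (\<integral>\<^sup>+y. f (- (x + y) + x) * g (x + y) \<partial>\<nu>) \<partial>\<mu>)"
  proof (rule nn_integral_cong)
    fix x
    have "(\<lambda>y. f (- y + x) * g y) \<in> borel_measurable borel" by measurable
    from N.nn_integral_translate[OF this, of x]
    show "(\<integral>\<^sup>+y. f (- y + x) * g y \<partial>\<nu>) = (\<integral>\<^sup>+y. f (- (x + y) + x) * g (x + y) \<partial>\<nu>)" by (rule sym)
  qed
  also have "\<dots> = (\<integral>\<^sup>+x. (\<integral>\<^sup>+y. f (- y) * g (x + y) \<partial>\<nu>) \<partial>\<mu>)"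
    by (simp only: minus_add add.assoc left_minus add_0_right)
  also have "\<dots> = (\<integral>\<^sup>+y. (\<integral>\<^sup>+x. f (- y) * g (x + y) \<partial>\<mu>) \<partial>\<nu>)"
    by (rule Fubini'[symmetric]) measurable
  also have "\<dots> = (\<integral>\<^sup>+y. f (- y) * (\<integral>\<^sup>+x. g (x + y) \<partial>\<mu>) \<partial>\<nu>)"
    by (simp add: nn_integral_cmult)
  finally show ?thesis .
qed

text \<open>In \<open>nn_integral_haar_mult\<close> take f(x) = 1_B(-x) / D(-x) and g = 1_K. The
  weight D cancels and leaves kappa(B) = A(B) kappa(K), where A(B) depends on \<open>\<mu>\<close>
  and B but not on kappa. Taking kappa to be \<open>\<mu>\<close> and then \<open>\<nu>\<close>
  shows that the measures are proportional, with ratio determined by K.\<close>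

theorem haar_measure_unique:
  fixes \<mu> \<nu> :: "'a::{topological_group_add, second_countable_topology, t2_space} measure"
  assumes "haar_group \<mu>" "haar_group \<nu>"
  shows "\<exists>c>0. \<nu> = density \<mu> (\<lambda>_. ennreal c)"
proof -
  interpret M: haar_group \<mu> by fact
  interpret N: haar_group \<nu> by fact
  obtain U K :: "'a set" where UK: "open U" "0 \<in> U" "U \<subseteq> K" "compact K"
    using M.compact_nhd[of 0] by auto
  have [measurable]: "K \<in> sets borel" using UK by (simp add: borel_compact)
  define D where "D y = (\<integral>\<^sup>+x. indicator K (x + y) \<partial>\<mu>)" for y
  have [measurable]: "D \<in> borel_measurable borel"
    unfolding D_def by measurable
  have D: "D y \<noteq> 0" "D y \<noteq> top" for y
  proof -
    have img: "x \<in> (\<lambda>x. x + - y) ` K \<longleftrightarrow> x + y \<in> K" for x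
      by (auto simp: add.assoc intro!: image_eqI[where x="x + y"])
    have "D y = (\<integral>\<^sup>+x. indicator ((\<lambda>x. x + - y) ` K) x \<partial>\<mu>)"
      unfolding D_def by (intro nn_integral_cong) (simp only: indicator_def img)
    also have "\<dots> = emeasure \<mu> ((\<lambda>x. x + - y) ` K)"
      using UK(4) by (intro nn_integral_indicator)
        (auto intro!: borel_compact compact_continuous_image continuous_intros)
    finally have eq: "D y = emeasure \<mu> ((\<lambda>x. x + - y) ` K)" .
    have cpt: "compact ((\<lambda>x. x + - y) ` K)"
      using UK(4) by (intro compact_continuous_image continuous_intros)
    then show "D y \<noteq> top" using M.emeasure_compact_finite eq by fastforce
    have "open ((\<lambda>x. x + y) -` U)"
      using UK(1) by (intro open_vimage continuous_intros)
    moreover have "(\<lambda>x. x + y) -` U \<noteq> {}" using UK(2) by (auto dest!: equals0D[where a="- y"])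
    ultimately have "0 < emeasure \<mu> ((\<lambda>x. x + y) -` U)" by (rule M.emeasure_open_pos)
    also have "\<dots> \<le> emeasure \<mu> ((\<lambda>x. x + - y) ` K)"
    proof (rule emeasure_mono)
      show "(\<lambda>x. x + y) -` U \<subseteq> (\<lambda>x. x + - y) ` K"
        using UK(3) by (auto intro!: image_eqI[where x="_ + y"] simp: add.assoc)
    qed (use borel_compact[OF cpt] in simp)
    finally show "D y \<noteq> 0" using eq by simp
  qed
  have key: "(\<integral>\<^sup>+x. indicator B (- x) / D (- x) \<partial>\<mu>) * emeasure \<kappa> K = emeasure \<kappa> B"
    if "haar_group \<kappa>" and [measurable]: "B \<in> sets borel" for \<kappa> B
  proof -
    interpret L: haar_group \<kappa> by fact
    have "(\<integral>\<^sup>+x. indicator B (- x) / D (- x) \<partial>\<mu>) * (\<integral>\<^sup>+y. indicator K y \<partial>\<kappa>) =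
        (\<integral>\<^sup>+y. indicator B (- (- y)) / D (- (- y)) * D y \<partial>\<kappa>)"
      by (subst (3) D_def, rule nn_integral_haar_mult[OF assms(1) that(1)]) measurable
    also have "\<dots> = (\<integral>\<^sup>+y. indicator B y \<partial>\<kappa>)"
      using D by (intro nn_integral_cong) (simp add: ennreal_divide_times ennreal_divide_self less_top)
    finally show ?thesis by simp
  qed
  have pos: "emeasure \<kappa> K \<noteq> 0" "emeasure \<kappa> K \<noteq> top" if "haar_group \<kappa>" for \<kappa>
  proof -
    interpret L: haar_group \<kappa> by fact
    have "0 < emeasure \<kappa> U" using UK by (intro L.emeasure_open_pos) auto
    also have "\<dots> \<le> emeasure \<kappa> K" using UK by (intro emeasure_mono) auto
    finally show "emeasure \<kappa> K \<noteq> 0" by simp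
    show "emeasure \<kappa> K \<noteq> top" using L.emeasure_compact_finite[OF UK(4)] by simp
  qed
  obtain m where m: "emeasure \<mu> K = ennreal m" "0 < m"
    using pos[OF assms(1)] by (cases "emeasure \<mu> K") (auto simp: less_le)
  obtain n where n: "emeasure \<nu> K = ennreal n" "0 < n"
    using pos[OF assms(2)] by (cases "emeasure \<nu> K") (auto simp: less_le)
  have "\<nu> = density \<mu> (\<lambda>_. ennreal (n / m))"
  proof (rule measure_eqI)
    fix B assume "B \<in> sets \<nu>"
    then have B[measurable]: "B \<in> sets borel" by simp
    define A where "A = (\<integral>\<^sup>+x. indicator B (- x) / D (- x) \<partial>\<mu>)"
    have "emeasure \<nu> B = A * ennreal n"
      using key[OF assms(2) B] n by (simp add: A_def)
    also have "\<dots> = ennreal (n / m) * (A * ennreal m)"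
    proof -
      have "ennreal n = ennreal (n / m) * ennreal m"
        using m n by (simp add: ennreal_mult[symmetric])
      then show ?thesis by (simp only: mult_ac)
    qed
    also have "\<dots> = ennreal (n / m) * emeasure \<mu> B"
      using key[OF assms(1) B] m by (simp add: A_def)
    also have "\<dots> = emeasure (density \<mu> (\<lambda>_. ennreal (n / m))) B"
      by (subst emeasure_density) (auto simp: nn_integral_cmult)
    finally show "emeasure \<nu> B = emeasure (density \<mu> (\<lambda>_. ennreal (n / m))) B" .
  qed simp
  then show ?thesis using m n by (intro exI[of _ "n / m"]) auto
qed

section \<open>The product of two Haar measures is a Haar measure\<close>

locale haar_group_pair = M1: haar_group \<mu>\<^sub>1 + M2: haar_group \<mu>\<^sub>2
  for \<mu>\<^sub>1 :: "'a::{topological_group_add, second_countable_topology, t2_space} measure"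
    and \<mu>\<^sub>2 :: "'b::{topological_group_add, second_countable_topology, t2_space} measure"
begin

sublocale pair_sigma_finite \<mu>\<^sub>1 \<mu>\<^sub>2 ..

lemma sets_haar_pair [simp]: "sets (\<mu>\<^sub>1 \<Otimes>\<^sub>M \<mu>\<^sub>2) = sets borel"
proof -
  have "sets (\<mu>\<^sub>1 \<Otimes>\<^sub>M \<mu>\<^sub>2) = sets (borel \<Otimes>\<^sub>M borel)"
    by (rule sets_pair_measure_cong) auto
  then show ?thesis unfolding borel_prod .
qed

lemma compact_nhd_pair: "\<exists>U K. open U \<and> x \<in> U \<and> U \<subseteq> K \<and> compact (K :: ('a \<times> 'b) set)"
proof -
  obtain U K V L where "open U" "fst x \<in> U" "U \<subseteq> K" "compact K" "open V" "snd x \<in> V" "V \<subseteq> L" "compact L"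
    using M1.compact_nhd[of "fst x"] M2.compact_nhd[of "snd x"] by auto
  then show ?thesis
    by (intro exI[of _ "U \<times> V"] exI[of _ "K \<times> L"]) (auto intro!: open_Times compact_Times simp: mem_Times_iff)
qed

text \<open>Invariance is checked on iterated integrals, one coordinate at a time. A compact K has
  finite measure because it lies in the rectangle of its two projections, which are compact.\<close>

sublocale P: haar_group "\<mu>\<^sub>1 \<Otimes>\<^sub>M \<mu>\<^sub>2"
proof
  show "\<exists>U K. open U \<and> x \<in> U \<and> U \<subseteq> K \<and> compact K" for x :: "'a \<times> 'b"
    by (rule compact_nhd_pair)
  have "emeasure (\<mu>\<^sub>1 \<Otimes>\<^sub>M \<mu>\<^sub>2) ((+) s ` B) = emeasure (\<mu>\<^sub>1 \<Otimes>\<^sub>M \<mu>\<^sub>2) B" if "B \<in> sets borel" for s B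
  proof -
    have Bp[measurable]: "B \<in> sets (\<mu>\<^sub>1 \<Otimes>\<^sub>M \<mu>\<^sub>2)" using that unfolding sets_haar_pair .
    have iB[measurable]: "(\<lambda>x. indicator B x :: ennreal) \<in> borel_measurable (\<mu>\<^sub>1 \<Otimes>\<^sub>M \<mu>\<^sub>2)" by simp
    have [measurable]: "(\<lambda>x. indicator B (- s + x) :: ennreal) \<in> borel_measurable (\<mu>\<^sub>1 \<Otimes>\<^sub>M \<mu>\<^sub>2)"
      using that by (simp add: measurable_cong_sets[OF sets_haar_pair refl])
    have s: "- s + (x, y) = (- fst s + x, - snd s + y)" for x y
      by (cases s) (simp add: uminus_prod_def)
    have m1: "(\<lambda>y. indicator B (x, y) :: ennreal) \<in> borel_measurable borel" for x
      using measurable_Pair2[OF iB, of x] by (simp add: measurable_cong_sets[OF M2.sets_haar refl])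
    have m2: "(\<lambda>x. \<integral>\<^sup>+y. indicator B (x, y) \<partial>\<mu>\<^sub>2) \<in> borel_measurable borel"
      using M2.borel_measurable_nn_integral_fst[OF iB] by (simp add: measurable_cong_sets[OF M1.sets_haar refl])
    have "emeasure (\<mu>\<^sub>1 \<Otimes>\<^sub>M \<mu>\<^sub>2) ((+) s ` B) = (\<integral>\<^sup>+x. indicator B (- s + x) \<partial>(\<mu>\<^sub>1 \<Otimes>\<^sub>M \<mu>\<^sub>2))"
    proof -
      have "(+) (- s) -` B \<in> sets borel"
        using that by (intro measurable_sets_borel[OF _ that]) auto
      then have "emeasure (\<mu>\<^sub>1 \<Otimes>\<^sub>M \<mu>\<^sub>2) ((+) (- s) -` B)
          = (\<integral>\<^sup>+x. indicator ((+) (- s) -` B) x \<partial>(\<mu>\<^sub>1 \<Otimes>\<^sub>M \<mu>\<^sub>2))"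
        by (intro nn_integral_indicator[symmetric]) simp
      then show ?thesis
        by (simp only: translate_image_eq_vimage indicator_def vimage_eq)
    qed
    also have "\<dots> = (\<integral>\<^sup>+x. \<integral>\<^sup>+y. indicator B (- fst s + x, - snd s + y) \<partial>\<mu>\<^sub>2 \<partial>\<mu>\<^sub>1)"
      by (subst M2.nn_integral_fst[symmetric]) (auto simp: s)
    also have "\<dots> = (\<integral>\<^sup>+x. \<integral>\<^sup>+y. indicator B (- fst s + x, y) \<partial>\<mu>\<^sub>2 \<partial>\<mu>\<^sub>1)"
      by (simp only: M2.nn_integral_translate[OF m1])
    also have "\<dots> = (\<integral>\<^sup>+x. \<integral>\<^sup>+y. indicator B (x, y) \<partial>\<mu>\<^sub>2 \<partial>\<mu>\<^sub>1)"
      by (rule M1.nn_integral_translate[OF m2])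
    also have "\<dots> = emeasure (\<mu>\<^sub>1 \<Otimes>\<^sub>M \<mu>\<^sub>2) B"
      unfolding M2.nn_integral_fst[OF iB] by (rule nn_integral_indicator[OF Bp])
    finally show ?thesis .
  qed
  moreover have "emeasure (\<mu>\<^sub>1 \<Otimes>\<^sub>M \<mu>\<^sub>2) K < \<infinity>" if "compact K" for K
  proof -
    have c: "compact (fst ` K)" "compact (snd ` K)"
      using that by (auto intro!: compact_continuous_image continuous_intros)
    have "emeasure (\<mu>\<^sub>1 \<Otimes>\<^sub>M \<mu>\<^sub>2) K \<le> emeasure (\<mu>\<^sub>1 \<Otimes>\<^sub>M \<mu>\<^sub>2) (fst ` K \<times> snd ` K)"
      using c by (intro emeasure_mono pair_measureI) (auto intro: borel_compact rev_image_eqI)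
    also have "\<dots> = emeasure \<mu>\<^sub>1 (fst ` K) * emeasure \<mu>\<^sub>2 (snd ` K)"
      using c by (intro M2.emeasure_pair_measure_Times) (auto intro: borel_compact)
    also have "\<dots> < \<infinity>"
      using M1.emeasure_compact_finite[OF c(1)] M2.emeasure_compact_finite[OF c(2)]
      by (simp add: ennreal_mult_less_top)
    finally show ?thesis .
  qed
  moreover have "emeasure (\<mu>\<^sub>1 \<Otimes>\<^sub>M \<mu>\<^sub>2) UNIV \<noteq> 0"
    using M2.emeasure_pair_measure_Times[of UNIV \<mu>\<^sub>1 UNIV] M1.emeasure_open_pos[of UNIV]
      M2.emeasure_open_pos[of UNIV] by auto
  ultimately show "left_haar_measure (\<mu>\<^sub>1 \<Otimes>\<^sub>M \<mu>\<^sub>2)"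
    by (simp add: left_haar_measure_def)
qed

end

section \<open>The reduced C*-algebra and the Fourier algebra\<close>

context haar_group
begin

lemma L2_borel [measurable_dest]: "\<xi> \<in> L2 \<mu> \<Longrightarrow> \<xi> \<in> borel_measurable borel"
  using L2_measurable[of \<xi> \<mu>] by (simp add: measurable_cong_sets[OF sets_haar refl])

lemma integrable_borel: "integrable \<mu> f \<Longrightarrow> f \<in> borel_measurable borel"
  using borel_measurable_integrable[of \<mu> f] by (simp add: measurable_cong_sets[OF sets_haar refl])

section \<open>Translations, matrix coefficients and convolution operators on L2\<close>

lemma
  assumes \<xi>[measurable]: "\<xi> \<in> L2 \<mu>"
  shows L2_left_translation: "left_translation s \<xi> \<in> L2 \<mu>"
    and l2_norm_left_translation: "l2_norm \<mu> (left_translation s \<xi>) = l2_norm \<mu> \<xi>"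
proof -
  have m: "left_translation s \<xi> \<in> borel_measurable \<mu>"
    unfolding left_translation_def using L2_borel[OF \<xi>] by measurable
  have eq: "(\<integral>\<^sup>+x. ennreal ((cmod (left_translation s \<xi> x))\<^sup>2) \<partial>\<mu>) = (\<integral>\<^sup>+x. ennreal ((cmod (\<xi> x))\<^sup>2) \<partial>\<mu>)"
    unfolding left_translation_def
    using nn_integral_translate[of "\<lambda>x. ennreal ((cmod (\<xi> x))\<^sup>2)" "- s"] L2_borel[OF \<xi>] by simp
  show L2: "left_translation s \<xi> \<in> L2 \<mu>"
    using \<xi> m eq by (simp add: L2_iff_nn_integral)
  show "l2_norm \<mu> (left_translation s \<xi>) = l2_norm \<mu> \<xi>"
    using eq unfolding nn_integral_eq_l2_norm[OF L2] nn_integral_eq_l2_norm[OF \<xi>] by simp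
qed

lemma norm_matrix_coeff_le:
  "\<xi> \<in> L2 \<mu> \<Longrightarrow> \<eta> \<in> L2 \<mu> \<Longrightarrow> cmod (matrix_coeff \<mu> \<xi> \<eta> s) \<le> l2_norm \<mu> \<xi> * l2_norm \<mu> \<eta>"
  using norm_l2_inner_le[OF L2_left_translation, of \<xi> \<eta> s]
  by (simp add: matrix_coeff_def l2_norm_left_translation)

lemma borel_measurable_matrix_coeff [measurable]:
  assumes "\<xi> \<in> L2 \<mu>" "\<eta> \<in> L2 \<mu>"
  shows "matrix_coeff \<mu> \<xi> \<eta> \<in> borel_measurable borel"
proof -
  have [measurable]: "\<xi> \<in> borel_measurable borel" "\<eta> \<in> borel_measurable borel"
    using assms by (auto intro: L2_borel)
  show ?thesis
    unfolding matrix_coeff_def l2_inner_def left_translation_def by measurable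
qed

lemma integrable_mult_matrix_coeff:
  assumes f: "integrable \<mu> f" and "\<xi> \<in> L2 \<mu>" "\<eta> \<in> L2 \<mu>"
  shows "integrable \<mu> (\<lambda>s. f s * matrix_coeff \<mu> \<xi> \<eta> s)"
proof (rule Bochner_Integration.integrable_bound)
  show "integrable \<mu> (\<lambda>s. (l2_norm \<mu> \<xi> * l2_norm \<mu> \<eta>) * cmod (f s))"
    using f by simp
  have [measurable]: "f \<in> borel_measurable borel" by (rule integrable_borel[OF f])
  have [measurable]: "matrix_coeff \<mu> \<xi> \<eta> \<in> borel_measurable borel"
    using assms by (intro borel_measurable_matrix_coeff)
  show "(\<lambda>s. f s * matrix_coeff \<mu> \<xi> \<eta> s) \<in> borel_measurable \<mu>" by measurable
  show "AE s in \<mu>. norm (f s * matrix_coeff \<mu> \<xi> \<eta> s) \<le> norm ((l2_norm \<mu> \<xi> * l2_norm \<mu> \<eta>) * cmod (f s))"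
    using norm_matrix_coeff_le[OF assms(2,3)]
    by (intro AE_I2) (simp add: norm_mult mult.commute[of _ "cmod (f _)"] mult_left_mono)
qed

text \<open>Tonelli and invariance. This one computation yields both the almost everywhere existence
  of the convolution and its L2 bound.\<close>

lemma nn_integral_convolution_square:
  assumes f: "integrable \<mu> f" and \<xi>: "\<xi> \<in> L2 \<mu>"
  shows "(\<integral>\<^sup>+t. (\<integral>\<^sup>+s. ennreal (cmod (f s) * (cmod (\<xi> (- s + t)))\<^sup>2) \<partial>\<mu>) \<partial>\<mu>)
    = ennreal ((\<integral>s. cmod (f s) \<partial>\<mu>) * (l2_norm \<mu> \<xi>)\<^sup>2)"
proof -
  interpret P: pair_sigma_finite \<mu> \<mu> ..
  have [measurable]: "f \<in> borel_measurable borel" "\<xi> \<in> borel_measurable borel"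
    using f \<xi> by (auto intro: L2_borel integrable_borel)
  have "(\<integral>\<^sup>+t. (\<integral>\<^sup>+s. ennreal (cmod (f s) * (cmod (\<xi> (- s + t)))\<^sup>2) \<partial>\<mu>) \<partial>\<mu>)
      = (\<integral>\<^sup>+s. (\<integral>\<^sup>+t. ennreal (cmod (f s) * (cmod (\<xi> (- s + t)))\<^sup>2) \<partial>\<mu>) \<partial>\<mu>)"
    by (rule P.Fubini') measurable
  also have "\<dots> = (\<integral>\<^sup>+s. ennreal (cmod (f s)) * (\<integral>\<^sup>+t. ennreal ((cmod (\<xi> (- s + t)))\<^sup>2) \<partial>\<mu>) \<partial>\<mu>)"
    by (simp add: ennreal_mult' nn_integral_cmult)
  also have "\<dots> = (\<integral>\<^sup>+s. ennreal (cmod (f s)) * ennreal ((l2_norm \<mu> \<xi>)\<^sup>2) \<partial>\<mu>)"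
    using nn_integral_translate[of "\<lambda>t. ennreal ((cmod (\<xi> t))\<^sup>2)"]
    by (simp add: nn_integral_eq_l2_norm[OF \<xi>])
  also have "\<dots> = ennreal (\<integral>s. cmod (f s) \<partial>\<mu>) * ennreal ((l2_norm \<mu> \<xi>)\<^sup>2)"
    using f by (subst nn_integral_multc) (auto simp: nn_integral_eq_integral)
  finally show ?thesis by (simp add: ennreal_mult')
qed

lemma AE_integrable_convolution:
  assumes f: "integrable \<mu> f" and \<xi>: "\<xi> \<in> L2 \<mu>"
  shows "AE t in \<mu>. integrable \<mu> (\<lambda>s. f s * left_translation s \<xi> t)"
proof -
  have [measurable]: "f \<in> borel_measurable borel" "\<xi> \<in> borel_measurable borel"
    using f \<xi> by (auto intro: L2_borel integrable_borel)
  have "AE t in \<mu>. (\<integral>\<^sup>+s. ennreal (cmod (f s) * (cmod (\<xi> (- s + t)))\<^sup>2) \<partial>\<mu>) \<noteq> \<infinity>"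
    using nn_integral_convolution_square[OF f \<xi>] by (intro nn_integral_PInf_AE) auto
  then show ?thesis
  proof eventually_elim
    case (elim t)
    then have "integrable \<mu> (\<lambda>s. cmod (f s) * (cmod (\<xi> (- s + t)))\<^sup>2)"
      by (intro integrableI_bounded) (auto simp: less_top)
    then have "integrable \<mu> (\<lambda>s. cmod (f s) + cmod (f s) * (cmod (\<xi> (- s + t)))\<^sup>2)"
      using f by simp
    then show ?case
      unfolding left_translation_def
    proof (rule Bochner_Integration.integrable_bound)
      \<comment> \<open>With a = |xi| this dominates |f| |xi| by |f| + |f| |xi|^2, which is
        integrable in s for almost every t.\<close>
      have "a \<le> 1 + a\<^sup>2" for a :: real
        using zero_le_power2[of "a - 1/2"] by (simp add: power2_eq_square algebra_simps)
      then have "cmod (f s) * cmod (\<xi> (- s + t)) \<le> cmod (f s) * (1 + (cmod (\<xi> (- s + t)))\<^sup>2)" for s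
        by (intro mult_left_mono) auto
      then show "AE s in \<mu>. norm (f s * \<xi> (- s + t)) \<le> norm (cmod (f s) + cmod (f s) * (cmod (\<xi> (- s + t)))\<^sup>2)"
        by (intro AE_I2) (simp add: norm_mult distrib_left)
    qed measurable
  qed
qed

text \<open>Young's inequality for exponents 1 and 2. Splitting |f| |xi| as |f|^(1/2) times
  |f|^(1/2) |xi|, Cauchy-Schwarz bounds the squared value at t by the L1 norm of f times the
  convolution of |f| and |xi|^2 at t; this is then integrated over t.\<close>

lemma
  assumes f: "integrable \<mu> f" and \<xi>: "\<xi> \<in> L2 \<mu>"
  shows L2_convolution: "left_convolution \<mu> f \<xi> \<in> L2 \<mu>"
    and l2_norm_convolution_le: "l2_norm \<mu> (left_convolution \<mu> f \<xi>) \<le> (\<integral>s. cmod (f s) \<partial>\<mu>) * l2_norm \<mu> \<xi>"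
proof -
  have [measurable]: "f \<in> borel_measurable borel" "\<xi> \<in> borel_measurable borel"
    using f \<xi> by (auto intro: L2_borel integrable_borel)
  have m: "left_convolution \<mu> f \<xi> \<in> borel_measurable \<mu>"
    unfolding left_convolution_def left_translation_def by measurable
  let ?F = "\<integral>s. cmod (f s) \<partial>\<mu>"
  let ?W = "\<lambda>t. \<integral>\<^sup>+s. ennreal (cmod (f s) * (cmod (\<xi> (- s + t)))\<^sup>2) \<partial>\<mu>"
  have pt: "ennreal ((cmod (left_convolution \<mu> f \<xi> t))\<^sup>2) \<le> ennreal ?F * ?W t" for t
  proof (cases "integrable \<mu> (\<lambda>s. f s * left_translation s \<xi> t)")
    case True
    have "ennreal (cmod (left_convolution \<mu> f \<xi> t)) \<le> (\<integral>\<^sup>+s. ennreal (cmod (f s * left_translation s \<xi> t)) \<partial>\<mu>)"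
      unfolding left_convolution_def by (rule integral_norm_bound_ennreal[OF True])
    also have "\<dots> = (\<integral>\<^sup>+s. ennreal (sqrt (cmod (f s))) * ennreal (sqrt (cmod (f s)) * cmod (\<xi> (- s + t))) \<partial>\<mu>)"
      by (simp add: left_translation_def norm_mult ennreal_mult'[symmetric] mult.assoc[symmetric])
    finally have "(ennreal (cmod (left_convolution \<mu> f \<xi> t)))\<^sup>2 \<le>
        (\<integral>\<^sup>+s. ennreal (sqrt (cmod (f s))) * ennreal (sqrt (cmod (f s)) * cmod (\<xi> (- s + t))) \<partial>\<mu>)\<^sup>2"
      by (rule power_mono) simp
    also have "\<dots> \<le> (\<integral>\<^sup>+s. (ennreal (sqrt (cmod (f s))))\<^sup>2 \<partial>\<mu>) *
        (\<integral>\<^sup>+s. (ennreal (sqrt (cmod (f s)) * cmod (\<xi> (- s + t))))\<^sup>2 \<partial>\<mu>)"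
      by (rule Cauchy_Schwarz_nn_integral) measurable
    also have "\<dots> = ennreal ?F * ?W t"
      using f by (simp add: ennreal_power power_mult_distrib nn_integral_eq_integral)
    finally show ?thesis by (simp add: ennreal_power)
  \<comment> \<open>Where the integral does not exist, the convolution has the value 0 by
    convention, so the bound is trivial.\<close>
  qed (simp add: left_convolution_def not_integrable_integral_eq)
  have "(\<integral>\<^sup>+t. ennreal ((cmod (left_convolution \<mu> f \<xi> t))\<^sup>2) \<partial>\<mu>) \<le> (\<integral>\<^sup>+t. ennreal ?F * ?W t \<partial>\<mu>)"
    by (intro nn_integral_mono pt)
  also have "\<dots> = ennreal ?F * (\<integral>\<^sup>+t. ?W t \<partial>\<mu>)"
    by (rule nn_integral_cmult) measurable
  also have "\<dots> = ennreal ((?F * l2_norm \<mu> \<xi>)\<^sup>2)"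
    unfolding nn_integral_convolution_square[OF f \<xi>]
    by (simp add: ennreal_mult'[symmetric] power2_eq_square mult_ac)
  finally have le: "(\<integral>\<^sup>+t. ennreal ((cmod (left_convolution \<mu> f \<xi> t))\<^sup>2) \<partial>\<mu>) \<le> ennreal ((?F * l2_norm \<mu> \<xi>)\<^sup>2)" .
  show "left_convolution \<mu> f \<xi> \<in> L2 \<mu>"
    by (rule L2_nn_integralI[OF m _ le]) simp
  show "l2_norm \<mu> (left_convolution \<mu> f \<xi>) \<le> ?F * l2_norm \<mu> \<xi>"
    by (rule l2_norm_le_nn_integralI[OF m _ le]) simp
qed

lemma left_convolution_bounded:
  assumes f: "integrable \<mu> f"
  shows "left_convolution \<mu> f \<in> bounded_ops \<mu>"
proof -
  have "AE t in \<mu>. left_convolution \<mu> f (\<lambda>y. \<xi> y + \<eta> y) t = left_convolution \<mu> f \<xi> t + left_convolution \<mu> f \<eta> t"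
    if "\<xi> \<in> L2 \<mu>" "\<eta> \<in> L2 \<mu>" for \<xi> \<eta>
    using AE_integrable_convolution[OF f that(1)] AE_integrable_convolution[OF f that(2)]
    by eventually_elim (simp add: left_convolution_def left_translation_def distrib_left)
  moreover have "left_convolution \<mu> f (\<lambda>y. c * \<xi> y) t = c * left_convolution \<mu> f \<xi> t" for c \<xi> t
    by (simp add: left_convolution_def left_translation_def mult.left_commute)
  ultimately show ?thesis
    using L2_convolution[OF f] l2_norm_convolution_le[OF f] unfolding bounded_ops_def
    by (auto intro!: exI[of _ "\<integral>s. cmod (f s) \<partial>\<mu>"])
qed

lemma l2_inner_convolution:
  assumes f: "integrable \<mu> f" and \<xi>: "\<xi> \<in> L2 \<mu>" and \<eta>: "\<eta> \<in> L2 \<mu>"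
  shows "l2_inner \<mu> (left_convolution \<mu> f \<xi>) \<eta> = (\<integral>s. f s * matrix_coeff \<mu> \<xi> \<eta> s \<partial>\<mu>)"
proof -
  interpret P: pair_sigma_finite \<mu> \<mu> ..
  have [measurable]: "f \<in> borel_measurable borel" "\<xi> \<in> borel_measurable borel" "\<eta> \<in> borel_measurable borel"
    using f \<xi> \<eta> by (auto intro: L2_borel integrable_borel)
  let ?g = "\<lambda>s t. f s * \<xi> (- s + t) * cnj (\<eta> t)"
  have int: "integrable (\<mu> \<Otimes>\<^sub>M \<mu>) (case_prod ?g)"
  proof (rule integrableI_bounded)
    show m: "case_prod ?g \<in> borel_measurable (\<mu> \<Otimes>\<^sub>M \<mu>)" by measurable
    have "(\<integral>\<^sup>+z. ennreal (norm (case_prod ?g z)) \<partial>(\<mu> \<Otimes>\<^sub>M \<mu>)) = (\<integral>\<^sup>+s. (\<integral>\<^sup>+t. ennreal (norm (?g s t)) \<partial>\<mu>) \<partial>\<mu>)"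
      using nn_integral_fst[of "\<lambda>z. ennreal (norm (case_prod ?g z))" \<mu>] m by simp
    also have "\<dots> = (\<integral>\<^sup>+s. ennreal (cmod (f s)) * (\<integral>\<^sup>+t. ennreal (cmod (left_translation s \<xi> t) * cmod (\<eta> t)) \<partial>\<mu>) \<partial>\<mu>)"
      by (simp add: norm_mult ennreal_mult' nn_integral_cmult mult.assoc left_translation_def)
    \<comment> \<open>Translation is isometric, so the inner integral is bounded uniformly in s;
      with f integrable this justifies Fubini.\<close>
    also have "\<dots> \<le> (\<integral>\<^sup>+s. ennreal (cmod (f s)) * ennreal (l2_norm \<mu> \<xi> * l2_norm \<mu> \<eta>) \<partial>\<mu>)"
      using nn_integral_mult_le_l2_norm[OF L2_left_translation[OF \<xi>] \<eta>]
      by (intro nn_integral_mono mult_left_mono) (auto simp: l2_norm_left_translation[OF \<xi>])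
    also have "\<dots> = (\<integral>\<^sup>+s. ennreal (cmod (f s)) \<partial>\<mu>) * ennreal (l2_norm \<mu> \<xi> * l2_norm \<mu> \<eta>)"
      by (rule nn_integral_multc) measurable
    also have "\<dots> < \<infinity>"
      using f by (simp add: integrable_iff_bounded ennreal_mult_less_top)
    finally show "(\<integral>\<^sup>+z. ennreal (norm (case_prod ?g z)) \<partial>(\<mu> \<Otimes>\<^sub>M \<mu>)) < \<infinity>" .
  qed
  have "l2_inner \<mu> (left_convolution \<mu> f \<xi>) \<eta> = (\<integral>t. (\<integral>s. ?g s t \<partial>\<mu>) \<partial>\<mu>)"
    by (simp add: l2_inner_def left_convolution_def left_translation_def)
  also have "\<dots> = (\<integral>s. (\<integral>t. ?g s t \<partial>\<mu>) \<partial>\<mu>)"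
    by (rule P.Fubini_integral[OF int])
  also have "\<dots> = (\<integral>s. f s * matrix_coeff \<mu> \<xi> \<eta> s \<partial>\<mu>)"
    by (simp add: matrix_coeff_def l2_inner_def left_translation_def mult.assoc)
  finally show ?thesis .
qed

lemma left_convolution_cmult: "left_convolution \<mu> (\<lambda>s. c * f s) = (\<lambda>\<xi> x. c * left_convolution \<mu> f \<xi> x)"
  by (simp add: left_convolution_def fun_eq_iff mult.assoc)

section \<open>Approximation and limits in the reduced C*-algebra\<close>

lemma cstar_bounded: "T \<in> reduced_group_cstar \<mu> \<Longrightarrow> T \<in> bounded_ops \<mu>"
  by (simp add: reduced_group_cstar_def op_norm_closure_def)

lemma cstar_approx:
  assumes T: "T \<in> reduced_group_cstar \<mu>" and "0 < \<epsilon>"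
  obtains f where "integrable \<mu> f"
    "\<And>\<xi>. \<xi> \<in> L2 \<mu> \<Longrightarrow> l2_norm \<mu> (\<lambda>x. T \<xi> x - left_convolution \<mu> f \<xi> x) \<le> \<epsilon> * l2_norm \<mu> \<xi>"
proof -
  obtain f where f: "integrable \<mu> f" and le: "op_norm \<mu> (\<lambda>\<xi> x. T \<xi> x - left_convolution \<mu> f \<xi> x) < \<epsilon>"
    using assms unfolding reduced_group_cstar_def op_norm_closure_def by blast
  note b = bounded_ops_diff[OF cstar_bounded[OF T] left_convolution_bounded[OF f]]
  have "l2_norm \<mu> (\<lambda>x. T \<xi> x - left_convolution \<mu> f \<xi> x) \<le> \<epsilon> * l2_norm \<mu> \<xi>" if "\<xi> \<in> L2 \<mu>" for \<xi>
    by (rule order_trans[OF l2_norm_le_op_norm[OF b that]]) (use le in \<open>simp add: mult_right_mono\<close>)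
  then show ?thesis using f that by blast
qed

text \<open>The rate (1/2)^n is fixed here so that every sequence derived from this one has
  geometrically decaying increments, as \<open>cstar_limit\<close> requires.\<close>

lemma cstar_approx_seq:
  assumes T: "T \<in> reduced_group_cstar \<mu>"
  obtains f where "\<And>n. integrable \<mu> (f n)"
    "\<And>n \<xi>. \<xi> \<in> L2 \<mu> \<Longrightarrow>
      l2_norm \<mu> (\<lambda>x. T \<xi> x - left_convolution \<mu> (f n) \<xi> x) \<le> (1/2)^n * l2_norm \<mu> \<xi>"
proof -
  have "\<exists>f. integrable \<mu> f \<and> (\<forall>\<xi>\<in>L2 \<mu>. l2_norm \<mu> (\<lambda>x. T \<xi> x - left_convolution \<mu> f \<xi> x) \<le> (1/2)^n * l2_norm \<mu> \<xi>)"
    for n :: nat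
    by (rule cstar_approx[OF T, of "(1/2)^n"]) auto
  then have "\<forall>n::nat. \<exists>f. integrable \<mu> f \<and> (\<forall>\<xi>\<in>L2 \<mu>. l2_norm \<mu> (\<lambda>x. T \<xi> x - left_convolution \<mu> f \<xi> x) \<le> (1/2)^n * l2_norm \<mu> \<xi>)"
    by blast
  from choice[OF this] show ?thesis using that by blast
qed

text \<open>The source of slices and tensor products, which exist only as limits: their
  approximating kernels k n are explicit, and the rate of convergence is kept in order to pass to
  the limit in inner products.\<close>

lemma cstar_limit:
  assumes k: "\<And>n. integrable \<mu> (k n)" and "0 \<le> C"
    and est: "\<And>n \<xi>. \<xi> \<in> L2 \<mu> \<Longrightarrow>
      l2_norm \<mu> (\<lambda>x. left_convolution \<mu> (k (Suc n)) \<xi> x - left_convolution \<mu> (k n) \<xi> x)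
        \<le> C * (1/2)^n * l2_norm \<mu> \<xi>"
  shows "\<exists>R\<in>reduced_group_cstar \<mu>. \<forall>n. \<forall>\<xi>\<in>L2 \<mu>.
    l2_norm \<mu> (\<lambda>x. R \<xi> x - left_convolution \<mu> (k n) \<xi> x) \<le> 2 * C * (1/2)^n * l2_norm \<mu> \<xi>"
proof -
  obtain R where R: "R \<in> bounded_ops \<mu>" and le: "\<And>n \<xi>. \<xi> \<in> L2 \<mu> \<Longrightarrow>
      l2_norm \<mu> (\<lambda>x. R \<xi> x - left_convolution \<mu> (k n) \<xi> x) \<le> 2 * C * (1/2)^n * l2_norm \<mu> \<xi>"
    using bounded_ops_complete_geometric[OF left_convolution_bounded[OF k] est] by blast
  have "\<exists>S\<in>left_convolution \<mu> ` {f. integrable \<mu> f}. op_norm \<mu> (\<lambda>\<xi> x. R \<xi> x - S \<xi> x) < \<epsilon>"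
    if "0 < \<epsilon>" for \<epsilon>
  proof -
    have "(\<lambda>n. 2 * C * (1/2)^n) \<longlonglongrightarrow> 0"
      by (intro tendsto_mult_right_zero LIMSEQ_power_zero) simp
    then have "\<forall>\<^sub>F n in sequentially. 2 * C * (1/2)^n < \<epsilon>"
      by (rule order_tendstoD(2)[OF _ that])
    then obtain n where n: "2 * C * (1/2)^n < \<epsilon>"
      by (auto simp: eventually_sequentially)
    have "op_norm \<mu> (\<lambda>\<xi> x. R \<xi> x - left_convolution \<mu> (k n) \<xi> x) \<le> 2 * C * (1/2)^n"
      using le \<open>0 \<le> C\<close> by (intro op_norm_le) auto
    then show ?thesis using n k by (intro bexI[of _ "left_convolution \<mu> (k n)"]) auto
  qed
  then have "R \<in> reduced_group_cstar \<mu>"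
    using R by (simp add: reduced_group_cstar_def op_norm_closure_def)
  then show ?thesis using le by blast
qed

lemma cstar_cmult:
  assumes T: "T \<in> reduced_group_cstar \<mu>"
  shows "(\<lambda>\<xi> x. c * T \<xi> x) \<in> reduced_group_cstar \<mu>"
proof -
  have "\<exists>S\<in>left_convolution \<mu> ` {f. integrable \<mu> f}. op_norm \<mu> (\<lambda>\<xi> x. c * T \<xi> x - S \<xi> x) < \<epsilon>"
    if "0 < \<epsilon>" for \<epsilon>
  proof -
    \<comment> \<open>The summand 1 keeps the denominator positive when c = 0.\<close>
    define \<delta> where "\<delta> = \<epsilon> / (cmod c + 1)"
    have \<delta>: "0 < \<delta>" "cmod c * \<delta> < \<epsilon>"
      using that by (auto simp: \<delta>_def field_simps add_pos_nonneg)
    obtain f where f: "integrable \<mu> f"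
      "\<And>\<xi>. \<xi> \<in> L2 \<mu> \<Longrightarrow> l2_norm \<mu> (\<lambda>x. T \<xi> x - left_convolution \<mu> f \<xi> x) \<le> \<delta> * l2_norm \<mu> \<xi>"
      using cstar_approx[OF T \<delta>(1)] by blast
    have "op_norm \<mu> (\<lambda>\<xi> x. c * T \<xi> x - left_convolution \<mu> (\<lambda>s. c * f s) \<xi> x) \<le> cmod c * \<delta>"
    proof (rule op_norm_le)
      fix \<xi> assume \<xi>: "\<xi> \<in> L2 \<mu>"
      show "l2_norm \<mu> (\<lambda>x. c * T \<xi> x - left_convolution \<mu> (\<lambda>s. c * f s) \<xi> x) \<le> cmod c * \<delta> * l2_norm \<mu> \<xi>"
        using mult_left_mono[OF f(2)[OF \<xi>], of "cmod c"]
        unfolding left_convolution_cmult right_diff_distrib[symmetric] l2_norm_cmult by (simp add: mult.assoc)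
    qed (use \<delta> in simp)
    then show ?thesis
      using \<delta> f(1) by (intro bexI[of _ "left_convolution \<mu> (\<lambda>s. c * f s)"]) auto
  qed
  then show ?thesis
    using bounded_ops_cmult[OF cstar_bounded[OF T]]
    by (simp add: reduced_group_cstar_def op_norm_closure_def)
qed

section \<open>Well-definedness and continuity of the pairing with the Fourier algebra\<close>

lemma cstar_subset_VN: "T \<in> reduced_group_cstar \<mu> \<Longrightarrow> T \<in> group_VN \<mu>"
  using cstar_bounded[of T] by (force simp: group_VN_def weak_star_closure_def)

lemma VN_bounded: "T \<in> group_VN \<mu> \<Longrightarrow> T \<in> bounded_ops \<mu>"
  by (simp add: group_VN_def weak_star_closure_def)

lemma norm_l2_inner_op_diff_le:
  assumes "T \<in> bounded_ops \<mu>" "S \<in> bounded_ops \<mu>" and \<xi>: "\<xi> \<in> L2 \<mu>" and \<eta>: "\<eta> \<in> L2 \<mu>"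
    and le: "l2_norm \<mu> (\<lambda>x. T \<xi> x - S \<xi> x) \<le> \<epsilon> * l2_norm \<mu> \<xi>"
  shows "cmod (l2_inner \<mu> (T \<xi>) \<eta> - l2_inner \<mu> (S \<xi>) \<eta>) \<le> \<epsilon> * (l2_norm \<mu> \<xi> * l2_norm \<mu> \<eta>)"
proof -
  have L: "T \<xi> \<in> L2 \<mu>" "S \<xi> \<in> L2 \<mu>" using assms by (auto intro: bounded_ops_L2)
  have "cmod (l2_inner \<mu> (T \<xi>) \<eta> - l2_inner \<mu> (S \<xi>) \<eta>) \<le> l2_norm \<mu> (\<lambda>x. T \<xi> x - S \<xi> x) * l2_norm \<mu> \<eta>"
    using norm_l2_inner_le[OF L2_diff[OF L] \<eta>] by (simp add: l2_inner_diff_left L \<eta>)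
  also have "\<dots> \<le> \<epsilon> * l2_norm \<mu> \<xi> * l2_norm \<mu> \<eta>"
    by (rule mult_right_mono[OF le]) simp
  finally show ?thesis by (simp add: mult.assoc)
qed

text \<open>For a convolution operator the sum is the integral of f times the vanishing sum of
  coefficients, hence 0. Norm approximation carries this over to T, since only finitely many vectors
  are involved.\<close>

lemma cstar_sum_l2_inner_eq_0:
  fixes n :: nat
  assumes T: "T \<in> reduced_group_cstar \<mu>"
    and L: "\<And>i. i < n \<Longrightarrow> \<xi> i \<in> L2 \<mu>" "\<And>i. i < n \<Longrightarrow> \<eta> i \<in> L2 \<mu>"
    and 0: "\<And>s. (\<Sum>i<n. matrix_coeff \<mu> (\<xi> i) (\<eta> i) s) = 0"
  shows "(\<Sum>i<n. l2_inner \<mu> (T (\<xi> i)) (\<eta> i)) = 0"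
proof -
  let ?K = "\<Sum>i<n. l2_norm \<mu> (\<xi> i) * l2_norm \<mu> (\<eta> i)"
  have "cmod (\<Sum>i<n. l2_inner \<mu> (T (\<xi> i)) (\<eta> i)) \<le> \<epsilon> * ?K" if \<epsilon>: "0 < \<epsilon>" for \<epsilon>
  proof -
    obtain f where f: "integrable \<mu> f"
      "\<And>\<xi>. \<xi> \<in> L2 \<mu> \<Longrightarrow> l2_norm \<mu> (\<lambda>x. T \<xi> x - left_convolution \<mu> f \<xi> x) \<le> \<epsilon> * l2_norm \<mu> \<xi>"
      using cstar_approx[OF T \<epsilon>] by blast
    have "(\<Sum>i<n. l2_inner \<mu> (left_convolution \<mu> f (\<xi> i)) (\<eta> i)) = (\<Sum>i<n. \<integral>s. f s * matrix_coeff \<mu> (\<xi> i) (\<eta> i) s \<partial>\<mu>)"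
      using L by (intro sum.cong) (auto simp: l2_inner_convolution[OF f(1)])
    also have "\<dots> = (\<integral>s. (\<Sum>i<n. f s * matrix_coeff \<mu> (\<xi> i) (\<eta> i) s) \<partial>\<mu>)"
      using L by (intro Bochner_Integration.integral_sum[symmetric] integrable_mult_matrix_coeff f) auto
    also have "\<dots> = 0" by (simp add: sum_distrib_left[symmetric] 0)
    finally have "cmod (\<Sum>i<n. l2_inner \<mu> (T (\<xi> i)) (\<eta> i)) =
        cmod (\<Sum>i<n. l2_inner \<mu> (T (\<xi> i)) (\<eta> i) - l2_inner \<mu> (left_convolution \<mu> f (\<xi> i)) (\<eta> i))"
      by (simp add: sum_subtractf)
    also have "\<dots> \<le> (\<Sum>i<n. \<epsilon> * (l2_norm \<mu> (\<xi> i) * l2_norm \<mu> (\<eta> i)))"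
      using L f(2) by (intro sum_norm_le norm_l2_inner_op_diff_le cstar_bounded[OF T] left_convolution_bounded f(1)) auto
    finally show ?thesis by (simp add: sum_distrib_left)
  qed
  note le = this
  have K: "0 \<le> ?K" by (intro sum_nonneg) auto
  have "cmod (\<Sum>i<n. l2_inner \<mu> (T (\<xi> i)) (\<eta> i)) \<le> 0"
  proof (rule field_le_epsilon)
    fix e :: real assume e: "0 < e"
    have "e / (?K + 1) * ?K \<le> e" using e K by (simp add: field_simps)
    then show "cmod (\<Sum>i<n. l2_inner \<mu> (T (\<xi> i)) (\<eta> i)) \<le> 0 + e"
      using le[of "e / (?K + 1)"] e K by auto
  qed
  then show ?thesis by simp
qed

text \<open>A finite sum of vector functionals is a single trace functional, so it is weak* continuous.\<close>

lemma VN_sum_l2_inner_eq_0: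
  fixes n :: nat
  assumes T: "T \<in> group_VN \<mu>"
    and L: "\<And>i. i < n \<Longrightarrow> \<xi> i \<in> L2 \<mu>" "\<And>i. i < n \<Longrightarrow> \<eta> i \<in> L2 \<mu>"
    and 0: "\<And>s. (\<Sum>i<n. matrix_coeff \<mu> (\<xi> i) (\<eta> i) s) = 0"
  shows "(\<Sum>i<n. l2_inner \<mu> (T (\<xi> i)) (\<eta> i)) = 0"
proof -
  define \<Xi> H where "\<Xi> i = (if i < n then \<xi> i else (\<lambda>x. 0))" and "H i = (if i < n then \<eta> i else (\<lambda>x. 0))" for i
  have sq: "\<Xi> \<in> sq_summable_seqs \<mu>" "H \<in> sq_summable_seqs \<mu>"
    using L by (auto simp: sq_summable_seqs_def \<Xi>_def H_def intro!: summable_finite[of "{..<n}"] split: if_splits)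
  have tr: "trace_functional \<mu> \<Xi> H S = (\<Sum>i<n. l2_inner \<mu> (S (\<xi> i)) (\<eta> i))" for S
  proof -
    have "trace_functional \<mu> \<Xi> H S = (\<Sum>i<n. l2_inner \<mu> (S (\<Xi> i)) (H i))"
      unfolding trace_functional_def by (rule suminf_finite) (auto simp: H_def)
    also have "\<dots> = (\<Sum>i<n. l2_inner \<mu> (S (\<xi> i)) (\<eta> i))"
      by (rule sum.cong) (auto simp: \<Xi>_def H_def)
    finally show ?thesis .
  qed
  have "cmod (trace_functional \<mu> \<Xi> H T) \<le> 0"
  proof (rule field_le_epsilon)
    fix e :: real assume e: "0 < e"
    have "\<exists>S\<in>reduced_group_cstar \<mu>. \<forall>(X, Y)\<in>{(\<Xi>, H)}.
        cmod (trace_functional \<mu> X Y T - trace_functional \<mu> X Y S) < e"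
      using T sq e unfolding group_VN_def weak_star_closure_def by blast
    then obtain S where S: "S \<in> reduced_group_cstar \<mu>"
      "cmod (trace_functional \<mu> \<Xi> H T - trace_functional \<mu> \<Xi> H S) < e" by auto
    have "trace_functional \<mu> \<Xi> H S = 0"
      using cstar_sum_l2_inner_eq_0[OF S(1), of n \<xi> \<eta>] L 0 tr by auto
    then show "cmod (trace_functional \<mu> \<Xi> H T) \<le> 0 + e" using S(2) by simp
  qed
  then show ?thesis by (simp add: tr)
qed

lemma matrix_coeff_uminus_right: "matrix_coeff \<mu> \<xi> (\<lambda>x. - \<eta> x) s = - matrix_coeff \<mu> \<xi> \<eta> s"
  by (simp add: matrix_coeff_def l2_inner_def)

lemma l2_inner_uminus_right: "l2_inner \<mu> \<xi> (\<lambda>x. - \<eta> x) = - l2_inner \<mu> \<xi> \<eta>"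
  by (simp add: l2_inner_def)

text \<open>The two-term case of \<open>VN_sum_l2_inner_eq_0\<close>, with the second term negated
  through its right vector. This uniqueness is what gives the definite description in
  \<open>fourier_pairing\<close> its value.\<close>

lemma VN_l2_inner_matrix_coeff_cong:
  assumes T: "T \<in> group_VN \<mu>" and "\<xi> \<in> L2 \<mu>" "\<eta> \<in> L2 \<mu>" "\<xi>' \<in> L2 \<mu>" "\<eta>' \<in> L2 \<mu>"
    and eq: "matrix_coeff \<mu> \<xi> \<eta> = matrix_coeff \<mu> \<xi>' \<eta>'"
  shows "l2_inner \<mu> (T \<xi>) \<eta> = l2_inner \<mu> (T \<xi>') \<eta>'"
proof -
  have "(\<Sum>i<2. l2_inner \<mu> (T (if i = 0 then \<xi> else \<xi>')) (if i = (0::nat) then \<eta> else (\<lambda>x. - \<eta>' x))) = 0"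
    using assms by (intro VN_sum_l2_inner_eq_0) (auto simp: matrix_coeff_uminus_right eval_nat_numeral)
  then show ?thesis by (simp add: l2_inner_uminus_right eval_nat_numeral)
qed

lemma fourier_pairing_matrix_coeff:
  assumes T: "T \<in> group_VN \<mu>" and "\<xi> \<in> L2 \<mu>" "\<eta> \<in> L2 \<mu>"
  shows "fourier_pairing \<mu> (matrix_coeff \<mu> \<xi> \<eta>) T = l2_inner \<mu> (T \<xi>) \<eta>"
  unfolding fourier_pairing_def
  using VN_l2_inner_matrix_coeff_cong[OF T] assms(2,3) by (intro the_equality) (metis (no_types, lifting))+

text \<open>T divided by its norm lies in the unit ball over which \<open>fourier_norm\<close> is a
  supremum. That supremum is a genuine one because the values are bounded by the product of the
  norms of the two vectors representing u.\<close>

lemma norm_fourier_pairing_le: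
  assumes T: "T \<in> reduced_group_cstar \<mu>" and u: "u \<in> fourier_algebra \<mu>"
  shows "cmod (fourier_pairing \<mu> u T) \<le> op_norm \<mu> T * fourier_norm \<mu> u"
proof -
  obtain \<xi> \<eta> where u: "u = matrix_coeff \<mu> \<xi> \<eta>" and L: "\<xi> \<in> L2 \<mu>" "\<eta> \<in> L2 \<mu>"
    using u by (auto simp: fourier_algebra_def)
  have le: "cmod (fourier_pairing \<mu> u S) \<le> op_norm \<mu> S * (l2_norm \<mu> \<xi> * l2_norm \<mu> \<eta>)" if S: "S \<in> group_VN \<mu>" for S
  proof -
    note b = VN_bounded[OF S]
    have "cmod (l2_inner \<mu> (S \<xi>) \<eta>) \<le> l2_norm \<mu> (S \<xi>) * l2_norm \<mu> \<eta>"
      by (rule norm_l2_inner_le[OF bounded_ops_L2[OF b L(1)] L(2)])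
    also have "\<dots> \<le> op_norm \<mu> S * l2_norm \<mu> \<xi> * l2_norm \<mu> \<eta>"
      by (rule mult_right_mono[OF l2_norm_le_op_norm[OF b L(1)]]) simp
    finally show ?thesis
      unfolding u fourier_pairing_matrix_coeff[OF S L] by (simp add: mult.assoc)
  qed
  show ?thesis
  proof (cases "op_norm \<mu> T = 0")
    \<comment> \<open>T cannot be rescaled here, but the direct estimate makes the pairing
      0.\<close>
    case True
    then show ?thesis using le[OF cstar_subset_VN[OF T]] by simp
  next
    case False
    define r where "r = op_norm \<mu> T"
    have r: "0 < r" using False op_norm_nonneg[OF cstar_bounded[OF T]] by (simp add: r_def less_le)
    define S where "S = (\<lambda>\<xi> x. complex_of_real (1/r) * T \<xi> x)"
    have S: "S \<in> group_VN \<mu>" unfolding S_def by (intro cstar_subset_VN cstar_cmult T)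
    have "op_norm \<mu> S \<le> 1"
    proof (rule op_norm_le)
      fix \<zeta> assume "\<zeta> \<in> L2 \<mu>"
      then have "l2_norm \<mu> (T \<zeta>) \<le> r * l2_norm \<mu> \<zeta>"
        unfolding r_def by (rule l2_norm_le_op_norm[OF cstar_bounded[OF T]])
      then show "l2_norm \<mu> (S \<zeta>) \<le> 1 * l2_norm \<mu> \<zeta>"
        using r unfolding S_def l2_norm_cmult by (simp add: norm_divide field_simps)
    qed simp
    then have "cmod (fourier_pairing \<mu> u S) \<le> fourier_norm \<mu> u"
      unfolding fourier_norm_def
    proof (intro cSUP_upper)
      show "bdd_above ((\<lambda>T. cmod (fourier_pairing \<mu> u T)) ` {T \<in> group_VN \<mu>. op_norm \<mu> T \<le> 1})"
      proof (rule bdd_aboveI2)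
        fix S assume "S \<in> {T \<in> group_VN \<mu>. op_norm \<mu> T \<le> 1}"
        then show "cmod (fourier_pairing \<mu> u S) \<le> 1 * (l2_norm \<mu> \<xi> * l2_norm \<mu> \<eta>)"
          by (intro order_trans[OF le] mult_right_mono) auto
      qed
    qed (use S in auto)
    moreover have "fourier_pairing \<mu> u S = complex_of_real (1/r) * fourier_pairing \<mu> u T"
      unfolding u fourier_pairing_matrix_coeff[OF S L] fourier_pairing_matrix_coeff[OF cstar_subset_VN[OF T] L]
      unfolding S_def l2_inner_cmult_left ..
    ultimately show ?thesis
      using r by (simp add: norm_mult norm_divide r_def field_simps)
  qed
qed

text \<open>The function is approximated by itself, so the point is that \<open>fourier_norm\<close>
  of the zero function is at most 0. As a real supremum it needs a nonempty unit ball, for which the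
  zero operator is exhibited.\<close>

lemma matrix_coeff_in_fourier_closure:
  assumes "matrix_coeff \<mu> \<xi> \<eta> \<in> S" "\<xi> \<in> L2 \<mu>" "\<eta> \<in> L2 \<mu>"
  shows "matrix_coeff \<mu> \<xi> \<eta> \<in> fourier_closure \<mu> S"
proof -
  have eq: "(\<lambda>x. 0) = matrix_coeff \<mu> (\<lambda>x. 0) (\<lambda>x. 0)"
    by (simp add: matrix_coeff_def fun_eq_iff)
  have 0: "(\<lambda>x. 0) \<in> fourier_algebra \<mu>"
    unfolding fourier_algebra_def using eq by blast
  have p0: "fourier_pairing \<mu> (\<lambda>x. 0) T = 0" if "T \<in> group_VN \<mu>" for T
    using fourier_pairing_matrix_coeff[OF that L2_zero L2_zero] by (simp add: eq[symmetric])
  have zero: "(\<lambda>\<xi> x. 0) \<in> group_VN \<mu> \<and> op_norm \<mu> (\<lambda>\<xi> x. 0) \<le> 1"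
  proof
    have b: "(\<lambda>\<xi> x. 0) \<in> bounded_ops \<mu>"
      unfolding bounded_ops_def by (auto intro!: exI[of _ 0])
    have "left_convolution \<mu> (\<lambda>x. 0) = (\<lambda>\<xi> x. 0)" by (simp add: left_convolution_def fun_eq_iff)
    then have "op_norm \<mu> (\<lambda>\<xi> x. 0 - left_convolution \<mu> (\<lambda>x. 0) \<xi> x) \<le> 0"
      by (intro op_norm_le) auto
    then have "(\<lambda>\<xi> x. 0) \<in> reduced_group_cstar \<mu>"
      unfolding reduced_group_cstar_def op_norm_closure_def using b
      by (auto intro!: exI[of _ "\<lambda>x. 0"] bexI[of _ "\<lambda>x. 0"] intro: le_less_trans)
    then show "(\<lambda>\<xi> x. 0) \<in> group_VN \<mu>" by (rule cstar_subset_VN)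
    show "op_norm \<mu> (\<lambda>\<xi> x. 0) \<le> 1" by (rule op_norm_le) auto
  qed
  have "fourier_norm \<mu> (\<lambda>x. 0) \<le> 0"
    unfolding fourier_norm_def using zero by (intro cSUP_least) (auto simp: p0)
  then show ?thesis
    unfolding fourier_closure_def using assms 0
    by (auto intro!: bexI[of _ "matrix_coeff \<mu> \<xi> \<eta>"] intro: le_less_trans simp: fourier_algebra_def[of \<mu>, THEN eqset_imp_iff, of "matrix_coeff \<mu> \<xi> \<eta>"])
qed

text \<open>The members of \<open>S\<close> are only required to be sums of matrix coefficients, which avoids
  the theorem that such sums are themselves matrix coefficients.\<close>

lemma fourier_pairing_closure_eq_0:
  assumes T: "T \<in> reduced_group_cstar \<mu>"
    and S: "\<And>w. w \<in> S \<Longrightarrow> \<exists>(n::nat) \<xi> \<eta>. (\<forall>i<n. \<xi> i \<in> L2 \<mu> \<and> \<eta> i \<in> L2 \<mu>) \<and>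
      w = (\<lambda>s. \<Sum>i<n. matrix_coeff \<mu> (\<xi> i) (\<eta> i) s) \<and> (\<forall>i<n. l2_inner \<mu> (T (\<xi> i)) (\<eta> i) = 0)"
    and u: "u \<in> fourier_closure \<mu> S"
  shows "fourier_pairing \<mu> u T = 0"
proof -
  obtain \<xi>\<^sub>0 \<eta>\<^sub>0 where u0: "u = matrix_coeff \<mu> \<xi>\<^sub>0 \<eta>\<^sub>0" and L0: "\<xi>\<^sub>0 \<in> L2 \<mu>" "\<eta>\<^sub>0 \<in> L2 \<mu>"
    using u by (auto simp: fourier_closure_def fourier_algebra_def)
  note VN = cstar_subset_VN[OF T]
  have le: "cmod (fourier_pairing \<mu> u T) \<le> op_norm \<mu> T * e" if e: "0 < e" for e
  proof -
    obtain w where w: "w \<in> S" and d: "(\<lambda>x. u x - w x) \<in> fourier_algebra \<mu>"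
      and lt: "fourier_norm \<mu> (\<lambda>x. u x - w x) < e"
      using u e unfolding fourier_closure_def by blast
    obtain \<xi>\<^sub>1 \<eta>\<^sub>1 where d1: "(\<lambda>x. u x - w x) = matrix_coeff \<mu> \<xi>\<^sub>1 \<eta>\<^sub>1" and L1: "\<xi>\<^sub>1 \<in> L2 \<mu>" "\<eta>\<^sub>1 \<in> L2 \<mu>"
      using d by (auto simp: fourier_algebra_def)
    obtain n :: nat and \<xi> \<eta> where L: "\<And>i. i < n \<Longrightarrow> \<xi> i \<in> L2 \<mu>" "\<And>i. i < n \<Longrightarrow> \<eta> i \<in> L2 \<mu>"
      and w': "w = (\<lambda>s. \<Sum>i<n. matrix_coeff \<mu> (\<xi> i) (\<eta> i) s)"
      and z: "\<And>i. i < n \<Longrightarrow> l2_inner \<mu> (T (\<xi> i)) (\<eta> i) = 0"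
      using S[OF w] by blast
    \<comment> \<open>X and Y list vectors for u, for - (u - w) and for the terms of - w. These
      coefficients add up to 0, so \<open>VN_sum_l2_inner_eq_0\<close> gives that u and u - w pair
      equally with T, the terms of w contributing 0. The pairing with u - w is small by the choice
      of w.\<close>
    define X where "X i = (case i of 0 \<Rightarrow> \<xi>\<^sub>0 | Suc 0 \<Rightarrow> \<xi>\<^sub>1 | Suc (Suc j) \<Rightarrow> \<xi> j)" for i
    define Y where "Y i = (case i of 0 \<Rightarrow> \<eta>\<^sub>0 | Suc 0 \<Rightarrow> (\<lambda>x. - \<eta>\<^sub>1 x) | Suc (Suc j) \<Rightarrow> (\<lambda>x. - \<eta> j x))" for i
    have "(\<Sum>i<Suc (Suc n). l2_inner \<mu> (T (X i)) (Y i)) = 0"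
    proof (rule VN_sum_l2_inner_eq_0[OF VN])
      show "X i \<in> L2 \<mu>" "Y i \<in> L2 \<mu>" if "i < Suc (Suc n)" for i
        using that L L0 L1 by (auto simp: X_def Y_def split: nat.splits)
      fix s
      have "u s - w s = matrix_coeff \<mu> \<xi>\<^sub>1 \<eta>\<^sub>1 s" using d1 by (simp add: fun_eq_iff)
      then show "(\<Sum>i<Suc (Suc n). matrix_coeff \<mu> (X i) (Y i) s) = 0"
        by (simp add: sum.lessThan_Suc_shift X_def Y_def matrix_coeff_uminus_right sum_negf u0 w' algebra_simps del: sum.lessThan_Suc)
    qed
    then have "l2_inner \<mu> (T \<xi>\<^sub>0) \<eta>\<^sub>0 = l2_inner \<mu> (T \<xi>\<^sub>1) \<eta>\<^sub>1"
      using z by (simp add: sum.lessThan_Suc_shift X_def Y_def l2_inner_uminus_right sum_negf del: sum.lessThan_Suc)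
    then have "fourier_pairing \<mu> u T = fourier_pairing \<mu> (\<lambda>x. u x - w x) T"
      unfolding d1 unfolding u0 by (simp add: fourier_pairing_matrix_coeff[OF VN] L0 L1)
    then have "cmod (fourier_pairing \<mu> u T) \<le> op_norm \<mu> T * fourier_norm \<mu> (\<lambda>x. u x - w x)"
      using norm_fourier_pairing_le[OF T d] by simp
    also have "\<dots> \<le> op_norm \<mu> T * e"
      using lt by (intro mult_left_mono op_norm_nonneg[OF cstar_bounded[OF T]]) simp
    finally show ?thesis .
  qed
  have "cmod (fourier_pairing \<mu> u T) \<le> 0"
  proof (rule field_le_epsilon)
    fix e :: real assume e: "0 < e"
    have K: "0 \<le> op_norm \<mu> T" by (rule op_norm_nonneg[OF cstar_bounded[OF T]])
    have "op_norm \<mu> T * (e / (op_norm \<mu> T + 1)) \<le> e" using e K by (simp add: field_simps)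
    then show "cmod (fourier_pairing \<mu> u T) \<le> 0 + e"
      using le[of "e / (op_norm \<mu> T + 1)"] e K by auto
  qed
  then show ?thesis by simp
qed

end

section \<open>Products\<close>

lemma l2_inner_tendsto_geometric:
  assumes X: "\<And>n. X n \<in> L2 M" and x: "x \<in> L2 M" and \<eta>: "\<eta> \<in> L2 M"
    and le: "\<And>n. l2_norm M (\<lambda>t. x t - X n t) \<le> K * (1/2)^n"
  shows "(\<lambda>n. l2_inner M (X n) \<eta>) \<longlonglongrightarrow> l2_inner M x \<eta>"
proof (rule Lim_null_comparison[THEN LIM_zero_cancel])
  have "(\<lambda>n. (K * l2_norm M \<eta>) * (1/2)^n) \<longlonglongrightarrow> 0"
    by (intro tendsto_mult_right_zero LIMSEQ_power_zero) simp
  then show "(\<lambda>n. K * (1/2)^n * l2_norm M \<eta>) \<longlonglongrightarrow> 0" by (simp add: mult_ac)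
  have "norm (l2_inner M (X n) \<eta> - l2_inner M x \<eta>) \<le> K * (1/2)^n * l2_norm M \<eta>" for n
  proof -
    have "norm (l2_inner M (X n) \<eta> - l2_inner M x \<eta>) \<le> l2_norm M (\<lambda>t. X n t - x t) * l2_norm M \<eta>"
      using norm_l2_inner_le[OF L2_diff[OF X x] \<eta>] by (simp add: l2_inner_diff_left X x \<eta>)
    also have "\<dots> \<le> K * (1/2)^n * l2_norm M \<eta>"
      using le[of n] by (intro mult_right_mono) (simp_all add: l2_norm_minus_commute)
    finally show ?thesis .
  qed
  then show "\<forall>\<^sub>F n in sequentially. norm (l2_inner M (X n) \<eta> - l2_inner M x \<eta>) \<le> K * (1/2)^n * l2_norm M \<eta>"
    by simp
qed

lemma l2_norm_tendsto_dominated: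
  assumes [measurable]: "\<And>n. X n \<in> borel_measurable M" "x \<in> borel_measurable M"
    and w: "integrable M (\<lambda>t. (w t)\<^sup>2)"
    and lim: "\<And>t. t \<in> space M \<Longrightarrow> (\<lambda>n. X n t) \<longlonglongrightarrow> x t"
    and le: "\<And>n t. t \<in> space M \<Longrightarrow> cmod (X n t) \<le> w t" "\<And>t. t \<in> space M \<Longrightarrow> cmod (x t) \<le> w t"
  shows "(\<lambda>n. l2_norm M (\<lambda>t. x t - X n t)) \<longlonglongrightarrow> 0"
proof -
  have "(\<lambda>n. \<integral>t. (cmod (x t - X n t))\<^sup>2 \<partial>M) \<longlonglongrightarrow> (\<integral>t. 0 \<partial>M)"
  proof (rule integral_dominated_convergence)
    \<comment> \<open>The factor 4 comes from |x - X n| <= 2 w.\<close>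
    show "integrable M (\<lambda>t. 4 * (w t)\<^sup>2)" using w by simp
    show "AE t in M. (\<lambda>n. (cmod (x t - X n t))\<^sup>2) \<longlonglongrightarrow> 0"
    proof (rule AE_I2)
      fix t assume "t \<in> space M"
      then have "(\<lambda>n. (cmod (x t - X n t))\<^sup>2) \<longlonglongrightarrow> (cmod (x t - x t))\<^sup>2"
        by (intro tendsto_intros lim)
      then show "(\<lambda>n. (cmod (x t - X n t))\<^sup>2) \<longlonglongrightarrow> 0" by simp
    qed
    show "AE t in M. norm ((cmod (x t - X n t))\<^sup>2) \<le> 4 * (w t)\<^sup>2" for n
    proof (rule AE_I2)
      fix t assume t: "t \<in> space M"
      have "cmod (x t - X n t) \<le> 2 * w t"
        using norm_triangle_ineq4[of "x t" "X n t"] le(1)[OF t, of n] le(2)[OF t] by simp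
      then have "(cmod (x t - X n t))\<^sup>2 \<le> (2 * w t)\<^sup>2" by (intro power_mono) auto
      then show "norm ((cmod (x t - X n t))\<^sup>2) \<le> 4 * (w t)\<^sup>2" by (simp add: power_mult_distrib)
    qed
  qed auto
  then have "(\<lambda>n. sqrt (\<integral>t. (cmod (x t - X n t))\<^sup>2 \<partial>M)) \<longlonglongrightarrow> sqrt 0"
    by (intro tendsto_real_sqrt) simp
  then show ?thesis by (simp add: l2_norm_def)
qed

context haar_group
begin

lemma left_convolution_add_AE:
  assumes "integrable \<mu> f" "integrable \<mu> g" "\<xi> \<in> L2 \<mu>"
  shows "AE x in \<mu>. left_convolution \<mu> (\<lambda>s. f s + g s) \<xi> x = left_convolution \<mu> f \<xi> x + left_convolution \<mu> g \<xi> x"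
  using AE_integrable_convolution[OF assms(1,3)] AE_integrable_convolution[OF assms(2,3)]
  by eventually_elim (simp add: left_convolution_def distrib_right)

lemma l2_norm_convolution_add_le:
  assumes f: "integrable \<mu> f" and g: "integrable \<mu> g" and \<xi>: "\<xi> \<in> L2 \<mu>"
  shows "l2_norm \<mu> (left_convolution \<mu> (\<lambda>s. f s + g s) \<xi>)
    \<le> l2_norm \<mu> (left_convolution \<mu> f \<xi>) + l2_norm \<mu> (left_convolution \<mu> g \<xi>)"
proof -
  note L = L2_convolution[OF f \<xi>] L2_convolution[OF g \<xi>] L2_convolution[OF Bochner_Integration.integrable_add[OF f g] \<xi>]
  have "l2_norm \<mu> (left_convolution \<mu> (\<lambda>s. f s + g s) \<xi>)
      = l2_norm \<mu> (\<lambda>x. left_convolution \<mu> f \<xi> x + left_convolution \<mu> g \<xi> x)"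
    by (intro l2_norm_cong_AE left_convolution_add_AE f g \<xi> L2_measurable L2_add L)
  then show ?thesis using l2_norm_triangle[OF L(1,2)] by simp
qed

lemma l2_norm_convolution_diff:
  assumes f: "integrable \<mu> f" and g: "integrable \<mu> g" and \<xi>: "\<xi> \<in> L2 \<mu>"
  shows "l2_norm \<mu> (left_convolution \<mu> (\<lambda>s. f s - g s) \<xi>)
    = l2_norm \<mu> (\<lambda>x. left_convolution \<mu> f \<xi> x - left_convolution \<mu> g \<xi> x)"
proof (rule l2_norm_cong_AE)
  show "AE x in \<mu>. left_convolution \<mu> (\<lambda>s. f s - g s) \<xi> x = left_convolution \<mu> f \<xi> x - left_convolution \<mu> g \<xi> x"
    using AE_integrable_convolution[OF f \<xi>] AE_integrable_convolution[OF g \<xi>]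
    by eventually_elim (simp add: left_convolution_def left_diff_distrib)
qed (intro L2_measurable L2_convolution L2_diff Bochner_Integration.integrable_diff f g \<xi>)+

text \<open>The operator bound, squared and put as a nonnegative integral, so that it can be applied
  to sections and then integrated over the other variable.\<close>

lemma nn_integral_convolution_le:
  assumes f: "integrable \<mu> f" and "0 \<le> a"
    and le: "\<And>\<xi>. \<xi> \<in> L2 \<mu> \<Longrightarrow> l2_norm \<mu> (left_convolution \<mu> f \<xi>) \<le> a * l2_norm \<mu> \<xi>"
    and \<xi>: "\<xi> \<in> L2 \<mu>"
  shows "(\<integral>\<^sup>+x. ennreal ((cmod (left_convolution \<mu> f \<xi> x))\<^sup>2) \<partial>\<mu>)
    \<le> ennreal (a\<^sup>2) * (\<integral>\<^sup>+x. ennreal ((cmod (\<xi> x))\<^sup>2) \<partial>\<mu>)"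
proof -
  have "(l2_norm \<mu> (left_convolution \<mu> f \<xi>))\<^sup>2 \<le> (a * l2_norm \<mu> \<xi>)\<^sup>2"
    by (intro power_mono le \<xi>) simp
  then show ?thesis
    unfolding nn_integral_eq_l2_norm[OF \<xi>] nn_integral_eq_l2_norm[OF L2_convolution[OF f \<xi>]]
    by (simp add: ennreal_mult'[symmetric] power_mult_distrib ennreal_leI)
qed

text \<open>Triangle inequality through T. The summand 1 bounds (1/2)^n, and the factor 2 covers the
  errors of steps n and n + 1 together.\<close>

lemma cstar_convolution_seq_bounds:
  assumes T: "T \<in> reduced_group_cstar \<mu>" and f: "\<And>n. integrable \<mu> (f n)"
    and le: "\<And>n \<xi>. \<xi> \<in> L2 \<mu> \<Longrightarrow>
      l2_norm \<mu> (\<lambda>x. T \<xi> x - left_convolution \<mu> (f n) \<xi> x) \<le> (1/2)^n * l2_norm \<mu> \<xi>"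
    and \<xi>: "\<xi> \<in> L2 \<mu>"
  shows "l2_norm \<mu> (left_convolution \<mu> (f n) \<xi>) \<le> (op_norm \<mu> T + 1) * l2_norm \<mu> \<xi>"
    and "l2_norm \<mu> (\<lambda>x. left_convolution \<mu> (f (Suc n)) \<xi> x - left_convolution \<mu> (f n) \<xi> x)
      \<le> 2 * (1/2)^n * l2_norm \<mu> \<xi>"
proof -
  have LT: "T \<xi> \<in> L2 \<mu>" by (rule bounded_ops_L2[OF cstar_bounded[OF T] \<xi>])
  have Lf: "left_convolution \<mu> (f n) \<xi> \<in> L2 \<mu>" for n by (rule L2_convolution[OF f \<xi>])
  have "l2_norm \<mu> (left_convolution \<mu> (f n) \<xi>) = l2_norm \<mu> (\<lambda>x. T \<xi> x - (T \<xi> x - left_convolution \<mu> (f n) \<xi> x))"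
    by simp
  also have "\<dots> \<le> l2_norm \<mu> (T \<xi>) + l2_norm \<mu> (\<lambda>x. T \<xi> x - left_convolution \<mu> (f n) \<xi> x)"
    by (intro l2_norm_diff_le LT L2_diff Lf)
  also have "\<dots> \<le> op_norm \<mu> T * l2_norm \<mu> \<xi> + 1 * l2_norm \<mu> \<xi>"
    by (intro add_mono l2_norm_le_op_norm[OF cstar_bounded[OF T] \<xi>] order_trans[OF le[OF \<xi>, of n]] mult_right_mono power_le_one) auto
  finally show "l2_norm \<mu> (left_convolution \<mu> (f n) \<xi>) \<le> (op_norm \<mu> T + 1) * l2_norm \<mu> \<xi>"
    by (simp add: distrib_right)
  have "l2_norm \<mu> (\<lambda>x. left_convolution \<mu> (f (Suc n)) \<xi> x - left_convolution \<mu> (f n) \<xi> x) \<le>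
      l2_norm \<mu> (\<lambda>x. left_convolution \<mu> (f (Suc n)) \<xi> x - T \<xi> x) + l2_norm \<mu> (\<lambda>x. T \<xi> x - left_convolution \<mu> (f n) \<xi> x)"
    by (intro l2_norm_triangle_diff LT Lf)
  also have "\<dots> \<le> (1/2)^Suc n * l2_norm \<mu> \<xi> + (1/2)^n * l2_norm \<mu> \<xi>"
    using le[OF \<xi>, of "Suc n"] le[OF \<xi>, of n] by (subst l2_norm_minus_commute) (rule add_mono)
  also have "\<dots> \<le> 2 * (1/2)^n * l2_norm \<mu> \<xi>"
    unfolding distrib_right[symmetric] by (rule mult_right_mono) auto
  finally show "l2_norm \<mu> (\<lambda>x. left_convolution \<mu> (f (Suc n)) \<xi> x - left_convolution \<mu> (f n) \<xi> x)
      \<le> 2 * (1/2)^n * l2_norm \<mu> \<xi>" .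
qed

end

text \<open>R plays the role of W* T V, with the adjoint expressed through inner products. By
  \<open>conv\<close> the compression of a convolution operator is again a convolution operator, and
  compression shrinks distances up to the factor K^2, one K for each of V and W; so compressing
  approximants of T gives approximants of R.\<close>

lemma cstar_compression:
  assumes "haar_group \<mu>" "haar_group \<nu>" and T: "T \<in> reduced_group_cstar \<mu>" and "0 \<le> K"
    and V: "\<And>\<xi>. \<xi> \<in> L2 \<nu> \<Longrightarrow> V \<xi> \<in> L2 \<mu>" "\<And>\<xi>. \<xi> \<in> L2 \<nu> \<Longrightarrow> l2_norm \<mu> (V \<xi>) \<le> K * l2_norm \<nu> \<xi>"
    and W: "\<And>\<xi>. \<xi> \<in> L2 \<nu> \<Longrightarrow> W \<xi> \<in> L2 \<mu>" "\<And>\<xi>. \<xi> \<in> L2 \<nu> \<Longrightarrow> l2_norm \<mu> (W \<xi>) \<le> K * l2_norm \<nu> \<xi>"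
    and conv: "\<And>h. integrable \<mu> h \<Longrightarrow> \<exists>k. integrable \<nu> k \<and> (\<forall>\<xi>\<in>L2 \<nu>. \<forall>\<eta>\<in>L2 \<nu>.
      l2_inner \<nu> (left_convolution \<nu> k \<xi>) \<eta> = l2_inner \<mu> (left_convolution \<mu> h (V \<xi>)) (W \<eta>))"
  shows "\<exists>R\<in>reduced_group_cstar \<nu>. \<forall>\<xi>\<in>L2 \<nu>. \<forall>\<eta>\<in>L2 \<nu>.
    l2_inner \<nu> (R \<xi>) \<eta> = l2_inner \<mu> (T (V \<xi>)) (W \<eta>)"
proof -
  interpret M: haar_group \<mu> by fact
  interpret N: haar_group \<nu> by fact
  obtain f where f: "\<And>n. integrable \<mu> (f n)"
    "\<And>n \<xi>. \<xi> \<in> L2 \<mu> \<Longrightarrow> l2_norm \<mu> (\<lambda>x. T \<xi> x - left_convolution \<mu> (f n) \<xi> x) \<le> (1/2)^n * l2_norm \<mu> \<xi>"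
    using M.cstar_approx_seq[OF T] by blast
  have "\<forall>n. \<exists>k. integrable \<nu> k \<and> (\<forall>\<xi>\<in>L2 \<nu>. \<forall>\<eta>\<in>L2 \<nu>.
      l2_inner \<nu> (left_convolution \<nu> k \<xi>) \<eta> = l2_inner \<mu> (left_convolution \<mu> (f n) (V \<xi>)) (W \<eta>))"
    using conv f(1) by blast
  from choice[OF this] obtain k where k: "\<And>n. integrable \<nu> (k n)"
    and kf: "\<And>n \<xi> \<eta>. \<xi> \<in> L2 \<nu> \<Longrightarrow> \<eta> \<in> L2 \<nu> \<Longrightarrow>
      l2_inner \<nu> (left_convolution \<nu> (k n) \<xi>) \<eta> = l2_inner \<mu> (left_convolution \<mu> (f n) (V \<xi>)) (W \<eta>)"
    by blast
  have "l2_norm \<nu> (\<lambda>x. left_convolution \<nu> (k (Suc n)) \<xi> x - left_convolution \<nu> (k n) \<xi> x)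
      \<le> (2 * K\<^sup>2) * (1/2)^n * l2_norm \<nu> \<xi>" if \<xi>: "\<xi> \<in> L2 \<nu>" for n \<xi>
  proof -
    \<comment> \<open>Testing the difference against itself turns a bound on inner products into a
      bound on the norm: the square of the norm of \<open>\<rho>\<close> is at most a constant times
      that norm, and one factor cancels.\<close>
    define \<rho> where "\<rho> = (\<lambda>x. left_convolution \<nu> (k (Suc n)) \<xi> x - left_convolution \<nu> (k n) \<xi> x)"
    note Lk = N.L2_convolution[OF k \<xi>]
    note Lf = M.L2_convolution[OF f(1) V(1)[OF \<xi>]]
    have \<rho>: "\<rho> \<in> L2 \<nu>" unfolding \<rho>_def by (intro L2_diff Lk)
    have "l2_inner \<nu> \<rho> \<rho> = l2_inner \<nu> (left_convolution \<nu> (k (Suc n)) \<xi>) \<rho> - l2_inner \<nu> (left_convolution \<nu> (k n) \<xi>) \<rho>"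
      by (subst (1) \<rho>_def) (intro l2_inner_diff_left Lk \<rho>)
    also have "\<dots> = l2_inner \<mu> (\<lambda>x. left_convolution \<mu> (f (Suc n)) (V \<xi>) x - left_convolution \<mu> (f n) (V \<xi>) x) (W \<rho>)"
      unfolding kf[OF \<xi> \<rho>] by (intro l2_inner_diff_left[symmetric] Lf W(1) \<rho>)
    finally have "(l2_norm \<nu> \<rho>)\<^sup>2 = cmod (l2_inner \<mu> (\<lambda>x. left_convolution \<mu> (f (Suc n)) (V \<xi>) x - left_convolution \<mu> (f n) (V \<xi>) x) (W \<rho>))"
      unfolding l2_inner_self by (metis norm_of_real abs_of_nonneg zero_le_power2)
    also have "\<dots> \<le> l2_norm \<mu> (\<lambda>x. left_convolution \<mu> (f (Suc n)) (V \<xi>) x - left_convolution \<mu> (f n) (V \<xi>) x) * l2_norm \<mu> (W \<rho>)"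
      by (intro norm_l2_inner_le L2_diff Lf W(1) \<rho>)
    also have "\<dots> \<le> (2 * (1/2)^n * (K * l2_norm \<nu> \<xi>)) * (K * l2_norm \<nu> \<rho>)"
      using \<open>0 \<le> K\<close>
      by (intro mult_mono order_trans[OF M.cstar_convolution_seq_bounds(2)[OF T f V(1)[OF \<xi>]]] mult_left_mono V(2) W(2) \<xi> \<rho>) auto
    finally have "l2_norm \<nu> \<rho> * l2_norm \<nu> \<rho> \<le> ((2 * K\<^sup>2) * (1/2)^n * l2_norm \<nu> \<xi>) * l2_norm \<nu> \<rho>"
      by (simp add: power2_eq_square mult_ac)
    moreover have "0 \<le> (2 * K\<^sup>2) * (1/2)^n * l2_norm \<nu> \<xi>" by simp
    ultimately have "l2_norm \<nu> \<rho> \<le> (2 * K\<^sup>2) * (1/2)^n * l2_norm \<nu> \<xi>"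
      using l2_norm_nonneg[of \<nu> \<rho>] by (cases "l2_norm \<nu> \<rho> = 0") (simp_all add: mult_le_cancel_right)
    then show ?thesis by (simp add: \<rho>_def)
  qed
  then obtain R where R: "R \<in> reduced_group_cstar \<nu>" and Rk: "\<And>n \<xi>. \<xi> \<in> L2 \<nu> \<Longrightarrow>
      l2_norm \<nu> (\<lambda>x. R \<xi> x - left_convolution \<nu> (k n) \<xi> x) \<le> 2 * (2 * K\<^sup>2) * (1/2)^n * l2_norm \<nu> \<xi>"
    using N.cstar_limit[of k "2 * K\<^sup>2"] k by auto
  have "l2_inner \<nu> (R \<xi>) \<eta> = l2_inner \<mu> (T (V \<xi>)) (W \<eta>)" if \<xi>: "\<xi> \<in> L2 \<nu>" and \<eta>: "\<eta> \<in> L2 \<nu>" for \<xi> \<eta>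
  \<comment> \<open>By \<open>kf\<close> the same sequence of numbers converges to either
    side.\<close>
  proof (rule LIMSEQ_unique)
    show "(\<lambda>n. l2_inner \<nu> (left_convolution \<nu> (k n) \<xi>) \<eta>) \<longlonglongrightarrow> l2_inner \<nu> (R \<xi>) \<eta>"
      using Rk[OF \<xi>]
      by (intro l2_inner_tendsto_geometric[where K="2 * (2 * K\<^sup>2) * l2_norm \<nu> \<xi>"] N.L2_convolution k \<xi> \<eta>
          bounded_ops_L2[OF N.cstar_bounded[OF R]]) (simp add: mult_ac)
    show "(\<lambda>n. l2_inner \<nu> (left_convolution \<nu> (k n) \<xi>) \<eta>) \<longlonglongrightarrow> l2_inner \<mu> (T (V \<xi>)) (W \<eta>)"
      unfolding kf[OF \<xi> \<eta>] using f(2)[OF V(1)[OF \<xi>]]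
      by (intro l2_inner_tendsto_geometric[where K="l2_norm \<mu> (V \<xi>)"] M.L2_convolution f V W \<xi> \<eta>
          bounded_ops_L2[OF M.cstar_bounded[OF T]]) (simp add: mult_ac)
  qed
  then show ?thesis using R by blast
qed

section \<open>Elementary tensors in L2 of the product group\<close>

definition tensor :: "('a \<Rightarrow> complex) \<Rightarrow> ('b \<Rightarrow> complex) \<Rightarrow> 'a \<times> 'b \<Rightarrow> complex" where
  "tensor \<xi> \<xi>' = (\<lambda>(x, y). \<xi> x * \<xi>' y)"

lemma tensor_apply [simp]: "tensor \<xi> \<xi>' (x, y) = \<xi> x * \<xi>' y"
  by (simp add: tensor_def)

text \<open>The measure on the product group is an arbitrary Haar measure, so it differs from the
  product measure by a constant c. Each inner product and each convolution integral taken over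
  \<open>\<mu>\<close> brings in one factor c.\<close>

locale haar_product = haar_group_pair \<mu>\<^sub>1 \<mu>\<^sub>2 + M: haar_group \<mu>
  for \<mu>\<^sub>1 :: "'a::{topological_group_add, second_countable_topology, t2_space} measure"
    and \<mu>\<^sub>2 :: "'b::{topological_group_add, second_countable_topology, t2_space} measure"
    and \<mu> :: "('a \<times> 'b) measure" +
  fixes c :: real
  assumes c_pos: "0 < c" and density: "\<mu> = density (\<mu>\<^sub>1 \<Otimes>\<^sub>M \<mu>\<^sub>2) (\<lambda>_. ennreal c)"
begin

abbreviation "P \<equiv> \<mu>\<^sub>1 \<Otimes>\<^sub>M \<mu>\<^sub>2"

lemma measurable_P [simp]: "borel_measurable P = borel_measurable borel"
  by (rule measurable_cong_sets) auto

lemma nn_integral_product: "f \<in> borel_measurable borel \<Longrightarrow> (\<integral>\<^sup>+z. f z \<partial>\<mu>) = ennreal c * (\<integral>\<^sup>+z. f z \<partial>P)"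
  unfolding density by (subst nn_integral_density) (auto simp: nn_integral_cmult)

lemma integral_product:
  fixes f :: "'a \<times> 'b \<Rightarrow> complex"
  shows "f \<in> borel_measurable borel \<Longrightarrow> (\<integral>z. f z \<partial>\<mu>) = of_real c * (\<integral>z. f z \<partial>P)"
  unfolding density using c_pos by (subst integral_density) (auto simp: scaleR_conv_of_real)

lemma integrable_product:
  fixes f :: "'a \<times> 'b \<Rightarrow> complex"
  shows "integrable \<mu> f \<longleftrightarrow> integrable P f"
proof -
  have "integrable \<mu> f \<longleftrightarrow> integrable P f" if "f \<in> borel_measurable borel"
  proof -
    have "integrable \<mu> f \<longleftrightarrow> integrable P (\<lambda>z. c *\<^sub>R f z)"
      unfolding density using c_pos that by (subst integrable_density) auto
    moreover have "integrable P (\<lambda>z. (1/c) *\<^sub>R (c *\<^sub>R f z))" if "integrable P (\<lambda>z. c *\<^sub>R f z)"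
      by (rule integrable_scaleR_right) (rule that)
    ultimately show ?thesis using c_pos by auto
  qed
  then show ?thesis
    using borel_measurable_integrable[of P f] M.integrable_borel[of f] by auto
qed

lemma borel_measurable_tensor [measurable]:
  fixes \<xi> :: "'a \<Rightarrow> complex" and \<xi>' :: "'b \<Rightarrow> complex"
  assumes [measurable]: "\<xi> \<in> borel_measurable borel" "\<xi>' \<in> borel_measurable borel"
  shows "tensor \<xi> \<xi>' \<in> borel_measurable borel"
proof -
  have "tensor \<xi> \<xi>' \<in> borel_measurable (borel \<Otimes>\<^sub>M borel)"
    unfolding tensor_def by measurable
  then show ?thesis unfolding borel_prod .
qed

lemma nn_integral_tensor:
  assumes [measurable]: "\<xi> \<in> borel_measurable borel" "\<xi>' \<in> borel_measurable borel"
  shows "(\<integral>\<^sup>+z. ennreal (cmod (tensor \<xi> \<xi>' z) ^ n) \<partial>P)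
    = (\<integral>\<^sup>+x. ennreal (cmod (\<xi> x) ^ n) \<partial>\<mu>\<^sub>1) * (\<integral>\<^sup>+y. ennreal (cmod (\<xi>' y) ^ n) \<partial>\<mu>\<^sub>2)"
proof -
  have "(\<integral>\<^sup>+z. ennreal (cmod (tensor \<xi> \<xi>' z) ^ n) \<partial>P)
      = (\<integral>\<^sup>+x. (\<integral>\<^sup>+y. ennreal (cmod (\<xi> x) ^ n) * ennreal (cmod (\<xi>' y) ^ n) \<partial>\<mu>\<^sub>2) \<partial>\<mu>\<^sub>1)"
    by (subst M2.nn_integral_fst[symmetric]) (auto simp: norm_mult power_mult_distrib ennreal_mult')
  also have "\<dots> = (\<integral>\<^sup>+x. ennreal (cmod (\<xi> x) ^ n) \<partial>\<mu>\<^sub>1) * (\<integral>\<^sup>+y. ennreal (cmod (\<xi>' y) ^ n) \<partial>\<mu>\<^sub>2)"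
    by (simp add: nn_integral_cmult nn_integral_multc)
  finally show ?thesis .
qed

lemma integrable_tensor:
  assumes f: "integrable \<mu>\<^sub>1 f" and g: "integrable \<mu>\<^sub>2 g"
  shows "integrable \<mu> (tensor f g)"
proof -
  have m: "f \<in> borel_measurable borel" "g \<in> borel_measurable borel"
    using f g by (auto intro: M1.integrable_borel M2.integrable_borel)
  have "(\<integral>\<^sup>+z. ennreal (cmod (tensor f g z)) \<partial>P) < \<infinity>"
    using nn_integral_tensor[OF m, of 1] f g by (simp add: integrable_iff_bounded ennreal_mult_less_top)
  then show ?thesis
    unfolding integrable_product using borel_measurable_tensor[OF m] by (intro integrableI_bounded) auto
qed

lemma L2_tensor [intro]:
  assumes "\<xi> \<in> L2 \<mu>\<^sub>1" "\<xi>' \<in> L2 \<mu>\<^sub>2"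
  shows "tensor \<xi> \<xi>' \<in> L2 \<mu>"
proof -
  have m: "\<xi> \<in> borel_measurable borel" "\<xi>' \<in> borel_measurable borel"
    using assms by (auto intro: M1.L2_borel M2.L2_borel)
  have "(\<integral>\<^sup>+z. ennreal ((cmod (tensor \<xi> \<xi>' z))\<^sup>2) \<partial>\<mu>) < \<infinity>"
    using nn_integral_tensor[OF m, of 2] assms borel_measurable_tensor[OF m]
    by (simp add: nn_integral_product L2_iff_nn_integral ennreal_mult_less_top)
  then show ?thesis
    using borel_measurable_tensor[OF m] by (simp add: L2_iff_nn_integral measurable_cong_sets[OF M.sets_haar refl])
qed

lemma l2_inner_tensor:
  assumes "\<xi> \<in> L2 \<mu>\<^sub>1" "\<xi>' \<in> L2 \<mu>\<^sub>2" "\<eta> \<in> L2 \<mu>\<^sub>1" "\<eta>' \<in> L2 \<mu>\<^sub>2"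
  shows "l2_inner \<mu> (tensor \<xi> \<xi>') (tensor \<eta> \<eta>') = of_real c * (l2_inner \<mu>\<^sub>1 \<xi> \<eta> * l2_inner \<mu>\<^sub>2 \<xi>' \<eta>')"
proof -
  have int: "integrable \<mu> (\<lambda>z. tensor \<xi> \<xi>' z * cnj (tensor \<eta> \<eta>' z))"
    using assms by (intro L2_mult_cnj_integrable L2_tensor)
  have "l2_inner \<mu> (tensor \<xi> \<xi>') (tensor \<eta> \<eta>') = of_real c * (\<integral>z. tensor \<xi> \<xi>' z * cnj (tensor \<eta> \<eta>' z) \<partial>P)"
    unfolding l2_inner_def by (rule integral_product[OF M.integrable_borel[OF int]])
  also have "(\<integral>z. tensor \<xi> \<xi>' z * cnj (tensor \<eta> \<eta>' z) \<partial>P)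
      = (\<integral>x. (\<integral>y. (\<xi> x * cnj (\<eta> x)) * (\<xi>' y * cnj (\<eta>' y)) \<partial>\<mu>\<^sub>2) \<partial>\<mu>\<^sub>1)"
    using int unfolding integrable_product by (subst integral_fst'[symmetric]) (auto simp: mult_ac)
  also have "\<dots> = l2_inner \<mu>\<^sub>1 \<xi> \<eta> * l2_inner \<mu>\<^sub>2 \<xi>' \<eta>'"
    by (simp add: l2_inner_def)
  finally show ?thesis .
qed

lemma l2_norm_tensor:
  assumes "\<xi> \<in> L2 \<mu>\<^sub>1" "\<xi>' \<in> L2 \<mu>\<^sub>2"
  shows "l2_norm \<mu> (tensor \<xi> \<xi>') = sqrt c * l2_norm \<mu>\<^sub>1 \<xi> * l2_norm \<mu>\<^sub>2 \<xi>'"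
proof (rule power2_eq_imp_eq)
  have "complex_of_real ((l2_norm \<mu> (tensor \<xi> \<xi>'))\<^sup>2) = complex_of_real (c * ((l2_norm \<mu>\<^sub>1 \<xi>)\<^sup>2 * (l2_norm \<mu>\<^sub>2 \<xi>')\<^sup>2))"
    unfolding of_real_mult l2_inner_self[symmetric] using assms by (intro l2_inner_tensor)
  then show "(l2_norm \<mu> (tensor \<xi> \<xi>'))\<^sup>2 = (sqrt c * l2_norm \<mu>\<^sub>1 \<xi> * l2_norm \<mu>\<^sub>2 \<xi>')\<^sup>2"
    using c_pos unfolding of_real_eq_iff by (simp add: power_mult_distrib)
qed (use c_pos in auto)

lemma matrix_coeff_tensor:
  assumes "\<xi> \<in> L2 \<mu>\<^sub>1" "\<xi>' \<in> L2 \<mu>\<^sub>2" "\<eta> \<in> L2 \<mu>\<^sub>1" "\<eta>' \<in> L2 \<mu>\<^sub>2"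
  shows "matrix_coeff \<mu> (tensor \<xi> \<xi>') (tensor \<eta> \<eta>') (s, t)
    = of_real c * (matrix_coeff \<mu>\<^sub>1 \<xi> \<eta> s * matrix_coeff \<mu>\<^sub>2 \<xi>' \<eta>' t)"
proof -
  have "left_translation (s, t) (tensor \<xi> \<xi>') = tensor (left_translation s \<xi>) (left_translation t \<xi>')"
    by (auto simp: left_translation_def fun_eq_iff)
  then show ?thesis
    using assms by (simp add: matrix_coeff_def l2_inner_tensor M1.L2_left_translation M2.L2_left_translation)
qed

section \<open>Matrix entries and slices of convolution operators on the product\<close>

lemma integrable_mult_bounded_P:
  fixes h v :: "'a \<times> 'b \<Rightarrow> complex"
  assumes h: "integrable P h" and [measurable]: "v \<in> borel_measurable borel" and le: "\<And>z. cmod (v z) \<le> K"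
  shows "integrable P (\<lambda>z. h z * v z)"
proof (rule Bochner_Integration.integrable_bound)
  show "integrable P (\<lambda>z. K * cmod (h z))" using h by simp
  have [measurable]: "h \<in> borel_measurable borel" using borel_measurable_integrable[OF h] by simp
  show "(\<lambda>z. h z * v z) \<in> borel_measurable P" by simp
  have "cmod (h z) * cmod (v z) \<le> \<bar>K\<bar> * cmod (h z)" for z
    using order_trans[OF le abs_ge_self] by (subst mult.commute) (intro mult_right_mono, auto)
  then show "AE z in P. norm (h z * v z) \<le> norm (K * cmod (h z))"
    by (simp add: norm_mult abs_mult)
qed

text \<open>One factor c comes from the inner product inside \<open>matrix_coeff_tensor\<close>, the
  other from integrating h over \<open>\<mu>\<close> instead of the product measure.\<close>

lemma l2_inner_convolution_tensor:
  assumes h: "integrable \<mu> h" and L: "\<xi> \<in> L2 \<mu>\<^sub>1" "\<xi>' \<in> L2 \<mu>\<^sub>2" "\<eta> \<in> L2 \<mu>\<^sub>1" "\<eta>' \<in> L2 \<mu>\<^sub>2"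
  shows "integrable P (\<lambda>(s, t). h (s, t) * (matrix_coeff \<mu>\<^sub>1 \<xi> \<eta> s * matrix_coeff \<mu>\<^sub>2 \<xi>' \<eta>' t))"
    and "l2_inner \<mu> (left_convolution \<mu> h (tensor \<xi> \<xi>')) (tensor \<eta> \<eta>')
      = (of_real c)\<^sup>2 * (\<integral>(s, t). h (s, t) * (matrix_coeff \<mu>\<^sub>1 \<xi> \<eta> s * matrix_coeff \<mu>\<^sub>2 \<xi>' \<eta>' t) \<partial>P)"
proof -
  note T = L2_tensor[OF L(1,2)] L2_tensor[OF L(3,4)]
  have eq: "h z * matrix_coeff \<mu> (tensor \<xi> \<xi>') (tensor \<eta> \<eta>') z
      = of_real c * (case z of (s, t) \<Rightarrow> h (s, t) * (matrix_coeff \<mu>\<^sub>1 \<xi> \<eta> s * matrix_coeff \<mu>\<^sub>2 \<xi>' \<eta>' t))" for z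
    by (cases z) (simp add: matrix_coeff_tensor[OF L])
  note int = M.integrable_mult_matrix_coeff[OF h T]
  from int have "integrable P (\<lambda>z. of_real c * (case z of (s, t) \<Rightarrow> h (s, t) * (matrix_coeff \<mu>\<^sub>1 \<xi> \<eta> s * matrix_coeff \<mu>\<^sub>2 \<xi>' \<eta>' t)))"
    unfolding integrable_product eq .
  then show "integrable P (\<lambda>(s, t). h (s, t) * (matrix_coeff \<mu>\<^sub>1 \<xi> \<eta> s * matrix_coeff \<mu>\<^sub>2 \<xi>' \<eta>' t))"
    using c_pos integrable_mult_right[of "complex_of_real (1/c)" P] by fastforce
  show "l2_inner \<mu> (left_convolution \<mu> h (tensor \<xi> \<xi>')) (tensor \<eta> \<eta>')
      = (of_real c)\<^sup>2 * (\<integral>(s, t). h (s, t) * (matrix_coeff \<mu>\<^sub>1 \<xi> \<eta> s * matrix_coeff \<mu>\<^sub>2 \<xi>' \<eta>' t) \<partial>P)"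
    unfolding M.l2_inner_convolution[OF h T] integral_product[OF M.integrable_borel[OF int]]
    unfolding eq
    by (simp add: power2_eq_square mult.assoc)
qed

text \<open>The kernel is k(s) = c^2 times the integral of h(s, t) v(t) over t, with v the
  coefficient of \<open>\<xi>'\<close> and \<open>\<eta>'\<close>. It is integrable because v is
  bounded; c^2 is the constant of \<open>l2_inner_convolution_tensor\<close>.\<close>

lemma slice_fst:
  assumes h: "integrable \<mu> h" and L': "\<xi>' \<in> L2 \<mu>\<^sub>2" "\<eta>' \<in> L2 \<mu>\<^sub>2"
  shows "\<exists>k. integrable \<mu>\<^sub>1 k \<and> (\<forall>\<xi>\<in>L2 \<mu>\<^sub>1. \<forall>\<eta>\<in>L2 \<mu>\<^sub>1.
    l2_inner \<mu>\<^sub>1 (left_convolution \<mu>\<^sub>1 k \<xi>) \<eta> = l2_inner \<mu> (left_convolution \<mu> h (tensor \<xi> \<xi>')) (tensor \<eta> \<eta>'))"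
proof -
  define k where "k s = (of_real c)\<^sup>2 * (\<integral>t. h (s, t) * matrix_coeff \<mu>\<^sub>2 \<xi>' \<eta>' t \<partial>\<mu>\<^sub>2)" for s
  have [measurable]: "matrix_coeff \<mu>\<^sub>2 \<xi>' \<eta>' \<in> borel_measurable borel"
    using L' by (rule M2.borel_measurable_matrix_coeff)
  have "(\<lambda>z :: 'a \<times> 'b. matrix_coeff \<mu>\<^sub>2 \<xi>' \<eta>' (snd z)) \<in> borel_measurable (borel \<Otimes>\<^sub>M borel)" by measurable
  then have "integrable P (\<lambda>z. h z * matrix_coeff \<mu>\<^sub>2 \<xi>' \<eta>' (snd z))"
    using h M2.norm_matrix_coeff_le[OF L'] unfolding integrable_product borel_prod
    by (intro integrable_mult_bounded_P) auto
  from integrable_fst'[OF this] have k: "integrable \<mu>\<^sub>1 k"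
    unfolding k_def by simp
  moreover have "l2_inner \<mu>\<^sub>1 (left_convolution \<mu>\<^sub>1 k \<xi>) \<eta> = l2_inner \<mu> (left_convolution \<mu> h (tensor \<xi> \<xi>')) (tensor \<eta> \<eta>')"
    if "\<xi> \<in> L2 \<mu>\<^sub>1" "\<eta> \<in> L2 \<mu>\<^sub>1" for \<xi> \<eta>
  proof -
    note C = l2_inner_convolution_tensor[OF h that(1) L'(1) that(2) L'(2)]
    show ?thesis
      unfolding C(2) M1.l2_inner_convolution[OF k that] integral_fst'[OF C(1), symmetric] k_def
      by (simp add: mult_ac flip: integral_mult_right_zero integral_mult_left_zero)
  qed
  ultimately show ?thesis by blast
qed

lemma slice_snd:
  assumes h: "integrable \<mu> h" and L: "\<xi> \<in> L2 \<mu>\<^sub>1" "\<eta> \<in> L2 \<mu>\<^sub>1"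
  shows "\<exists>k. integrable \<mu>\<^sub>2 k \<and> (\<forall>\<xi>'\<in>L2 \<mu>\<^sub>2. \<forall>\<eta>'\<in>L2 \<mu>\<^sub>2.
    l2_inner \<mu>\<^sub>2 (left_convolution \<mu>\<^sub>2 k \<xi>') \<eta>' = l2_inner \<mu> (left_convolution \<mu> h (tensor \<xi> \<xi>')) (tensor \<eta> \<eta>'))"
proof -
  define k where "k t = (of_real c)\<^sup>2 * (\<integral>s. h (s, t) * matrix_coeff \<mu>\<^sub>1 \<xi> \<eta> s \<partial>\<mu>\<^sub>1)" for t
  have [measurable]: "matrix_coeff \<mu>\<^sub>1 \<xi> \<eta> \<in> borel_measurable borel"
    using L by (rule M1.borel_measurable_matrix_coeff)
  have "(\<lambda>z :: 'a \<times> 'b. matrix_coeff \<mu>\<^sub>1 \<xi> \<eta> (fst z)) \<in> borel_measurable (borel \<Otimes>\<^sub>M borel)" by measurable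
  then have "integrable P (\<lambda>z. h z * matrix_coeff \<mu>\<^sub>1 \<xi> \<eta> (fst z))"
    using h M1.norm_matrix_coeff_le[OF L] unfolding integrable_product borel_prod
    by (intro integrable_mult_bounded_P) auto
  then have "integrable P (case_prod (\<lambda>s t. h (s, t) * matrix_coeff \<mu>\<^sub>1 \<xi> \<eta> s))"
    by (simp add: case_prod_unfold)
  from integrable_snd[OF this] have k: "integrable \<mu>\<^sub>2 k"
    unfolding k_def by simp
  moreover have "l2_inner \<mu>\<^sub>2 (left_convolution \<mu>\<^sub>2 k \<xi>') \<eta>' = l2_inner \<mu> (left_convolution \<mu> h (tensor \<xi> \<xi>')) (tensor \<eta> \<eta>')"
    if "\<xi>' \<in> L2 \<mu>\<^sub>2" "\<eta>' \<in> L2 \<mu>\<^sub>2" for \<xi>' \<eta>'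
  proof -
    note C = l2_inner_convolution_tensor[OF h L(1) that(1) L(2) that(2)]
    show ?thesis
      unfolding C(2) M2.l2_inner_convolution[OF k that] integral_snd[OF C(1), symmetric] k_def
      by (simp add: mult_ac flip: integral_mult_right_zero integral_mult_left_zero)
  qed
  ultimately show ?thesis by blast
qed

text \<open>With this rule the measurability prover would replace the product \<open>\<sigma>\<close>-algebra by \<^const>\<open>borel\<close> and
  lose the projections.\<close>

declare P.sets_haar [measurable_cong del]

text \<open>Totality of elementary tensors as an induction rule: a property preserved by linear
  combinations and L2 limits is pushed from indicators of rectangles to indicators of Borel sets by
  a pi-lambda argument, then to simple functions, then to all of \<open>L2\<close>.\<close>

lemma tensor_total:
  assumes tensor: "\<And>\<xi> \<xi>'. \<xi> \<in> L2 \<mu>\<^sub>1 \<Longrightarrow> \<xi>' \<in> L2 \<mu>\<^sub>2 \<Longrightarrow> Q (tensor \<xi> \<xi>')"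
    and add: "\<And>\<zeta> \<zeta>'. \<zeta> \<in> L2 \<mu> \<Longrightarrow> \<zeta>' \<in> L2 \<mu> \<Longrightarrow> Q \<zeta> \<Longrightarrow> Q \<zeta>' \<Longrightarrow> Q (\<lambda>z. \<zeta> z + \<zeta>' z)"
    and cmult: "\<And>a \<zeta>. \<zeta> \<in> L2 \<mu> \<Longrightarrow> Q \<zeta> \<Longrightarrow> Q (\<lambda>z. a * \<zeta> z)"
    and closed: "\<And>\<zeta> X. \<zeta> \<in> L2 \<mu> \<Longrightarrow> (\<And>n::nat. X n \<in> L2 \<mu>) \<Longrightarrow> (\<And>n. Q (X n)) \<Longrightarrow>
      (\<lambda>n. l2_norm \<mu> (\<lambda>z. \<zeta> z - X n z)) \<longlonglongrightarrow> 0 \<Longrightarrow> Q \<zeta>"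
    and \<zeta>: "\<zeta> \<in> L2 \<mu>"
  shows "Q \<zeta>"
proof -
  have Q0: "Q (\<lambda>z. 0)"
    using cmult[OF L2_tensor[OF L2_zero L2_zero] tensor[OF L2_zero L2_zero], of 0] by simp
  have Qsum: "Q (\<lambda>z. \<Sum>i\<in>I. X i z)" if "finite I" "\<And>i. i \<in> I \<Longrightarrow> X i \<in> L2 \<mu>" "\<And>i. i \<in> I \<Longrightarrow> Q (X i)"
    for I :: "'i set" and X
    using that by (induction I rule: finite_induct) (auto intro!: Q0 add L2_sum)
  obtain A :: "nat \<Rightarrow> 'a set" where A: "range A \<subseteq> sets \<mu>\<^sub>1" "\<Union>(range A) = space \<mu>\<^sub>1" "\<And>i. emeasure \<mu>\<^sub>1 (A i) \<noteq> \<infinity>" "incseq A"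
    using M1.sigma_finite_incseq by blast
  obtain B :: "nat \<Rightarrow> 'b set" where B: "range B \<subseteq> sets \<mu>\<^sub>2" "\<Union>(range B) = space \<mu>\<^sub>2" "\<And>i. emeasure \<mu>\<^sub>2 (B i) \<noteq> \<infinity>" "incseq B"
    using M2.sigma_finite_incseq by blast
  \<comment> \<open>Indicators of Borel sets need not be square integrable. Cutting with the
    rectangles C i, which have finite measure and exhaust the space, repairs this.\<close>
  define C where "C i = A i \<times> B i" for i
  have finite_rect: "emeasure \<mu> (a \<times> b) < \<infinity>" "a \<times> b \<in> sets borel"
    if "a \<in> sets \<mu>\<^sub>1" "b \<in> sets \<mu>\<^sub>2" "emeasure \<mu>\<^sub>1 a < \<infinity>" "emeasure \<mu>\<^sub>2 b < \<infinity>" for a b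
  proof -
    have "a \<times> b \<in> sets P" using that by (intro pair_measureI)
    then show ab: "a \<times> b \<in> sets borel" unfolding sets_haar_pair .
    have "emeasure \<mu> (a \<times> b) = ennreal c * emeasure P (a \<times> b)"
      using nn_integral_product[of "indicator (a \<times> b)"] ab by simp
    also have "emeasure P (a \<times> b) = emeasure \<mu>\<^sub>1 a * emeasure \<mu>\<^sub>2 b"
      using that by (intro M2.emeasure_pair_measure_Times)
    finally show "emeasure \<mu> (a \<times> b) < \<infinity>"
      using that by (simp add: ennreal_mult_less_top)
  qed
  have AB: "A i \<in> sets \<mu>\<^sub>1" "B i \<in> sets \<mu>\<^sub>2" "emeasure \<mu>\<^sub>1 (A i) < \<infinity>" "emeasure \<mu>\<^sub>2 (B i) < \<infinity>" for i
    using A B by (auto simp: less_top)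
  have C: "C i \<in> sets borel" "emeasure \<mu> (C i) < \<infinity>" for i
    unfolding C_def using finite_rect[OF AB] by auto
  have L2C: "(\<lambda>z. indicator (E \<inter> C i) z :: complex) \<in> L2 \<mu>" if "E \<in> sets borel" for E i
  proof (rule L2_indicator)
    show "emeasure \<mu> (E \<inter> C i) < \<infinity>"
      by (rule le_less_trans[OF emeasure_mono C(2)[of i]]) (use C in auto)
  qed (use that C in auto)
  have QE: "Q (\<lambda>z. indicator (E \<inter> C i) z)" if "E \<in> sets borel" for E i
  proof -
    let ?G = "{a \<times> b | a b. a \<in> sets \<mu>\<^sub>1 \<and> b \<in> sets \<mu>\<^sub>2}"
    have rect: "Q (\<lambda>z. indicator (E \<inter> C i) z)" if EG: "E \<in> ?G" for E
    proof -
      obtain a b where ab: "E = a \<times> b" "a \<in> sets \<mu>\<^sub>1" "b \<in> sets \<mu>\<^sub>2" using EG by blast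
      have "emeasure \<mu>\<^sub>1 (a \<inter> A i) < \<infinity>"
        by (rule le_less_trans[OF emeasure_mono AB(3)[of i]]) (use AB[of i] ab in auto)
      then have 1: "(\<lambda>x. indicator (a \<inter> A i) x :: complex) \<in> L2 \<mu>\<^sub>1" using ab AB[of i] by (intro L2_indicator) auto
      have "emeasure \<mu>\<^sub>2 (b \<inter> B i) < \<infinity>"
        by (rule le_less_trans[OF emeasure_mono AB(4)[of i]]) (use AB[of i] ab in auto)
      then have 2: "(\<lambda>x. indicator (b \<inter> B i) x :: complex) \<in> L2 \<mu>\<^sub>2" using ab AB[of i] by (intro L2_indicator) auto
      have "(\<lambda>z. indicator (E \<inter> C i) z) = tensor (\<lambda>x. indicator (a \<inter> A i) x) (\<lambda>x. indicator (b \<inter> B i) x)"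
        by (auto simp: tensor_def ab C_def indicator_def fun_eq_iff)
      then show ?thesis using tensor[OF 1 2] by simp
    qed
    have UG: "UNIV \<in> ?G" using sets.top[of \<mu>\<^sub>1] sets.top[of \<mu>\<^sub>2] by (auto intro!: exI[of _ UNIV])
    have sig: "sigma_sets UNIV ?G = sets borel"
      using sets_pair_measure[of \<mu>\<^sub>1 \<mu>\<^sub>2] unfolding sets_haar_pair by simp
    \<comment> \<open>The index i stays fixed during the induction: rectangles are stable under
      intersection and generate the Borel sets.\<close>
    have "Int_stable ?G" by (rule Int_stable_pair_measure_generator)
    moreover have "?G \<subseteq> Pow UNIV" by simp
    moreover have "E \<in> sigma_sets UNIV ?G" using that unfolding sig .
    ultimately show ?thesis
    proof (induction rule: sigma_sets_induct_disjoint)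
      case (basic E) then show ?case by (rule rect)
    next
      case empty show ?case using Q0 by simp
    next
      case (compl E)
      then have E: "E \<in> sets borel" unfolding sig by simp
      \<comment> \<open>The complement is formed inside C i, as a difference of two square
        integrable indicators.\<close>
      have "Q (\<lambda>z. indicator (UNIV \<inter> C i) z + (-1) * indicator (E \<inter> C i) z)"
        using compl(2) E by (intro add cmult L2_cmult L2C rect[OF UG]) auto
      moreover have "(\<lambda>z. indicator (UNIV \<inter> C i) z + (-1) * indicator (E \<inter> C i) z) = (\<lambda>z. indicator ((UNIV - E) \<inter> C i) z :: complex)"
        by (auto simp: indicator_def fun_eq_iff)
      ultimately show ?case by simp
    next
      case (union E)
      then have E: "E n \<in> sets borel" for n unfolding sig by auto
      have UE: "(\<Union>n. E n) \<in> sets borel" using E by auto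
      \<comment> \<open>By disjointness the partial sums are indicators themselves, so the indicator
        of C i dominates them all and their pointwise limit is an L2 limit.\<close>
      have part: "(\<Sum>j<n. indicator (E j \<inter> C i) z) = (indicator ((\<Union>j<n. E j) \<inter> C i) z :: complex)" for n z
      proof -
        have "indicator (\<Union>j\<in>{..<n}. E j) z = (\<Sum>j<n. indicator (E j) z :: complex)"
          using union(1) by (intro indicator_UN_disjoint) (auto intro: disjoint_family_on_mono)
        then show ?thesis by (simp add: indicator_inter_arith sum_distrib_right)
      qed
      show ?case
      proof (rule closed)
        show "(\<lambda>z. indicator (\<Union>(range E) \<inter> C i) z) \<in> L2 \<mu>" by (rule L2C[OF UE])
        show "(\<lambda>z. \<Sum>j<n. indicator (E j \<inter> C i) z) \<in> L2 \<mu>" for n by (intro L2_sum L2C E)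
        show "Q (\<lambda>z. \<Sum>j<n. indicator (E j \<inter> C i) z)" for n
          using union(3) by (intro Qsum L2C E) auto
        show "(\<lambda>n. l2_norm \<mu> (\<lambda>z. indicator (\<Union>(range E) \<inter> C i) z - (\<Sum>j<n. indicator (E j \<inter> C i) z))) \<longlonglongrightarrow> 0"
          unfolding part
        proof (rule l2_norm_tendsto_dominated)
          have "integrable \<mu> (\<lambda>z. indicator (C i) z :: real)"
            using C by (intro integrable_real_indicator) auto
          moreover have "(indicator (C i) z :: real)\<^sup>2 = indicator (C i) z" for z
            by (simp add: indicator_def)
          ultimately show "integrable \<mu> (\<lambda>z. (indicator (C i) z :: real)\<^sup>2)" by simp
          show "(\<lambda>z. indicator (\<Union>(range E) \<inter> C i) z :: complex) \<in> borel_measurable \<mu>"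
            by (rule L2_measurable[OF L2C[OF UE]])
          show "(\<lambda>z. indicator ((\<Union>j<n. E j) \<inter> C i) z :: complex) \<in> borel_measurable \<mu>" for n
            using E by (intro L2_measurable[OF L2C]) auto
          fix z
          show "(\<lambda>n. indicator ((\<Union>j<n. E j) \<inter> C i) z :: complex) \<longlonglongrightarrow> indicator (\<Union>(range E) \<inter> C i) z"
            using LIMSEQ_indicator_UN[of "\<lambda>j. E j \<inter> C i" z] by (simp add: UN_extend_simps del: UN_simps)
        qed (auto simp: indicator_def)
      qed
    qed
  qed
  have \<zeta>m: "\<zeta> \<in> borel_measurable \<mu>" using \<zeta> by (rule L2_measurable)
  obtain s where s: "\<And>i. simple_function \<mu> (s i)" "\<And>x. x \<in> space \<mu> \<Longrightarrow> (\<lambda>i. s i x) \<longlonglongrightarrow> \<zeta> x"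
    "\<And>i x. x \<in> space \<mu> \<Longrightarrow> dist (s i x) 0 \<le> 2 * dist (\<zeta> x) 0"
    using borel_measurable_implies_sequence_metric[OF \<zeta>m, of 0] by blast
  \<comment> \<open>The simple functions s n satisfy |s n| <= 2 |zeta|. After cutting with C n, only
    the finite measure parts of their level sets remain, so X n is a finite combination of
    indicators already covered by \<open>QE\<close>.\<close>
  define X where "X n z = s n z * indicator (C n) z" for n z
  have sv: "s n -` {v} \<in> sets borel" for n v
    using simple_functionD(2)[OF s(1)[of n], of "{v}"] by simp
  have X_eq: "X n = (\<lambda>z. \<Sum>v\<in>range (s n). v * indicator (s n -` {v} \<inter> C n) z)" for n
  proof
    fix z
    have "finite (range (s n))" using simple_functionD(1)[OF s(1)[of n]] by simp
    then have "(\<Sum>v\<in>range (s n). v * indicator (s n -` {v} \<inter> C n) z) = (\<Sum>v\<in>range (s n). if v = s n z then v * indicator (C n) z else 0)"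
      by (intro sum.cong) (auto simp: indicator_def)
    also have "\<dots> = X n z"
      using \<open>finite (range (s n))\<close> by (simp add: X_def)
    finally show "X n z = (\<Sum>v\<in>range (s n). v * indicator (s n -` {v} \<inter> C n) z)" by simp
  qed
  show ?thesis
  proof (rule closed[OF \<zeta>])
    show LX: "X n \<in> L2 \<mu>" for n unfolding X_eq by (intro L2_sum L2_cmult L2C sv)
    show "Q (X n)" for n unfolding X_eq
      using simple_functionD(1)[OF s(1)[of n]] by (intro Qsum L2_cmult cmult QE L2C sv) auto
    show "(\<lambda>n. l2_norm \<mu> (\<lambda>z. \<zeta> z - X n z)) \<longlonglongrightarrow> 0"
    proof (rule l2_norm_tendsto_dominated)
      show "integrable \<mu> (\<lambda>z. (2 * cmod (\<zeta> z))\<^sup>2)"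
        using \<zeta> by (simp add: L2_def power_mult_distrib)
      show "X n \<in> borel_measurable \<mu>" for n by (rule L2_measurable[OF LX])
      fix z :: "'a \<times> 'b" assume z: "z \<in> space \<mu>"
      show "cmod (X n z) \<le> 2 * cmod (\<zeta> z)" for n
        using s(3)[OF z, of n] by (auto simp: X_def indicator_def)
      obtain i j where "fst z \<in> A i" "snd z \<in> B j"
        using A(2) B(2) by (metis M1.space_haar M2.space_haar UNIV_I UN_E)
      \<comment> \<open>From the index max i j on, the cut has no effect at z, so X n inherits the
        pointwise limit of s n.\<close>
      then have "z \<in> C n" if "max i j \<le> n" for n
        using that incseqD[OF A(4), of i n] incseqD[OF B(4), of j n] by (auto simp: C_def mem_Times_iff)
      then have "\<forall>\<^sub>F n in sequentially. s n z = X n z"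
        by (auto simp: eventually_sequentially X_def intro!: exI[of _ "max i j"])
      then show "(\<lambda>n. X n z) \<longlonglongrightarrow> \<zeta> z" by (rule Lim_transform_eventually[OF s(2)[OF z]])
    qed (use \<zeta>m in auto)
  qed
qed

text \<open>Two passes through \<open>tensor_total\<close>. In the second argument of the inner
  product it shows that T of an elementary tensor is orthogonal to everything, hence to itself; in
  the argument of T it extends the vanishing to all vectors by boundedness.\<close>

lemma bounded_op_eq_zeroI:
  assumes T: "T \<in> bounded_ops \<mu>"
    and 0: "\<And>\<xi> \<xi>' \<eta> \<eta>'. \<xi> \<in> L2 \<mu>\<^sub>1 \<Longrightarrow> \<xi>' \<in> L2 \<mu>\<^sub>2 \<Longrightarrow> \<eta> \<in> L2 \<mu>\<^sub>1 \<Longrightarrow> \<eta>' \<in> L2 \<mu>\<^sub>2 \<Longrightarrow>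
      l2_inner \<mu> (T (tensor \<xi> \<xi>')) (tensor \<eta> \<eta>') = 0"
  shows "zero_op \<mu> T"
proof -
  have L: "T \<zeta> \<in> L2 \<mu>" if "\<zeta> \<in> L2 \<mu>" for \<zeta> by (rule bounded_ops_L2[OF T that])
  have tensor: "l2_norm \<mu> (T (tensor \<xi> \<xi>')) = 0" if \<xi>: "\<xi> \<in> L2 \<mu>\<^sub>1" "\<xi>' \<in> L2 \<mu>\<^sub>2" for \<xi> \<xi>'
  proof -
    let ?\<rho> = "T (tensor \<xi> \<xi>')"
    have \<rho>: "?\<rho> \<in> L2 \<mu>" using \<xi> by (intro L L2_tensor)
    have "l2_inner \<mu> ?\<rho> \<eta> = 0" if "\<eta> \<in> L2 \<mu>" for \<eta>
    proof (rule tensor_total[where Q="\<lambda>\<eta>. l2_inner \<mu> ?\<rho> \<eta> = 0", OF _ _ _ _ that])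
      fix \<zeta> X assume \<zeta>: "\<zeta> \<in> L2 \<mu>" and X: "\<And>n::nat. X n \<in> L2 \<mu>" "\<And>n. l2_inner \<mu> ?\<rho> (X n) = 0"
        and lim: "(\<lambda>n. l2_norm \<mu> (\<lambda>z. \<zeta> z - X n z)) \<longlonglongrightarrow> 0"
      have "cmod (l2_inner \<mu> ?\<rho> \<zeta>) \<le> l2_norm \<mu> ?\<rho> * l2_norm \<mu> (\<lambda>z. \<zeta> z - X n z)" for n
        using norm_l2_inner_le[OF \<rho> L2_diff[OF \<zeta> X(1)], of n] by (simp add: l2_inner_diff_right \<rho> \<zeta> X)
      then have "cmod (l2_inner \<mu> ?\<rho> \<zeta>) \<le> 0"
        by (intro LIMSEQ_le_const[OF tendsto_mult_right_zero[OF lim, of "l2_norm \<mu> ?\<rho>"]]) auto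
      then show "l2_inner \<mu> ?\<rho> \<zeta> = 0" by simp
    qed (auto simp: 0 \<xi> \<rho> l2_inner_add_right l2_inner_cmult_right)
    from this[OF \<rho>] show ?thesis by (simp add: l2_inner_self)
  qed
  have "l2_norm \<mu> (T \<zeta>) = 0" if "\<zeta> \<in> L2 \<mu>" for \<zeta>
  proof (rule tensor_total[where Q="\<lambda>\<zeta>. l2_norm \<mu> (T \<zeta>) = 0", OF tensor _ _ _ that])
    fix \<zeta> \<zeta>' assume \<zeta>: "\<zeta> \<in> L2 \<mu>" "\<zeta>' \<in> L2 \<mu>" "l2_norm \<mu> (T \<zeta>) = 0" "l2_norm \<mu> (T \<zeta>') = 0"
    have "l2_norm \<mu> (T (\<lambda>z. \<zeta> z + \<zeta>' z)) = l2_norm \<mu> (\<lambda>z. T \<zeta> z + T \<zeta>' z)"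
      using \<zeta> by (intro l2_norm_cong_AE bounded_ops_add_AE[OF T] L2_measurable L2_add L)
    also have "\<dots> \<le> 0" using l2_norm_triangle[OF L[OF \<zeta>(1)] L[OF \<zeta>(2)]] \<zeta> by simp
    finally show "l2_norm \<mu> (T (\<lambda>z. \<zeta> z + \<zeta>' z)) = 0" by (simp add: order.antisym)
  next
    fix a \<zeta> assume \<zeta>: "\<zeta> \<in> L2 \<mu>" "l2_norm \<mu> (T \<zeta>) = 0"
    have "l2_norm \<mu> (T (\<lambda>z. a * \<zeta> z)) = l2_norm \<mu> (\<lambda>z. a * T \<zeta> z)"
      using \<zeta> by (intro l2_norm_cong_AE bounded_ops_cmult_AE[OF T] L2_measurable L2_cmult L)
    then show "l2_norm \<mu> (T (\<lambda>z. a * \<zeta> z)) = 0" using \<zeta> by (simp add: l2_norm_cmult)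
  next
    fix \<zeta> X assume \<zeta>: "\<zeta> \<in> L2 \<mu>" and X: "\<And>n::nat. X n \<in> L2 \<mu>" "\<And>n. l2_norm \<mu> (T (X n)) = 0"
      and lim: "(\<lambda>n. l2_norm \<mu> (\<lambda>z. \<zeta> z - X n z)) \<longlonglongrightarrow> 0"
    have "l2_norm \<mu> (T \<zeta>) \<le> op_norm \<mu> T * l2_norm \<mu> (\<lambda>z. \<zeta> z - X n z)" for n
    proof -
      let ?d = "\<lambda>z. \<zeta> z - X n z"
      have d: "?d \<in> L2 \<mu>" by (intro L2_diff \<zeta> X)
      have "l2_norm \<mu> (T (\<lambda>z. ?d z + X n z)) = l2_norm \<mu> (\<lambda>z. T ?d z + T (X n) z)"
        by (intro l2_norm_cong_AE bounded_ops_add_AE[OF T] L2_measurable L2_add L d X)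
      also have "\<dots> \<le> l2_norm \<mu> (T ?d) + l2_norm \<mu> (T (X n))"
        by (intro l2_norm_triangle L d X)
      also have "\<dots> \<le> op_norm \<mu> T * l2_norm \<mu> ?d" using l2_norm_le_op_norm[OF T d] X by simp
      finally show ?thesis by simp
    qed
    then have "l2_norm \<mu> (T \<zeta>) \<le> 0"
      by (intro LIMSEQ_le_const[OF tendsto_mult_right_zero[OF lim, of "op_norm \<mu> T"]]) auto
    then show "l2_norm \<mu> (T \<zeta>) = 0" by (simp add: order.antisym)
  qed
  then show ?thesis
    unfolding zero_op_def using l2_norm_eq_0_iff[OF L] by blast
qed

text \<open>The convolution by \<open>f \<otimes> g\<close> is the convolution by \<open>g\<close> in the second variable followed by that by \<open>f\<close>
  in the first one.\<close>

lemma l2_norm_convolution_tensor_le: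
  assumes f: "integrable \<mu>\<^sub>1 f" and g: "integrable \<mu>\<^sub>2 g" and a: "0 \<le> a" and b: "0 \<le> b"
    and lef: "\<And>\<xi>. \<xi> \<in> L2 \<mu>\<^sub>1 \<Longrightarrow> l2_norm \<mu>\<^sub>1 (left_convolution \<mu>\<^sub>1 f \<xi>) \<le> a * l2_norm \<mu>\<^sub>1 \<xi>"
    and leg: "\<And>\<xi>. \<xi> \<in> L2 \<mu>\<^sub>2 \<Longrightarrow> l2_norm \<mu>\<^sub>2 (left_convolution \<mu>\<^sub>2 g \<xi>) \<le> b * l2_norm \<mu>\<^sub>2 \<xi>"
    and \<zeta>: "\<zeta> \<in> L2 \<mu>"
  shows "l2_norm \<mu> (left_convolution \<mu> (tensor f g) \<zeta>) \<le> c * a * b * l2_norm \<mu> \<zeta>"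
proof -
  have fg[measurable]: "f \<in> borel_measurable borel" "g \<in> borel_measurable borel"
    using f g by (auto intro: M1.integrable_borel M2.integrable_borel)
  have \<zeta>b: "\<zeta> \<in> borel_measurable borel" by (rule M.L2_borel[OF \<zeta>])
  then have [measurable]: "\<zeta> \<in> borel_measurable (borel \<Otimes>\<^sub>M borel)" unfolding borel_prod .
  define Z where "Z z = left_convolution \<mu>\<^sub>2 g (\<lambda>y. \<zeta> (fst z, y)) (snd z)" for z
  have Zm[measurable]: "Z \<in> borel_measurable (borel \<Otimes>\<^sub>M borel)"
    unfolding Z_def left_convolution_def left_translation_def by measurable
  define Y where "Y z = left_convolution \<mu>\<^sub>1 f (\<lambda>x. Z (x, snd z)) (fst z)" for z
  have Ym[measurable]: "Y \<in> borel_measurable (borel \<Otimes>\<^sub>M borel)"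
    unfolding Y_def left_convolution_def left_translation_def by measurable
  have Zb: "Z \<in> borel_measurable borel" and Yb: "Y \<in> borel_measurable borel"
    using Zm Ym unfolding borel_prod .
  have \<zeta>fin: "(\<integral>\<^sup>+z. ennreal ((cmod (\<zeta> z))\<^sup>2) \<partial>P) < \<infinity>"
  proof -
    have "ennreal c * (\<integral>\<^sup>+z. ennreal ((cmod (\<zeta> z))\<^sup>2) \<partial>P) < \<infinity>"
      using \<zeta> \<zeta>b nn_integral_product[of "\<lambda>z. ennreal ((cmod (\<zeta> z))\<^sup>2)"] by (simp add: L2_iff_nn_integral)
    then show ?thesis using c_pos by (auto simp: ennreal_mult_less_top less_top[symmetric])
  qed
  have Zle: "(\<integral>\<^sup>+z. ennreal ((cmod (Z z))\<^sup>2) \<partial>P) \<le> ennreal (b\<^sup>2) * (\<integral>\<^sup>+z. ennreal ((cmod (\<zeta> z))\<^sup>2) \<partial>P)"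
  proof -
    have eq: "(\<integral>\<^sup>+z. ennreal ((cmod (\<zeta> z))\<^sup>2) \<partial>P) = (\<integral>\<^sup>+x. (\<integral>\<^sup>+y. ennreal ((cmod (\<zeta> (x, y)))\<^sup>2) \<partial>\<mu>\<^sub>2) \<partial>\<mu>\<^sub>1)"
      by (rule M2.nn_integral_fst[symmetric]) (use \<zeta>b in simp)
    \<comment> \<open>Only almost every section of \<open>\<zeta>\<close> is square integrable, and
      \<open>leg\<close> speaks about square integrable functions.\<close>
    have "AE x in \<mu>\<^sub>1. (\<integral>\<^sup>+y. ennreal ((cmod (\<zeta> (x, y)))\<^sup>2) \<partial>\<mu>\<^sub>2) \<noteq> \<infinity>"
      using \<zeta>fin unfolding eq by (intro nn_integral_PInf_AE) auto
    then have ae: "AE x in \<mu>\<^sub>1. (\<integral>\<^sup>+y. ennreal ((cmod (Z (x, y)))\<^sup>2) \<partial>\<mu>\<^sub>2) \<le> ennreal (b\<^sup>2) * (\<integral>\<^sup>+y. ennreal ((cmod (\<zeta> (x, y)))\<^sup>2) \<partial>\<mu>\<^sub>2)"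
    proof eventually_elim
      case (elim x)
      then have "(\<lambda>y. \<zeta> (x, y)) \<in> L2 \<mu>\<^sub>2"
        by (simp add: L2_iff_nn_integral less_top)
      from M2.nn_integral_convolution_le[OF g b leg this] show ?case by (simp add: Z_def)
    qed
    have "(\<integral>\<^sup>+z. ennreal ((cmod (Z z))\<^sup>2) \<partial>P) = (\<integral>\<^sup>+x. (\<integral>\<^sup>+y. ennreal ((cmod (Z (x, y)))\<^sup>2) \<partial>\<mu>\<^sub>2) \<partial>\<mu>\<^sub>1)"
      by (rule M2.nn_integral_fst[symmetric]) (use Zb in simp)
    also have "\<dots> \<le> (\<integral>\<^sup>+x. ennreal (b\<^sup>2) * (\<integral>\<^sup>+y. ennreal ((cmod (\<zeta> (x, y)))\<^sup>2) \<partial>\<mu>\<^sub>2) \<partial>\<mu>\<^sub>1)"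
      by (rule nn_integral_mono_AE[OF ae])
    also have "\<dots> = ennreal (b\<^sup>2) * (\<integral>\<^sup>+z. ennreal ((cmod (\<zeta> z))\<^sup>2) \<partial>P)"
      unfolding eq by (rule nn_integral_cmult) measurable
    finally show ?thesis .
  qed
  have Yle: "(\<integral>\<^sup>+z. ennreal ((cmod (Y z))\<^sup>2) \<partial>P) \<le> ennreal (a\<^sup>2) * (\<integral>\<^sup>+z. ennreal ((cmod (Z z))\<^sup>2) \<partial>P)"
  proof -
    have eq: "(\<integral>\<^sup>+z. ennreal ((cmod (Z z))\<^sup>2) \<partial>P) = (\<integral>\<^sup>+y. (\<integral>\<^sup>+x. ennreal ((cmod (Z (x, y)))\<^sup>2) \<partial>\<mu>\<^sub>1) \<partial>\<mu>\<^sub>2)"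
      by (rule nn_integral_snd[symmetric]) (use Zb in simp)
    have "(\<integral>\<^sup>+z. ennreal ((cmod (Z z))\<^sup>2) \<partial>P) < \<infinity>"
      using \<zeta>fin by (intro le_less_trans[OF Zle]) (simp add: ennreal_mult_less_top)
    then have "AE y in \<mu>\<^sub>2. (\<integral>\<^sup>+x. ennreal ((cmod (Z (x, y)))\<^sup>2) \<partial>\<mu>\<^sub>1) \<noteq> \<infinity>"
      unfolding eq by (intro nn_integral_PInf_AE) auto
    then have ae: "AE y in \<mu>\<^sub>2. (\<integral>\<^sup>+x. ennreal ((cmod (Y (x, y)))\<^sup>2) \<partial>\<mu>\<^sub>1) \<le> ennreal (a\<^sup>2) * (\<integral>\<^sup>+x. ennreal ((cmod (Z (x, y)))\<^sup>2) \<partial>\<mu>\<^sub>1)"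
    proof eventually_elim
      case (elim y)
      then have "(\<lambda>x. Z (x, y)) \<in> L2 \<mu>\<^sub>1"
        by (simp add: L2_iff_nn_integral less_top)
      from M1.nn_integral_convolution_le[OF f a lef this] show ?case by (simp add: Y_def)
    qed
    have "(\<integral>\<^sup>+z. ennreal ((cmod (Y z))\<^sup>2) \<partial>P) = (\<integral>\<^sup>+y. (\<integral>\<^sup>+x. ennreal ((cmod (Y (x, y)))\<^sup>2) \<partial>\<mu>\<^sub>1) \<partial>\<mu>\<^sub>2)"
      by (rule nn_integral_snd[symmetric]) (use Yb in simp)
    also have "\<dots> \<le> (\<integral>\<^sup>+y. ennreal (a\<^sup>2) * (\<integral>\<^sup>+x. ennreal ((cmod (Z (x, y)))\<^sup>2) \<partial>\<mu>\<^sub>1) \<partial>\<mu>\<^sub>2)"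
      by (rule nn_integral_mono_AE[OF ae])
    also have "\<dots> = ennreal (a\<^sup>2) * (\<integral>\<^sup>+z. ennreal ((cmod (Z z))\<^sup>2) \<partial>P)"
      unfolding eq by (rule nn_integral_cmult) measurable
    finally show ?thesis .
  qed
  note fgint = integrable_tensor[OF f g]
  \<comment> \<open>The iterated formula is valid where the joint convolution integral converges
    absolutely, thus almost everywhere; c converts \<open>\<mu>\<close> into the product
    measure.\<close>
  have AE_eq: "AE z in \<mu>. left_convolution \<mu> (tensor f g) \<zeta> z = of_real c * Y z"
    using M.AE_integrable_convolution[OF fgint \<zeta>]
  proof eventually_elim
    case (elim z)
    obtain x y where z: "z = (x, y)" by (cases z)
    let ?F = "\<lambda>w. tensor f g w * left_translation w \<zeta> z"
    have "left_convolution \<mu> (tensor f g) \<zeta> z = of_real c * (\<integral>w. ?F w \<partial>P)"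
      unfolding left_convolution_def by (rule integral_product[OF M.integrable_borel[OF elim]])
    also have "(\<integral>w. ?F w \<partial>P) = (\<integral>s. (\<integral>t. ?F (s, t) \<partial>\<mu>\<^sub>2) \<partial>\<mu>\<^sub>1)"
      using elim unfolding integrable_product by (rule integral_fst'[symmetric])
    also have "\<dots> = Y z"
      by (simp add: z Y_def Z_def left_convolution_def left_translation_def mult.assoc)
    finally show ?case .
  qed
  have conv: "left_convolution \<mu> (tensor f g) \<zeta> \<in> L2 \<mu>" by (rule M.L2_convolution[OF fgint \<zeta>])
  have "(\<integral>\<^sup>+z. ennreal ((cmod (left_convolution \<mu> (tensor f g) \<zeta> z))\<^sup>2) \<partial>\<mu>) = (\<integral>\<^sup>+z. ennreal (c\<^sup>2 * (cmod (Y z))\<^sup>2) \<partial>\<mu>)"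
    by (rule nn_integral_cong_AE, use AE_eq in eventually_elim) (simp add: norm_mult power_mult_distrib)
  also have "\<dots> = ennreal c * (ennreal (c\<^sup>2) * (\<integral>\<^sup>+z. ennreal ((cmod (Y z))\<^sup>2) \<partial>P))"
    using Yb by (simp add: nn_integral_product ennreal_mult' nn_integral_cmult mult.left_commute)
  also have "\<dots> \<le> ennreal c * (ennreal (c\<^sup>2) * (ennreal (a\<^sup>2) * (ennreal (b\<^sup>2) * (\<integral>\<^sup>+z. ennreal ((cmod (\<zeta> z))\<^sup>2) \<partial>P))))"
    by (intro mult_left_mono order_trans[OF Yle] Zle) auto
  also have "\<dots> = ennreal (c\<^sup>2) * (ennreal (a\<^sup>2) * (ennreal (b\<^sup>2) * (\<integral>\<^sup>+z. ennreal ((cmod (\<zeta> z))\<^sup>2) \<partial>\<mu>)))"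
    using nn_integral_product[of "\<lambda>z. ennreal ((cmod (\<zeta> z))\<^sup>2)"] \<zeta>b by (simp add: mult_ac)
  also have "\<dots> = ennreal ((c * a * b * l2_norm \<mu> \<zeta>)\<^sup>2)"
    by (simp add: nn_integral_eq_l2_norm[OF \<zeta>] ennreal_mult'[symmetric] power_mult_distrib mult.assoc)
  finally show ?thesis
    using a b c_pos by (intro l2_norm_le_nn_integralI L2_measurable[OF conv]) auto
qed

text \<open>R is c times the tensor product of T1 and T2, since convolution by f tensor g over
  \<open>\<mu>\<close> carries a factor c; the inner product over \<open>\<mu>\<close> contributes
  the second c.\<close>

lemma cstar_tensor:
  assumes T1: "T1 \<in> reduced_group_cstar \<mu>\<^sub>1" and T2: "T2 \<in> reduced_group_cstar \<mu>\<^sub>2"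
  shows "\<exists>R\<in>reduced_group_cstar \<mu>. \<forall>\<xi>\<in>L2 \<mu>\<^sub>1. \<forall>\<eta>\<in>L2 \<mu>\<^sub>1. \<forall>\<xi>'\<in>L2 \<mu>\<^sub>2. \<forall>\<eta>'\<in>L2 \<mu>\<^sub>2.
    l2_inner \<mu> (R (tensor \<xi> \<xi>')) (tensor \<eta> \<eta>') = (of_real c)\<^sup>2 * (l2_inner \<mu>\<^sub>1 (T1 \<xi>) \<eta> * l2_inner \<mu>\<^sub>2 (T2 \<xi>') \<eta>')"
proof -
  obtain f where f: "\<And>n. integrable \<mu>\<^sub>1 (f n)"
    "\<And>n \<xi>. \<xi> \<in> L2 \<mu>\<^sub>1 \<Longrightarrow> l2_norm \<mu>\<^sub>1 (\<lambda>x. T1 \<xi> x - left_convolution \<mu>\<^sub>1 (f n) \<xi> x) \<le> (1/2)^n * l2_norm \<mu>\<^sub>1 \<xi>"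
    using M1.cstar_approx_seq[OF T1] by blast
  obtain g where g: "\<And>n. integrable \<mu>\<^sub>2 (g n)"
    "\<And>n \<xi>. \<xi> \<in> L2 \<mu>\<^sub>2 \<Longrightarrow> l2_norm \<mu>\<^sub>2 (\<lambda>x. T2 \<xi> x - left_convolution \<mu>\<^sub>2 (g n) \<xi> x) \<le> (1/2)^n * l2_norm \<mu>\<^sub>2 \<xi>"
    using M2.cstar_approx_seq[OF T2] by blast
  have bf: "l2_norm \<mu>\<^sub>1 (left_convolution \<mu>\<^sub>1 (f n) \<xi>) \<le> (op_norm \<mu>\<^sub>1 T1 + 1) * l2_norm \<mu>\<^sub>1 \<xi>"
    "l2_norm \<mu>\<^sub>1 (\<lambda>x. left_convolution \<mu>\<^sub>1 (f (Suc n)) \<xi> x - left_convolution \<mu>\<^sub>1 (f n) \<xi> x) \<le> 2 * (1/2)^n * l2_norm \<mu>\<^sub>1 \<xi>"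
    if "\<xi> \<in> L2 \<mu>\<^sub>1" for n \<xi>
    by (rule M1.cstar_convolution_seq_bounds[OF T1 f(1) _ that], rule f(2), assumption)+
  have bg: "l2_norm \<mu>\<^sub>2 (left_convolution \<mu>\<^sub>2 (g n) \<xi>) \<le> (op_norm \<mu>\<^sub>2 T2 + 1) * l2_norm \<mu>\<^sub>2 \<xi>"
    "l2_norm \<mu>\<^sub>2 (\<lambda>x. left_convolution \<mu>\<^sub>2 (g (Suc n)) \<xi> x - left_convolution \<mu>\<^sub>2 (g n) \<xi> x) \<le> 2 * (1/2)^n * l2_norm \<mu>\<^sub>2 \<xi>"
    if "\<xi> \<in> L2 \<mu>\<^sub>2" for n \<xi>
    by (rule M2.cstar_convolution_seq_bounds[OF T2 g(1) _ that], rule g(2), assumption)+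
  define A where "A = op_norm \<mu>\<^sub>1 T1 + 1"
  define B where "B = op_norm \<mu>\<^sub>2 T2 + 1"
  have AB: "0 \<le> A" "0 \<le> B"
    using op_norm_nonneg[OF M1.cstar_bounded[OF T1]] op_norm_nonneg[OF M2.cstar_bounded[OF T2]]
    by (auto simp: A_def B_def)
  have df: "integrable \<mu>\<^sub>1 (\<lambda>s. f (Suc n) s - f n s)" and dg: "integrable \<mu>\<^sub>2 (\<lambda>s. g (Suc n) s - g n s)" for n
    using f g by auto
  have fg: "integrable \<mu> (tensor (f n) (g n))" for n by (intro integrable_tensor f g)
  have "l2_norm \<mu> (\<lambda>x. left_convolution \<mu> (tensor (f (Suc n)) (g (Suc n))) \<zeta> x - left_convolution \<mu> (tensor (f n) (g n)) \<zeta> x)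
      \<le> (2 * c * (A + B)) * (1/2)^n * l2_norm \<mu> \<zeta>" if \<zeta>: "\<zeta> \<in> L2 \<mu>" for n \<zeta>
  proof -
    \<comment> \<open>With f', g' the next terms, f' tensor g' - f tensor g = f' tensor (g' - g) +
      (f' - f) tensor g: in each summand one factor is bounded by A or B and the other is at most 2
      (1/2)^n.\<close>
    let ?D1 = "tensor (f (Suc n)) (\<lambda>t. g (Suc n) t - g n t)" and ?D2 = "tensor (\<lambda>s. f (Suc n) s - f n s) (g n)"
    have "l2_norm \<mu> (\<lambda>x. left_convolution \<mu> (tensor (f (Suc n)) (g (Suc n))) \<zeta> x - left_convolution \<mu> (tensor (f n) (g n)) \<zeta> x)
      = l2_norm \<mu> (left_convolution \<mu> (\<lambda>z. tensor (f (Suc n)) (g (Suc n)) z - tensor (f n) (g n) z) \<zeta>)"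
      by (rule M.l2_norm_convolution_diff[OF fg fg \<zeta>, symmetric])
    also have "(\<lambda>z. tensor (f (Suc n)) (g (Suc n)) z - tensor (f n) (g n) z) = (\<lambda>z. ?D1 z + ?D2 z)"
      by (auto simp: tensor_def fun_eq_iff algebra_simps)
    also have "l2_norm \<mu> (left_convolution \<mu> (\<lambda>z. ?D1 z + ?D2 z) \<zeta>)
      \<le> l2_norm \<mu> (left_convolution \<mu> ?D1 \<zeta>) + l2_norm \<mu> (left_convolution \<mu> ?D2 \<zeta>)"
      by (intro M.l2_norm_convolution_add_le integrable_tensor f g df dg \<zeta>)
    also have "\<dots> \<le> c * A * (2 * (1/2)^n) * l2_norm \<mu> \<zeta> + c * (2 * (1/2)^n) * B * l2_norm \<mu> \<zeta>"
    proof (rule add_mono)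
      show "l2_norm \<mu> (left_convolution \<mu> ?D1 \<zeta>) \<le> c * A * (2 * (1/2)^n) * l2_norm \<mu> \<zeta>"
      proof (rule l2_norm_convolution_tensor_le[OF f(1) dg _ _ _ _ \<zeta>])
        show "l2_norm \<mu>\<^sub>2 (left_convolution \<mu>\<^sub>2 (\<lambda>t. g (Suc n) t - g n t) \<xi>) \<le> 2 * (1/2)^n * l2_norm \<mu>\<^sub>2 \<xi>"
          if "\<xi> \<in> L2 \<mu>\<^sub>2" for \<xi>
          unfolding M2.l2_norm_convolution_diff[OF g(1) g(1) that] by (rule bg(2)[OF that])
      qed (use AB bf(1) in \<open>auto simp: A_def\<close>)
      show "l2_norm \<mu> (left_convolution \<mu> ?D2 \<zeta>) \<le> c * (2 * (1/2)^n) * B * l2_norm \<mu> \<zeta>"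
      proof (rule l2_norm_convolution_tensor_le[OF df g(1) _ _ _ _ \<zeta>])
        show "l2_norm \<mu>\<^sub>1 (left_convolution \<mu>\<^sub>1 (\<lambda>t. f (Suc n) t - f n t) \<xi>) \<le> 2 * (1/2)^n * l2_norm \<mu>\<^sub>1 \<xi>"
          if "\<xi> \<in> L2 \<mu>\<^sub>1" for \<xi>
          unfolding M1.l2_norm_convolution_diff[OF f(1) f(1) that] by (rule bf(2)[OF that])
      qed (use AB bg(1) in \<open>auto simp: B_def\<close>)
    qed
    also have "\<dots> = (2 * c * (A + B)) * (1/2)^n * l2_norm \<mu> \<zeta>" by (simp add: algebra_simps)
    finally show ?thesis .
  qed
  then obtain R where R: "R \<in> reduced_group_cstar \<mu>" and Rk: "\<And>n \<zeta>. \<zeta> \<in> L2 \<mu> \<Longrightarrow>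
      l2_norm \<mu> (\<lambda>x. R \<zeta> x - left_convolution \<mu> (tensor (f n) (g n)) \<zeta> x) \<le> 2 * (2 * c * (A + B)) * (1/2)^n * l2_norm \<mu> \<zeta>"
    using M.cstar_limit[of "\<lambda>n. tensor (f n) (g n)" "2 * c * (A + B)"] fg AB c_pos by auto
  have "l2_inner \<mu> (R (tensor \<xi> \<xi>')) (tensor \<eta> \<eta>') = (of_real c)\<^sup>2 * (l2_inner \<mu>\<^sub>1 (T1 \<xi>) \<eta> * l2_inner \<mu>\<^sub>2 (T2 \<xi>') \<eta>')"
    if L: "\<xi> \<in> L2 \<mu>\<^sub>1" "\<eta> \<in> L2 \<mu>\<^sub>1" "\<xi>' \<in> L2 \<mu>\<^sub>2" "\<eta>' \<in> L2 \<mu>\<^sub>2" for \<xi> \<eta> \<xi>' \<eta>'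
  proof (rule LIMSEQ_unique)
    have T: "tensor \<xi> \<xi>' \<in> L2 \<mu>" "tensor \<eta> \<eta>' \<in> L2 \<mu>" using L by auto
    show "(\<lambda>n. l2_inner \<mu> (left_convolution \<mu> (tensor (f n) (g n)) (tensor \<xi> \<xi>')) (tensor \<eta> \<eta>'))
        \<longlonglongrightarrow> l2_inner \<mu> (R (tensor \<xi> \<xi>')) (tensor \<eta> \<eta>')"
      using Rk[OF T(1)]
      by (intro l2_inner_tendsto_geometric[where K="2 * (2 * c * (A + B)) * l2_norm \<mu> (tensor \<xi> \<xi>')"] M.L2_convolution fg T
          bounded_ops_L2[OF M.cstar_bounded[OF R]]) (simp add: mult_ac)
    have eq: "l2_inner \<mu> (left_convolution \<mu> (tensor (f n) (g n)) (tensor \<xi> \<xi>')) (tensor \<eta> \<eta>')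
        = (of_real c)\<^sup>2 * (l2_inner \<mu>\<^sub>1 (left_convolution \<mu>\<^sub>1 (f n) \<xi>) \<eta> * l2_inner \<mu>\<^sub>2 (left_convolution \<mu>\<^sub>2 (g n) \<xi>') \<eta>')" for n
    proof -
      note C = l2_inner_convolution_tensor[OF fg[of n] L(1,3,2,4)]
      have "(\<integral>(s, t). tensor (f n) (g n) (s, t) * (matrix_coeff \<mu>\<^sub>1 \<xi> \<eta> s * matrix_coeff \<mu>\<^sub>2 \<xi>' \<eta>' t) \<partial>P)
          = (\<integral>s. (\<integral>t. (f n s * matrix_coeff \<mu>\<^sub>1 \<xi> \<eta> s) * (g n t * matrix_coeff \<mu>\<^sub>2 \<xi>' \<eta>' t) \<partial>\<mu>\<^sub>2) \<partial>\<mu>\<^sub>1)"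
        unfolding integral_fst'[OF C(1), symmetric] by (simp add: mult_ac)
      also have "\<dots> = l2_inner \<mu>\<^sub>1 (left_convolution \<mu>\<^sub>1 (f n) \<xi>) \<eta> * l2_inner \<mu>\<^sub>2 (left_convolution \<mu>\<^sub>2 (g n) \<xi>') \<eta>'"
        using L f(1) g(1) by (simp add: M1.l2_inner_convolution M2.l2_inner_convolution)
      finally show ?thesis unfolding C(2) by simp
    qed
    show "(\<lambda>n. l2_inner \<mu> (left_convolution \<mu> (tensor (f n) (g n)) (tensor \<xi> \<xi>')) (tensor \<eta> \<eta>'))
        \<longlonglongrightarrow> (of_real c)\<^sup>2 * (l2_inner \<mu>\<^sub>1 (T1 \<xi>) \<eta> * l2_inner \<mu>\<^sub>2 (T2 \<xi>') \<eta>')"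
      unfolding eq
    proof (intro tendsto_mult tendsto_const)
      show "(\<lambda>n. l2_inner \<mu>\<^sub>1 (left_convolution \<mu>\<^sub>1 (f n) \<xi>) \<eta>) \<longlonglongrightarrow> l2_inner \<mu>\<^sub>1 (T1 \<xi>) \<eta>"
        using f(2)[OF L(1)]
        by (intro l2_inner_tendsto_geometric[where K="l2_norm \<mu>\<^sub>1 \<xi>"] M1.L2_convolution f L
            bounded_ops_L2[OF M1.cstar_bounded[OF T1]]) (simp add: mult_ac)
      show "(\<lambda>n. l2_inner \<mu>\<^sub>2 (left_convolution \<mu>\<^sub>2 (g n) \<xi>') \<eta>') \<longlonglongrightarrow> l2_inner \<mu>\<^sub>2 (T2 \<xi>') \<eta>'"
        using g(2)[OF L(3)]
        by (intro l2_inner_tendsto_geometric[where K="l2_norm \<mu>\<^sub>2 \<xi>'"] M2.L2_convolution g L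
            bounded_ops_L2[OF M2.cstar_bounded[OF T2]]) (simp add: mult_ac)
    qed
  qed
  then show ?thesis using R by blast
qed

lemma tensor_fourier_algebra:
  assumes "u \<in> fourier_algebra \<mu>\<^sub>1" "v \<in> fourier_algebra \<mu>\<^sub>2"
  obtains \<xi> \<eta> \<xi>' \<eta>' where "\<xi> \<in> L2 \<mu>\<^sub>1" "\<eta> \<in> L2 \<mu>\<^sub>1" "\<xi>' \<in> L2 \<mu>\<^sub>2" "\<eta>' \<in> L2 \<mu>\<^sub>2"
    "tensor u v = matrix_coeff \<mu> (tensor \<xi> \<xi>') (tensor \<eta> \<eta>')"
    "\<And>T. T \<in> group_VN \<mu>\<^sub>1 \<Longrightarrow> of_real c * l2_inner \<mu>\<^sub>1 (T \<xi>) \<eta> = fourier_pairing \<mu>\<^sub>1 u T"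
    "\<And>T. T \<in> group_VN \<mu>\<^sub>2 \<Longrightarrow> l2_inner \<mu>\<^sub>2 (T \<xi>') \<eta>' = fourier_pairing \<mu>\<^sub>2 v T"
proof -
  obtain \<xi> \<eta> where u: "u = matrix_coeff \<mu>\<^sub>1 \<xi> \<eta>" "\<xi> \<in> L2 \<mu>\<^sub>1" "\<eta> \<in> L2 \<mu>\<^sub>1"
    using assms by (auto simp: fourier_algebra_def)
  obtain \<xi>' \<eta>' where v: "v = matrix_coeff \<mu>\<^sub>2 \<xi>' \<eta>'" "\<xi>' \<in> L2 \<mu>\<^sub>2" "\<eta>' \<in> L2 \<mu>\<^sub>2"
    using assms by (auto simp: fourier_algebra_def)
  define \<rho> where "\<rho> = (\<lambda>x. complex_of_real (1/c) * \<eta> x)"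
  have \<rho>: "\<rho> \<in> L2 \<mu>\<^sub>1" unfolding \<rho>_def by (intro L2_cmult u)
  have scale: "of_real c * l2_inner \<mu>\<^sub>1 \<zeta> \<rho> = l2_inner \<mu>\<^sub>1 \<zeta> \<eta>" for \<zeta>
    using c_pos unfolding \<rho>_def l2_inner_cmult_right by simp
  have "tensor u v = matrix_coeff \<mu> (tensor \<xi> \<xi>') (tensor \<rho> \<eta>')"
  proof
    fix z :: "'a \<times> 'b"
    obtain s t where z: "z = (s, t)" by (cases z)
    show "tensor u v z = matrix_coeff \<mu> (tensor \<xi> \<xi>') (tensor \<rho> \<eta>') z"
      unfolding z matrix_coeff_tensor[OF u(2) v(2) \<rho> v(3)] mult.assoc[symmetric]
      by (simp add: u v matrix_coeff_def scale)
  qed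
  then show ?thesis
    using u v \<rho> by (intro that[of \<xi> \<rho> \<xi>' \<eta>'])
      (auto simp: scale M1.fourier_pairing_matrix_coeff M2.fourier_pairing_matrix_coeff)
qed

end

section \<open>The two implications\<close>

lemma (in haar_group) zero_op_l2_inner:
  assumes "T \<in> bounded_ops \<mu>" "zero_op \<mu> T" "\<xi> \<in> L2 \<mu>" "\<eta> \<in> L2 \<mu>"
  shows "l2_inner \<mu> (T \<xi>) \<eta> = 0"
proof -
  have "l2_inner \<mu> (T \<xi>) \<eta> = l2_inner \<mu> (\<lambda>x. 0) \<eta>"
    using assms(2,3) unfolding zero_op_def
    by (intro l2_inner_cong_AE L2_measurable[OF bounded_ops_L2[OF assms(1,3)]] L2_measurable[OF L2_zero]
        L2_measurable[OF assms(4)]) blast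
  then show ?thesis by (simp add: l2_inner_def)
qed

lemma (in haar_group) not_zero_opE:
  assumes "T \<in> bounded_ops \<mu>" "\<not> zero_op \<mu> T"
  obtains \<xi> where "\<xi> \<in> L2 \<mu>" "T \<xi> \<in> L2 \<mu>" "l2_inner \<mu> (T \<xi>) (T \<xi>) \<noteq> 0"
proof -
  obtain \<xi> where \<xi>: "\<xi> \<in> L2 \<mu>" "\<not> (AE x in \<mu>. T \<xi> x = 0)"
    using assms(2) by (auto simp: zero_op_def)
  have "T \<xi> \<in> L2 \<mu>" by (rule bounded_ops_L2[OF assms(1) \<xi>(1)])
  then show ?thesis
    using that[of \<xi>] \<xi> l2_norm_eq_0_iff[of "T \<xi>" \<mu>] by (simp add: l2_inner_self)
qed

lemma alg_tensor_iff:
  "w \<in> alg_tensor U V \<longleftrightarrow> (\<exists>(n::nat) u v. (\<forall>i<n. u i \<in> U \<and> v i \<in> V) \<and> w = (\<lambda>z. \<Sum>i<n. tensor (u i) (v i) z))"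
  unfolding alg_tensor_def by (auto simp: tensor_def case_prod_unfold)

lemma zero_in_alg_tensor: "(\<lambda>z. 0) \<in> alg_tensor U V"
  unfolding alg_tensor_iff by (auto intro!: exI[of _ "0::nat"])

lemma tensor_in_alg_tensor: "u \<in> U \<Longrightarrow> v \<in> V \<Longrightarrow> tensor u v \<in> alg_tensor U V"
  unfolding alg_tensor_iff
  by (rule exI[of _ 1], rule exI[of _ "\<lambda>_. u"], rule exI[of _ "\<lambda>_. v"]) auto

lemma subspace_sumI: "u \<in> U \<Longrightarrow> v \<in> V \<Longrightarrow> (\<lambda>x. u x + v x) \<in> subspace_sum U V"
  unfolding subspace_sum_def by blast

lemma sum_lessThan_add:
  fixes f :: "nat \<Rightarrow> 'a::comm_monoid_add"
  shows "(\<Sum>i<n + m. f i) = (\<Sum>i<n. f i) + (\<Sum>i<m. f (n + i))"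
  by (induction m) (auto simp: add.assoc)

context haar_product
begin

text \<open>By \<open>fourier_pairing_closure_eq_0\<close> it is enough that R kills each elementary
  tensor with one factor in its ideal. There the entry of R is a product in which T1 or T2
  contributes 0.\<close>

lemma ideal_of_multiplicity_product:
  assumes J1: "J\<^sub>1 \<subseteq> fourier_algebra \<mu>\<^sub>1" and J2: "J\<^sub>2 \<subseteq> fourier_algebra \<mu>\<^sub>2"
    and "ideal_of_multiplicity \<mu>\<^sub>1 J\<^sub>1" "ideal_of_multiplicity \<mu>\<^sub>2 J\<^sub>2"
  shows "ideal_of_multiplicity \<mu> (fourier_closure \<mu>
    (subspace_sum (alg_tensor J\<^sub>1 (fourier_algebra \<mu>\<^sub>2)) (alg_tensor (fourier_algebra \<mu>\<^sub>1) J\<^sub>2)))"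
    (is "ideal_of_multiplicity \<mu> (fourier_closure \<mu> ?S)")
proof -
  obtain T1 where T1: "T1 \<in> reduced_group_cstar \<mu>\<^sub>1" "\<And>u. u \<in> J\<^sub>1 \<Longrightarrow> fourier_pairing \<mu>\<^sub>1 u T1 = 0" "\<not> zero_op \<mu>\<^sub>1 T1"
    using assms(3) by (auto simp: ideal_of_multiplicity_def annihilator_def)
  obtain T2 where T2: "T2 \<in> reduced_group_cstar \<mu>\<^sub>2" "\<And>u. u \<in> J\<^sub>2 \<Longrightarrow> fourier_pairing \<mu>\<^sub>2 u T2 = 0" "\<not> zero_op \<mu>\<^sub>2 T2"
    using assms(4) by (auto simp: ideal_of_multiplicity_def annihilator_def)
  obtain R where R: "R \<in> reduced_group_cstar \<mu>"
    and Rt: "\<And>\<xi> \<eta> \<xi>' \<eta>'. \<xi> \<in> L2 \<mu>\<^sub>1 \<Longrightarrow> \<eta> \<in> L2 \<mu>\<^sub>1 \<Longrightarrow> \<xi>' \<in> L2 \<mu>\<^sub>2 \<Longrightarrow> \<eta>' \<in> L2 \<mu>\<^sub>2 \<Longrightarrow>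
      l2_inner \<mu> (R (tensor \<xi> \<xi>')) (tensor \<eta> \<eta>') = (of_real c)\<^sup>2 * (l2_inner \<mu>\<^sub>1 (T1 \<xi>) \<eta> * l2_inner \<mu>\<^sub>2 (T2 \<xi>') \<eta>')"
    using cstar_tensor[OF T1(1) T2(1)] by blast
  have "\<not> zero_op \<mu> R"
  proof
    assume 0: "zero_op \<mu> R"
    obtain \<xi> where \<xi>: "\<xi> \<in> L2 \<mu>\<^sub>1" "T1 \<xi> \<in> L2 \<mu>\<^sub>1" "l2_inner \<mu>\<^sub>1 (T1 \<xi>) (T1 \<xi>) \<noteq> 0"
      using M1.not_zero_opE[OF M1.cstar_bounded[OF T1(1)] T1(3)] by blast
    obtain \<xi>' where \<xi>': "\<xi>' \<in> L2 \<mu>\<^sub>2" "T2 \<xi>' \<in> L2 \<mu>\<^sub>2" "l2_inner \<mu>\<^sub>2 (T2 \<xi>') (T2 \<xi>') \<noteq> 0"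
      using M2.not_zero_opE[OF M2.cstar_bounded[OF T2(1)] T2(3)] by blast
    \<comment> \<open>Tested against T1 xi and T2 xi', the entry of R is c^2 times the squared norms
      of these two nonzero vectors.\<close>
    show False
      using Rt[OF \<xi>(1,2) \<xi>'(1,2)] M.zero_op_l2_inner[OF M.cstar_bounded[OF R] 0 L2_tensor[OF \<xi>(1) \<xi>'(1)] L2_tensor[OF \<xi>(2) \<xi>'(2)]]
        \<xi>(3) \<xi>'(3) c_pos by simp
  qed
  moreover have "fourier_pairing \<mu> u R = 0" if "u \<in> fourier_closure \<mu> ?S" for u
  proof (rule M.fourier_pairing_closure_eq_0[OF R _ that])
    \<comment> \<open>Both vectors are packed into one pair p so that a single choice over the
      summation index suffices later.\<close>
    have single: "\<exists>p. fst p \<in> L2 \<mu> \<and> snd p \<in> L2 \<mu> \<and> tensor u v = matrix_coeff \<mu> (fst p) (snd p) \<and> l2_inner \<mu> (R (fst p)) (snd p) = 0"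
      if uv: "u \<in> fourier_algebra \<mu>\<^sub>1" "v \<in> fourier_algebra \<mu>\<^sub>2" and "u \<in> J\<^sub>1 \<or> v \<in> J\<^sub>2" for u v
    proof -
      obtain \<xi> \<eta> \<xi>' \<eta>' where L: "\<xi> \<in> L2 \<mu>\<^sub>1" "\<eta> \<in> L2 \<mu>\<^sub>1" "\<xi>' \<in> L2 \<mu>\<^sub>2" "\<eta>' \<in> L2 \<mu>\<^sub>2"
        and eq: "tensor u v = matrix_coeff \<mu> (tensor \<xi> \<xi>') (tensor \<eta> \<eta>')"
        and p: "\<And>T. T \<in> group_VN \<mu>\<^sub>1 \<Longrightarrow> of_real c * l2_inner \<mu>\<^sub>1 (T \<xi>) \<eta> = fourier_pairing \<mu>\<^sub>1 u T"
          "\<And>T. T \<in> group_VN \<mu>\<^sub>2 \<Longrightarrow> l2_inner \<mu>\<^sub>2 (T \<xi>') \<eta>' = fourier_pairing \<mu>\<^sub>2 v T"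
        using tensor_fourier_algebra[OF uv] by blast
      have "l2_inner \<mu>\<^sub>1 (T1 \<xi>) \<eta> = 0 \<or> l2_inner \<mu>\<^sub>2 (T2 \<xi>') \<eta>' = 0"
        using that(3) p(1)[OF M1.cstar_subset_VN[OF T1(1)]] p(2)[OF M2.cstar_subset_VN[OF T2(1)]] T1(2) T2(2) c_pos
        by auto
      then have "l2_inner \<mu> (R (tensor \<xi> \<xi>')) (tensor \<eta> \<eta>') = 0" using Rt[OF L] by auto
      then show ?thesis
        using L eq by (intro exI[of _ "(tensor \<xi> \<xi>', tensor \<eta> \<eta>')"]) auto
    qed
    have alg: "\<exists>(n::nat) X Y. (\<forall>i<n. X i \<in> L2 \<mu> \<and> Y i \<in> L2 \<mu>) \<and> w = (\<lambda>s. \<Sum>i<n. matrix_coeff \<mu> (X i) (Y i) s) \<and>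
        (\<forall>i<n. l2_inner \<mu> (R (X i)) (Y i) = 0)"
      if w: "w \<in> alg_tensor U V" and UV: "\<And>u v. u \<in> U \<Longrightarrow> v \<in> V \<Longrightarrow> u \<in> fourier_algebra \<mu>\<^sub>1 \<and> v \<in> fourier_algebra \<mu>\<^sub>2 \<and> (u \<in> J\<^sub>1 \<or> v \<in> J\<^sub>2)"
      for w U V
    proof -
      obtain n :: nat and u v where uv: "\<And>i. i < n \<Longrightarrow> u i \<in> U \<and> v i \<in> V" and w: "w = (\<lambda>z. \<Sum>i<n. tensor (u i) (v i) z)"
        using w unfolding alg_tensor_iff by blast
      have "\<forall>i\<in>{..<n}. \<exists>p. fst p \<in> L2 \<mu> \<and> snd p \<in> L2 \<mu> \<and> tensor (u i) (v i) = matrix_coeff \<mu> (fst p) (snd p) \<and> l2_inner \<mu> (R (fst p)) (snd p) = 0"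
        using uv UV single by blast
      from bchoice[OF this] obtain p where
        p: "\<And>i. i < n \<Longrightarrow> fst (p i) \<in> L2 \<mu> \<and> snd (p i) \<in> L2 \<mu> \<and>
          tensor (u i) (v i) = matrix_coeff \<mu> (fst (p i)) (snd (p i)) \<and> l2_inner \<mu> (R (fst (p i))) (snd (p i)) = 0"
        by blast
      then have "w = (\<lambda>s. \<Sum>i<n. matrix_coeff \<mu> (fst (p i)) (snd (p i)) s)"
        unfolding w by (intro ext sum.cong) auto
      then show ?thesis
        using p by (intro exI[of _ n] exI[of _ "\<lambda>i. fst (p i)"] exI[of _ "\<lambda>i. snd (p i)"]) auto
    qed
    fix w assume "w \<in> ?S"
    then obtain w1 w2 where w: "w = (\<lambda>x. w1 x + w2 x)" "w1 \<in> alg_tensor J\<^sub>1 (fourier_algebra \<mu>\<^sub>2)"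
      "w2 \<in> alg_tensor (fourier_algebra \<mu>\<^sub>1) J\<^sub>2" by (auto simp: subspace_sum_def)
    obtain n :: nat and X Y where 1: "\<forall>i<n. X i \<in> L2 \<mu> \<and> Y i \<in> L2 \<mu>" "w1 = (\<lambda>s. \<Sum>i<n. matrix_coeff \<mu> (X i) (Y i) s)"
      "\<forall>i<n. l2_inner \<mu> (R (X i)) (Y i) = 0"
      using alg[OF w(2)] J1 by blast
    obtain m :: nat and X' Y' where 2: "\<forall>i<m. X' i \<in> L2 \<mu> \<and> Y' i \<in> L2 \<mu>" "w2 = (\<lambda>s. \<Sum>i<m. matrix_coeff \<mu> (X' i) (Y' i) s)"
      "\<forall>i<m. l2_inner \<mu> (R (X' i)) (Y' i) = 0"
      using alg[OF w(3)] J2 by blast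
    \<comment> \<open>The two finite representations are concatenated, the second one shifted by
      n.\<close>
    define X'' Y'' where "X'' i = (if i < n then X i else X' (i - n))" and "Y'' i = (if i < n then Y i else Y' (i - n))" for i
    have "w = (\<lambda>s. \<Sum>i<n + m. matrix_coeff \<mu> (X'' i) (Y'' i) s)"
      unfolding w(1) 1(2) 2(2) sum_lessThan_add by (simp add: X''_def Y''_def)
    moreover have "X'' i \<in> L2 \<mu> \<and> Y'' i \<in> L2 \<mu> \<and> l2_inner \<mu> (R (X'' i)) (Y'' i) = 0" if "i < n + m" for i
      using that 1 2 by (simp add: X''_def Y''_def)
    ultimately show "\<exists>(n::nat) \<xi> \<eta>. (\<forall>i<n. \<xi> i \<in> L2 \<mu> \<and> \<eta> i \<in> L2 \<mu>) \<and>
        w = (\<lambda>s. \<Sum>i<n. matrix_coeff \<mu> (\<xi> i) (\<eta> i) s) \<and> (\<forall>i<n. l2_inner \<mu> (R (\<xi> i)) (\<eta> i) = 0)"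
      by blast
  qed
  ultimately show ?thesis
    using R M.cstar_subset_VN[OF R] by (auto simp: ideal_of_multiplicity_def annihilator_def)
qed

text \<open>Compression along the maps that tensor with \<open>\<xi>'\<close> and with
  \<open>\<eta>'\<close>. One constant K has to bound both, hence the sum of the two norms; sqrt c
  comes from \<open>l2_norm_tensor\<close>.\<close>

lemma cstar_slice_fst:
  assumes T: "T \<in> reduced_group_cstar \<mu>" and L: "\<xi>' \<in> L2 \<mu>\<^sub>2" "\<eta>' \<in> L2 \<mu>\<^sub>2"
  shows "\<exists>R\<in>reduced_group_cstar \<mu>\<^sub>1. \<forall>\<xi>\<in>L2 \<mu>\<^sub>1. \<forall>\<eta>\<in>L2 \<mu>\<^sub>1.
    l2_inner \<mu>\<^sub>1 (R \<xi>) \<eta> = l2_inner \<mu> (T (tensor \<xi> \<xi>')) (tensor \<eta> \<eta>')"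
proof (rule cstar_compression[OF M.haar_group_axioms M1.haar_group_axioms T,
      where V="\<lambda>\<xi>. tensor \<xi> \<xi>'" and W="\<lambda>\<eta>. tensor \<eta> \<eta>'" and K="sqrt c * (l2_norm \<mu>\<^sub>2 \<xi>' + l2_norm \<mu>\<^sub>2 \<eta>')"])
  show "l2_norm \<mu> (tensor \<xi> \<xi>') \<le> sqrt c * (l2_norm \<mu>\<^sub>2 \<xi>' + l2_norm \<mu>\<^sub>2 \<eta>') * l2_norm \<mu>\<^sub>1 \<xi>"
    "l2_norm \<mu> (tensor \<xi> \<eta>') \<le> sqrt c * (l2_norm \<mu>\<^sub>2 \<xi>' + l2_norm \<mu>\<^sub>2 \<eta>') * l2_norm \<mu>\<^sub>1 \<xi>"
    if "\<xi> \<in> L2 \<mu>\<^sub>1" for \<xi>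
    using c_pos L that by (auto simp: l2_norm_tensor algebra_simps)
qed (use c_pos L in \<open>auto intro: slice_fst\<close>)

lemma cstar_slice_snd:
  assumes T: "T \<in> reduced_group_cstar \<mu>" and L: "\<xi> \<in> L2 \<mu>\<^sub>1" "\<eta> \<in> L2 \<mu>\<^sub>1"
  shows "\<exists>R\<in>reduced_group_cstar \<mu>\<^sub>2. \<forall>\<xi>'\<in>L2 \<mu>\<^sub>2. \<forall>\<eta>'\<in>L2 \<mu>\<^sub>2.
    l2_inner \<mu>\<^sub>2 (R \<xi>') \<eta>' = l2_inner \<mu> (T (tensor \<xi> \<xi>')) (tensor \<eta> \<eta>')"
proof (rule cstar_compression[OF M.haar_group_axioms M2.haar_group_axioms T,
      where V="\<lambda>\<xi>'. tensor \<xi> \<xi>'" and W="\<lambda>\<eta>'. tensor \<eta> \<eta>'" and K="sqrt c * (l2_norm \<mu>\<^sub>1 \<xi> + l2_norm \<mu>\<^sub>1 \<eta>)"])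
  show "l2_norm \<mu> (tensor \<xi> \<xi>') \<le> sqrt c * (l2_norm \<mu>\<^sub>1 \<xi> + l2_norm \<mu>\<^sub>1 \<eta>) * l2_norm \<mu>\<^sub>2 \<xi>'"
    "l2_norm \<mu> (tensor \<eta> \<xi>') \<le> sqrt c * (l2_norm \<mu>\<^sub>1 \<xi> + l2_norm \<mu>\<^sub>1 \<eta>) * l2_norm \<mu>\<^sub>2 \<xi>'"
    if "\<xi>' \<in> L2 \<mu>\<^sub>2" for \<xi>'
    using c_pos L that by (auto simp: l2_norm_tensor algebra_simps)
qed (use c_pos L in \<open>auto intro: slice_snd\<close>)

text \<open>One nonzero entry of T is fixed. R1 freezes its vectors on the second group, R2 those on
  the first, and that same entry shows that neither slice is zero. Both annihilate because an entry
  of T vanishes as soon as one of the two coefficients lies in its ideal.\<close>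

lemma ideal_of_multiplicity_factors:
  assumes J1: "J\<^sub>1 \<subseteq> fourier_algebra \<mu>\<^sub>1" "\<And>a u. u \<in> J\<^sub>1 \<Longrightarrow> (\<lambda>x. a * u x) \<in> J\<^sub>1"
    and J2: "J\<^sub>2 \<subseteq> fourier_algebra \<mu>\<^sub>2" "\<And>a u. u \<in> J\<^sub>2 \<Longrightarrow> (\<lambda>x. a * u x) \<in> J\<^sub>2"
    and mult: "ideal_of_multiplicity \<mu> (fourier_closure \<mu>
      (subspace_sum (alg_tensor J\<^sub>1 (fourier_algebra \<mu>\<^sub>2)) (alg_tensor (fourier_algebra \<mu>\<^sub>1) J\<^sub>2)))"
  shows "ideal_of_multiplicity \<mu>\<^sub>1 J\<^sub>1 \<and> ideal_of_multiplicity \<mu>\<^sub>2 J\<^sub>2"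
proof -
  let ?S = "subspace_sum (alg_tensor J\<^sub>1 (fourier_algebra \<mu>\<^sub>2)) (alg_tensor (fourier_algebra \<mu>\<^sub>1) J\<^sub>2)"
  obtain T where T: "T \<in> reduced_group_cstar \<mu>" "\<And>u. u \<in> fourier_closure \<mu> ?S \<Longrightarrow> fourier_pairing \<mu> u T = 0" "\<not> zero_op \<mu> T"
    using mult by (auto simp: ideal_of_multiplicity_def annihilator_def)
  obtain \<xi>0 \<xi>0' \<eta>0 \<eta>0' where L0: "\<xi>0 \<in> L2 \<mu>\<^sub>1" "\<xi>0' \<in> L2 \<mu>\<^sub>2" "\<eta>0 \<in> L2 \<mu>\<^sub>1" "\<eta>0' \<in> L2 \<mu>\<^sub>2"
    and nz: "l2_inner \<mu> (T (tensor \<xi>0 \<xi>0')) (tensor \<eta>0 \<eta>0') \<noteq> 0"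
    using bounded_op_eq_zeroI[OF M.cstar_bounded[OF T(1)]] T(3) by blast
  have ann: "l2_inner \<mu> (T (tensor \<xi> \<xi>')) (tensor \<eta> \<eta>') = 0"
    if L: "\<xi> \<in> L2 \<mu>\<^sub>1" "\<xi>' \<in> L2 \<mu>\<^sub>2" "\<eta> \<in> L2 \<mu>\<^sub>1" "\<eta>' \<in> L2 \<mu>\<^sub>2"
      and J: "matrix_coeff \<mu>\<^sub>1 \<xi> \<eta> \<in> J\<^sub>1 \<or> matrix_coeff \<mu>\<^sub>2 \<xi>' \<eta>' \<in> J\<^sub>2" for \<xi> \<xi>' \<eta> \<eta>'
  proof -
    let ?u = "matrix_coeff \<mu>\<^sub>1 \<xi> \<eta>" and ?v = "matrix_coeff \<mu>\<^sub>2 \<xi>' \<eta>'"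
    let ?w = "matrix_coeff \<mu> (tensor \<xi> \<xi>') (tensor \<eta> \<eta>')"
    have A: "?u \<in> fourier_algebra \<mu>\<^sub>1" "?v \<in> fourier_algebra \<mu>\<^sub>2"
      using L by (auto simp: fourier_algebra_def)
    \<comment> \<open>The factor c can be moved into either tensor factor; it is put into the one
      that lies in the ideal, which is closed under scalars.\<close>
    have w: "?w = tensor (\<lambda>x. of_real c * ?u x) ?v" "?w = tensor ?u (\<lambda>x. of_real c * ?v x)"
      using matrix_coeff_tensor[OF L] by (auto simp: fun_eq_iff)
    have "?w \<in> ?S"
      using J
    proof
      assume "?u \<in> J\<^sub>1"
      then have "?w \<in> alg_tensor J\<^sub>1 (fourier_algebra \<mu>\<^sub>2)"
        unfolding w(1) by (intro tensor_in_alg_tensor J1(2) A)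
      \<comment> \<open>Adding the zero function from the other summand exhibits the tensor as an
        element of the sum.\<close>
      then have "(\<lambda>z. ?w z + 0) \<in> ?S"
        by (rule subspace_sumI[OF _ zero_in_alg_tensor])
      then show ?thesis by simp
    next
      assume "?v \<in> J\<^sub>2"
      then have "?w \<in> alg_tensor (fourier_algebra \<mu>\<^sub>1) J\<^sub>2"
        unfolding w(2) by (intro tensor_in_alg_tensor J2(2) A)
      then have "(\<lambda>z. 0 + ?w z) \<in> ?S"
        by (rule subspace_sumI[OF zero_in_alg_tensor])
      then show ?thesis by simp
    qed
    then have "fourier_pairing \<mu> ?w T = 0"
      using L by (intro T(2) M.matrix_coeff_in_fourier_closure) auto
    then show ?thesis
      using L by (simp add: M.fourier_pairing_matrix_coeff[OF M.cstar_subset_VN[OF T(1)]] L2_tensor)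
  qed
  obtain R1 where R1: "R1 \<in> reduced_group_cstar \<mu>\<^sub>1" and R1T: "\<And>\<xi> \<eta>. \<xi> \<in> L2 \<mu>\<^sub>1 \<Longrightarrow> \<eta> \<in> L2 \<mu>\<^sub>1 \<Longrightarrow>
      l2_inner \<mu>\<^sub>1 (R1 \<xi>) \<eta> = l2_inner \<mu> (T (tensor \<xi> \<xi>0')) (tensor \<eta> \<eta>0')"
    using cstar_slice_fst[OF T(1) L0(2,4)] by blast
  have "\<not> zero_op \<mu>\<^sub>1 R1"
    using M1.zero_op_l2_inner[OF M1.cstar_bounded[OF R1] _ L0(1,3)] R1T[OF L0(1,3)] nz by auto
  moreover have "fourier_pairing \<mu>\<^sub>1 u R1 = 0" if "u \<in> J\<^sub>1" for u
  proof -
    obtain \<xi> \<eta> where u: "u = matrix_coeff \<mu>\<^sub>1 \<xi> \<eta>" "\<xi> \<in> L2 \<mu>\<^sub>1" "\<eta> \<in> L2 \<mu>\<^sub>1"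
      using \<open>u \<in> J\<^sub>1\<close> J1(1) by (auto simp: fourier_algebra_def)
    show ?thesis
      unfolding u(1) M1.fourier_pairing_matrix_coeff[OF M1.cstar_subset_VN[OF R1] u(2,3)] R1T[OF u(2,3)]
      using that u L0 by (intro ann) auto
  qed
  moreover obtain R2 where R2: "R2 \<in> reduced_group_cstar \<mu>\<^sub>2" and R2T: "\<And>\<xi> \<eta>. \<xi> \<in> L2 \<mu>\<^sub>2 \<Longrightarrow> \<eta> \<in> L2 \<mu>\<^sub>2 \<Longrightarrow>
      l2_inner \<mu>\<^sub>2 (R2 \<xi>) \<eta> = l2_inner \<mu> (T (tensor \<xi>0 \<xi>)) (tensor \<eta>0 \<eta>)"
    using cstar_slice_snd[OF T(1) L0(1,3)] by blast
  moreover have "\<not> zero_op \<mu>\<^sub>2 R2"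
    using M2.zero_op_l2_inner[OF M2.cstar_bounded[OF R2] _ L0(2,4)] R2T[OF L0(2,4)] nz by auto
  moreover have "fourier_pairing \<mu>\<^sub>2 u R2 = 0" if "u \<in> J\<^sub>2" for u
  proof -
    obtain \<xi> \<eta> where u: "u = matrix_coeff \<mu>\<^sub>2 \<xi> \<eta>" "\<xi> \<in> L2 \<mu>\<^sub>2" "\<eta> \<in> L2 \<mu>\<^sub>2"
      using \<open>u \<in> J\<^sub>2\<close> J2(1) by (auto simp: fourier_algebra_def)
    show ?thesis
      unfolding u(1) M2.fourier_pairing_matrix_coeff[OF M2.cstar_subset_VN[OF R2] u(2,3)] R2T[OF u(2,3)]
      using that u L0 by (intro ann) auto
  qed
  ultimately show ?thesis
    using R1 R2 M1.cstar_subset_VN[OF R1] M2.cstar_subset_VN[OF R2]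
    unfolding ideal_of_multiplicity_def annihilator_def by blast
qed

end

lemma haar_groupI:
  fixes \<mu> :: "'a::{topological_group_add, second_countable_topology, t2_space} measure"
  assumes "locally compact (UNIV :: 'a set)" "left_haar_measure \<mu>"
  shows "haar_group \<mu>"
proof
  fix x :: 'a
  show "\<exists>U K. open U \<and> x \<in> U \<and> U \<subseteq> K \<and> compact K"
    using assms(1)[unfolded locally_def, rule_format, of UNIV x] by auto
qed fact

theorem theorem4p6:
  fixes \<mu>\<^sub>1 :: "'a::{topological_group_add, second_countable_topology, t2_space} measure"
    and \<mu>\<^sub>2 :: "'b::{topological_group_add, second_countable_topology, t2_space} measure"
    and \<mu> :: "('a \<times> 'b) measure"
    and J\<^sub>1 :: "('a \<Rightarrow> complex) set"
    and J\<^sub>2 :: "('b \<Rightarrow> complex) set"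
    and J :: "('a \<times> 'b \<Rightarrow> complex) set"
  assumes "locally compact (UNIV :: 'a set)"
    and "locally compact (UNIV :: 'b set)"
    and "left_haar_measure \<mu>\<^sub>1"
    and "left_haar_measure \<mu>\<^sub>2"
    and "left_haar_measure \<mu>"
    and "closed_ideal \<mu>\<^sub>1 J\<^sub>1"
    and "closed_ideal \<mu>\<^sub>2 J\<^sub>2"
    and "J = fourier_closure \<mu>
           (subspace_sum (alg_tensor J\<^sub>1 (fourier_algebra \<mu>\<^sub>2)) (alg_tensor (fourier_algebra \<mu>\<^sub>1) J\<^sub>2))"
  shows "(ideal_of_multiplicity \<mu>\<^sub>1 J\<^sub>1 \<and> ideal_of_multiplicity \<mu>\<^sub>2 J\<^sub>2) \<longleftrightarrow>
           ideal_of_multiplicity \<mu> J"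
proof -
  interpret haar_group_pair \<mu>\<^sub>1 \<mu>\<^sub>2
    using assms by (intro haar_group_pair.intro haar_groupI)
  have M: "haar_group \<mu>"
    using assms(5) by unfold_locales (rule compact_nhd_pair)
  obtain c where "0 < c" "\<mu> = density (\<mu>\<^sub>1 \<Otimes>\<^sub>M \<mu>\<^sub>2) (\<lambda>_. ennreal c)"
    using haar_measure_unique[OF P.haar_group_axioms M] by blast
  then interpret haar_product \<mu>\<^sub>1 \<mu>\<^sub>2 \<mu> c
    using M by (intro haar_product.intro haar_product_axioms.intro haar_group_pair_axioms)
  show ?thesis
    using assms(6-8) ideal_of_multiplicity_product[of J\<^sub>1 J\<^sub>2] ideal_of_multiplicity_factors[of J\<^sub>1 J\<^sub>2]
    unfolding closed_ideal_def by blast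
qed

end
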